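(* Let $n\ge 1$ and $m\geq n+1$ be integers, let $$ \frac{1}{2}\leq\gamma\leq\frac{n+1}{n+2} \quad\text{and}\quad \theta=\frac{n+1}{n}-\frac{2\gamma}{n}. $$ Then there does not exist a map $$ f\in C^{0,\gamma+}(\mathbb{B}^m,\mathbb{H}^n)\cap C^{0,\theta}(\mathbb{B}^m,\mathbb{R}^{2n+1}) $$ or a map $$ f\in C^{0,\gamma}(\mathbb{B}^m,\mathbb{H}^n)\cap C^{0,\theta+}(\mathbb{B}^m,\mathbb{R}^{2n+1}) $$ such that $f|_{\mathbb{S}^{m-1}}$ is a topological embedding.
   Context: $\mathbb{B}^m\subset\mathbb{R}^m$ is the (closed) unit ball centered at the origin and $\mathbb{S}^{m-1}$ is its boundary, the unit sphere. Heisenberg group: $\mathbb{H}^n$ is the set $\mathbb{R}^{2n+1}$ with coordinates $(x,y,t)\in\mathbb{R}^n\times\mathbb{R}^n\times\mathbb{R}$ and the Lie group law $$(x,y,t)*(x',y',t')=\Big(x+x',\,y+y',\,t+t'+2\sum_{j=1}^n(y_jx_j'-x_jy_j')\Big).$$ It is equipped with the Carnot-Carathéodory metric $d_c$: $d_c(p,q)$ is the infimum of lengths (computed with respect to a left-invariant Riemannian metric) of horizontal curves connecting $p$ and $q$, i.e. curves tangent to the distribution $\ker\alpha$, where $\alpha=dt+2\sum_{j=1}^n(x_j\,dy_j-y_j\,dx_j)$. This metric is bi-Lipschitz equivalent to the Korányi metric $d_K(p,q)=\|q^{-1}*p\|_K$, $\|(x,y,t)\|_K=(|(x,y)|^4+t^2)^{1/4}$,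 and $\mathbb{H}^n$ is regarded as a metric space with the metric $d_K$ (the function classes below do not depend on whether $d_c$ or $d_K$ is used). The intersections of classes make sense because $\mathbb{H}^n=\mathbb{R}^{2n+1}$ as sets: the first class uses the Heisenberg metric on the target, the second the Euclidean metric on the target. Hölder classes: for a metric space $(X,d)$ and $\alpha\in(0,1]$, $C^{0,\alpha}(\mathbb{B}^m,X)$ is the class of maps $f:\mathbb{B}^m\to X$ for which there is $C\geq 0$ with $d(f(x),f(y))\le C|x-y|^\alpha$ for all $x,y\in\mathbb{B}^m$. Moreover $f\in C^{0,\alpha+}(\mathbb{B}^m,X)$ means that $$\lim_{t\to0^+}\ \sup\left\{\frac{d(f(x),f(y))}{|x-y|^\alpha}:\ x,y\in\mathbb{B}^m,\ 0<|x-y|\le t\right\}=0.$$ A topological embedding is a homeomorphism onto its image. *)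

theory Defs
  imports "HOL-Analysis.Analysis"
begin

section \<open>Hoelder classes of maps into a metric space\<close>

definition holder_class :: "real \<Rightarrow> 'a::metric_space set \<Rightarrow> 'b metric \<Rightarrow> ('a \<Rightarrow> 'b) set"
  where "holder_class \<alpha> S X =
    {f. f \<in> S \<rightarrow> mspace X \<and>
        (\<exists>C\<ge>0. \<forall>x\<in>S. \<forall>y\<in>S. mdist X (f x) (f y) \<le> C * dist x y powr \<alpha>)}"

text \<open>The supremum is taken in \<^typ>\<open>ennreal\<close>, so that it is infinite when the quotients are
  unbounded.\<close>

definition holder_plus_class :: "real \<Rightarrow> 'a::metric_space set \<Rightarrow> 'b metric \<Rightarrow> ('a \<Rightarrow> 'b) set"
  where "holder_plus_class \<alpha> S X =
    {f. f \<in> S \<rightarrow> mspace X \<and>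
        ((\<lambda>t::real. Sup {ennreal (mdist X (f x) (f y) / dist x y powr \<alpha>) | x y.
                          x \<in> S \<and> y \<in> S \<and> 0 < dist x y \<and> dist x y \<le> t})
           \<longlongrightarrow> 0) (at_right 0)}"


section \<open>The Heisenberg group with the Koranyi metric\<close>

text \<open>The underlying set is \<^term>\<open>UNIV\<close> of the type below, i.e. $\mathbb{R}^{2n+1}$ with
  $n = $ \<^term>\<open>CARD('n)\<close>; the product norm of this type is the Euclidean one.\<close>

type_synonym 'n heis = "(real ^ 'n) \<times> (real ^ 'n) \<times> real"

definition heis_mult :: "'n::finite heis \<Rightarrow> 'n heis \<Rightarrow> 'n heis"
  where "heis_mult = (\<lambda>(x, y, t) (x', y', t').
    (x + x', y + y', t + t' + 2 * (\<Sum>j\<in>UNIV. y $ j * x' $ j - x $ j * y' $ j)))"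

definition heis_inv :: "'n::finite heis \<Rightarrow> 'n heis"
  where "heis_inv = (\<lambda>(x, y, t). (- x, - y, - t))"

definition koranyi_norm :: "'n::finite heis \<Rightarrow> real"
  where "koranyi_norm = (\<lambda>(x, y, t). root 4 (norm (x, y) ^ 4 + t\<^sup>2))"

definition koranyi_dist :: "'n::finite heis \<Rightarrow> 'n heis \<Rightarrow> real"
  where "koranyi_dist p q = koranyi_norm (heis_mult (heis_inv q) p)"

definition heis_metric :: "'n::finite heis metric"
  where "heis_metric = metric (UNIV, koranyi_dist)"

subsection \<open>Group laws\<close>

lemma heis_mult_inner:
  "heis_mult (x, y, t) (x', y', t') =
    (x + x', y + y', t + t' + 2 * (inner y x' - inner x y'))"
  by (simp add: heis_mult_def inner_vec_def sum_subtractf)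

lemma heis_inv_simp: "heis_inv (x, y, t) = (- x, - y, - t)"
  by (simp add: heis_inv_def)

lemma heis_mult_assoc: "heis_mult (heis_mult p q) r = heis_mult p (heis_mult q r)"
  by (cases p; cases q; cases r) (simp add: heis_mult_inner algebra_simps)

lemma heis_mult_0_left [simp]: "heis_mult 0 p = p"
  by (cases p) (simp add: heis_mult_inner zero_prod_def)

lemma heis_mult_0_right [simp]: "heis_mult p 0 = p"
  by (cases p) (simp add: heis_mult_inner zero_prod_def)

lemma heis_mult_inv_left [simp]: "heis_mult (heis_inv p) p = 0"
  by (cases p) (simp add: heis_mult_inner heis_inv_simp zero_prod_def inner_commute)

lemma heis_mult_inv_right [simp]: "heis_mult p (heis_inv p) = 0"
  by (cases p) (simp add: heis_mult_inner heis_inv_simp zero_prod_def inner_commute)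

lemma heis_inv_inv_mult: "heis_inv (heis_mult (heis_inv q) p) = heis_mult (heis_inv p) q"
  by (cases p; cases q) (simp add: heis_mult_inner heis_inv_simp algebra_simps inner_commute)

lemma heis_mult_inv_cancel: "heis_mult p (heis_mult (heis_inv p) q) = q"
  by (metis heis_mult_0_left heis_mult_assoc heis_mult_inv_right)

subsection \<open>The Koranyi distance is a metric\<close>

lemma koranyi_norm_pow4: "koranyi_norm (x, y, t) ^ 4 = norm (x, y) ^ 4 + t\<^sup>2"
  by (simp add: koranyi_norm_def)

lemma koranyi_norm_nonneg [simp]: "0 \<le> koranyi_norm p"
  by (cases p) (simp add: koranyi_norm_def)

lemma koranyi_norm_eq_0_iff [simp]: "koranyi_norm p = 0 \<longleftrightarrow> p = 0"
proof (cases p)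
  case (fields x y t)
  have "koranyi_norm p = 0 \<longleftrightarrow> norm (x, y) ^ 4 + t\<^sup>2 = 0"
    using fields by (simp add: koranyi_norm_def)
  also have "\<dots> \<longleftrightarrow> norm (x, y) ^ 4 = 0 \<and> t\<^sup>2 = 0"
    by (intro add_nonneg_eq_0_iff) auto
  finally show ?thesis using fields by (simp add: zero_prod_def)
qed

lemma koranyi_norm_inv [simp]: "koranyi_norm (heis_inv p) = koranyi_norm p"
  by (cases p) (simp add: koranyi_norm_def heis_inv_simp norm_Pair)

lemma koranyi_norm_ge:
  "norm (x, y) \<le> koranyi_norm (x, y, t)" "\<bar>t\<bar> \<le> koranyi_norm (x, y, t) ^ 2"
proof -
  have "norm (x, y) ^ 4 \<le> koranyi_norm (x, y, t) ^ 4"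
    by (simp add: koranyi_norm_pow4)
  then show "norm (x, y) \<le> koranyi_norm (x, y, t)"
    by (rule power_le_imp_le_base[of _ 3, simplified]) simp
  have "\<bar>t\<bar> ^ 2 \<le> (koranyi_norm (x, y, t) ^ 2) ^ 2"
    by (simp add: koranyi_norm_pow4 flip: power_mult)
  then show "\<bar>t\<bar> \<le> koranyi_norm (x, y, t) ^ 2"
    by (rule power2_le_imp_le) simp
qed

lemma koranyi_norm_sq: "koranyi_norm (x, y, t) ^ 2 = cmod (Complex (norm (x, y) ^ 2) t)"
proof (rule power2_eq_imp_eq)
  show "(koranyi_norm (x, y, t) ^ 2) ^ 2 = (cmod (Complex (norm (x, y) ^ 2) t)) ^ 2"
    by (simp add: koranyi_norm_pow4 cmod_power2 flip: power_mult)
qed auto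

lemma hermitian_Cauchy_Schwarz:
  fixes x y x' y' :: "real ^ 'n::finite"
  shows "cmod (Complex (inner x x' + inner y y') (inner y x' - inner x y'))
    \<le> norm (x, y) * norm (x', y')"
proof -
  define a b where "a = inner x x' + inner y y'" and "b = inner y x' - inner x y'"
  define w where "w = (a *\<^sub>R x' - b *\<^sub>R y', a *\<^sub>R y' + b *\<^sub>R x')"
  define h where "h = cmod (Complex a b)"
  have h2: "h ^ 2 = a ^ 2 + b ^ 2" by (simp add: h_def cmod_power2)
  have n2: "norm (u, v) ^ 2 = inner u u + inner v v" for u v :: "real ^ 'n"
    by (simp add: norm_Pair power2_norm_eq_inner)
  have "norm w ^ 2 = (a ^ 2 + b ^ 2) * norm (x', y') ^ 2"
    unfolding w_def n2
    unfolding inner_diff_left inner_diff_right inner_add_left inner_add_right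
      inner_scaleR_left inner_scaleR_right inner_commute[of y' x'] power2_eq_square
    by (simp add: algebra_simps)
  then have "norm w ^ 2 = (h * norm (x', y')) ^ 2"
    by (simp add: h2 power_mult_distrib)
  then have nw: "norm w = h * norm (x', y')"
    by (rule power2_eq_imp_eq) (auto simp: h_def)
  have "h ^ 2 = inner (x, y) w"
    unfolding h2 by (simp add: w_def a_def b_def algebra_simps power2_eq_square)
  also have "\<dots> \<le> norm (x, y) * norm w" by (rule norm_cauchy_schwarz)
  finally have "h * h \<le> h * (norm (x, y) * norm (x', y'))"
    by (simp add: nw power2_eq_square mult_ac)
  moreover have "0 \<le> h" by (simp add: h_def)
  ultimately have "h \<le> norm (x, y) * norm (x', y')"
    by (cases "h = 0") auto
  then show ?thesis by (simp add: h_def a_def b_def)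
qed

lemma koranyi_norm_triangle: "koranyi_norm (heis_mult p q) \<le> koranyi_norm p + koranyi_norm q"
proof (cases p; cases q)
  fix x y t x' y' t' assume p: "p = (x, y, t)" and q: "q = (x', y', t')"
  define H where "H = Complex (inner x x' + inner y y') (inner y x' - inner x y')"
  have "Complex (norm (x + x', y + y') ^ 2) (t + t' + 2 * (inner y x' - inner x y')) =
      Complex (norm (x, y) ^ 2) t + Complex (norm (x', y') ^ 2) t' + 2 * H"
    by (simp add: H_def complex_eq_iff power2_norm_eq_inner algebra_simps inner_commute)
  then have "koranyi_norm (heis_mult p q) ^ 2 =
      cmod (Complex (norm (x, y) ^ 2) t + Complex (norm (x', y') ^ 2) t' + 2 * H)"
    by (simp add: p q heis_mult_inner koranyi_norm_sq)
  also have "\<dots> \<le> koranyi_norm p ^ 2 + koranyi_norm q ^ 2 + 2 * cmod H"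
    unfolding p q koranyi_norm_sq
    by (intro norm_triangle_le add_mono order_refl) (auto simp: norm_mult)
  also have "cmod H \<le> koranyi_norm p * koranyi_norm q"
    unfolding H_def p q
    by (rule order_trans[OF hermitian_Cauchy_Schwarz]) (intro mult_mono koranyi_norm_ge, auto)
  finally have "koranyi_norm (heis_mult p q) ^ 2 \<le> (koranyi_norm p + koranyi_norm q) ^ 2"
    by (simp add: power2_sum)
  then show ?thesis by (rule power2_le_imp_le) simp
qed

lemma Metric_space_koranyi: "Metric_space (UNIV :: 'n::finite heis set) koranyi_dist"
proof
  fix p q r :: "'n heis"
  show "0 \<le> koranyi_dist p q" by (simp add: koranyi_dist_def)
  show "koranyi_dist p q = koranyi_dist q p"
    by (metis koranyi_dist_def koranyi_norm_inv heis_inv_inv_mult)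
  show "koranyi_dist p q = 0 \<longleftrightarrow> p = q"
    unfolding koranyi_dist_def koranyi_norm_eq_0_iff
    by (metis heis_mult_inv_cancel heis_mult_0_right heis_mult_inv_left)
  have "heis_mult (heis_inv r) p = heis_mult (heis_mult (heis_inv r) q) (heis_mult (heis_inv q) p)"
    by (simp add: heis_mult_assoc heis_mult_inv_cancel)
  then show "koranyi_dist p r \<le> koranyi_dist p q + koranyi_dist q r"
    unfolding koranyi_dist_def by (metis koranyi_norm_triangle add.commute)
qed

lemma mspace_heis_metric [simp]: "mspace (heis_metric :: 'n::finite heis metric) = UNIV"
  by (simp add: heis_metric_def Metric_space.mspace_metric Metric_space_koranyi)

lemma mdist_heis_metric [simp]: "mdist (heis_metric :: 'n::finite heis metric) = koranyi_dist"
  by (simp add: heis_metric_def Metric_space.mdist_metric Metric_space_koranyi)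

subsection \<open>The Koranyi metric induces the Euclidean topology\<close>

lemma continuous_on_heis_mult: "continuous_on UNIV (heis_mult (p :: 'n::finite heis))"
  unfolding heis_mult_def case_prod_unfold by (intro continuous_intros)

lemma continuous_on_koranyi_norm: "continuous_on UNIV (koranyi_norm :: 'n::finite heis \<Rightarrow> real)"
  unfolding koranyi_norm_def case_prod_unfold by (intro continuous_intros)

lemma mtopology_of_heis_metric: "mtopology_of (heis_metric :: 'n::finite heis metric) = euclidean"
proof -
  interpret K: Metric_space "UNIV :: 'n heis set" koranyi_dist by (rule Metric_space_koranyi)
  have sub: "\<exists>r>0. K.mball p r \<subseteq> ball p e" if "0 < e" for p :: "'n heis" and e
  proof -
    have "isCont (heis_mult p) 0"
      by (metis continuous_on_heis_mult continuous_on_eq_continuous_at open_UNIV UNIV_I)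
    then have "\<exists>\<delta>>0. \<forall>u. norm (u - 0) < \<delta> \<longrightarrow> norm (heis_mult p u - heis_mult p 0) < e"
      using that unfolding continuous_at_eps_delta dist_norm by blast
    then obtain \<delta> where \<delta>: "\<delta> > 0" "\<And>u. norm u < \<delta> \<Longrightarrow> dist (heis_mult p u) p < e"
      unfolding dist_norm diff_zero heis_mult_0_right by blast
    define r where "r = min 1 (\<delta> / 2)"
    have r: "0 < r" "r \<le> 1" "2 * r \<le> \<delta>" using \<delta> by (auto simp: r_def)
    have "dist p q < e" if "koranyi_dist p q < r" for q
    proof -
      define u where "u = heis_mult (heis_inv p) q"
      have ku: "koranyi_norm u < r" 
        using that by (metis u_def koranyi_dist_def K.commute)
      obtain x y t where u: "u = (x, y, t)" by (cases u)
      have "norm (x, y) < r" using koranyi_norm_ge(1)[of x y t] ku u by simp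
      moreover have "\<bar>t\<bar> \<le> koranyi_norm u"
        using koranyi_norm_ge(2)[where x=x and y=y and t=t] ku r u
          power_le_one_iff[of "koranyi_norm u" 1]
          mult_left_le[of "koranyi_norm u" "koranyi_norm u"]
        by (simp add: power2_eq_square)
      moreover have "norm u \<le> norm (x, y) + \<bar>t\<bar>"
      proof -
        have "u = (x, y, 0) + (0, 0, t)" by (simp add: u)
        then have "norm u \<le> norm (x, y, 0::real) + norm (0::real^'n, 0::real^'n, t)"
          by (metis norm_triangle_ineq)
        then show ?thesis by (simp add: norm_Pair)
      qed
      ultimately have "norm u < \<delta>" using ku r by linarith
      from \<delta>(2)[OF this] show ?thesis
        by (simp add: u_def heis_mult_inv_cancel dist_commute)
    qed
    then show ?thesis using r by (intro exI[of _ r]) auto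
  qed
  have op: "open (K.mball p r)" for p r
  proof -
    have "continuous_on UNIV (\<lambda>q. koranyi_norm (heis_mult (heis_inv p) q))"
      by (rule continuous_on_compose2[OF continuous_on_koranyi_norm continuous_on_heis_mult]) auto
    moreover have "K.mball p r = {q. koranyi_norm (heis_mult (heis_inv p) q) < r}"
      by (simp add: K.mball_def K.commute[of p]) (simp add: koranyi_dist_def)
    ultimately show ?thesis
      by (simp add: open_Collect_less continuous_on_const)
  qed
  have "openin K.mtopology U \<longleftrightarrow> open U" for U
  proof
    assume U: "openin K.mtopology U"
    show "open U"
    proof (subst open_subopen, intro ballI)
      fix p assume "p \<in> U"
      then obtain r where "r > 0" "K.mball p r \<subseteq> U" using U unfolding K.openin_mtopology by blast
      with op[of p r] show "\<exists>T. open T \<and> p \<in> T \<and> T \<subseteq> U"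
        by (intro exI[of _ "K.mball p r"]) (simp only: K.centre_in_mball_iff, simp)
    qed
  next
    assume U: "open U"
    have "\<exists>r>0. K.mball p r \<subseteq> U" if "p \<in> U" for p
      using U that sub by (meson open_contains_ball order_trans)
    then show "openin K.mtopology U" by (auto simp: K.openin_mtopology)
  qed
  then have "K.mtopology = euclidean" by (simp add: topology_eq)
  then show ?thesis by (simp add: mtopology_of_def)
qed

end

theory Submission
  imports Defs
begin

text \<open>
  The obstruction is a closed form of degree \<open>n + 1\<close> that lives away from the image of the
  sphere. By restriction to a coordinate disc it is enough to treat \<open>m = n + 1\<close>. Let
  \<open>K\<close> be the image of the sphere. The inverse of \<open>f\<close> on \<open>K\<close> is a uniform limit of
  polynomial maps, so there is a polynomial map \<open>G\<close> from \<open>\<real>\<^sup>2\<^sup>n\<^sup>+\<^sup>1\<close> to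
  \<open>\<real>\<^sup>n\<^sup>+\<^sup>1\<close> with \<open>G \<circ> f\<close> close to the identity on the sphere. If \<open>\<psi>\<close> is a
  nonnegative bump around the origin, then \<open>\<omega> = \<psi>(G) dG\<^sub>1 \<and> \<dots> \<and> dG\<^sub>n\<^sub>+\<^sub>1\<close> is closed
  and vanishes near \<open>K\<close>. Let \<open>F\<close> be a continuously differentiable approximation of \<open>f\<close> at
  scale \<open>\<epsilon>\<close>. The integral of \<open>F\<^sup>*\<omega>\<close> over the ball is evaluated in two ways.

  First, \<open>G \<circ> F\<close> is close to the identity near the boundary of the ball, hence has degree one
  over the support of \<open>\<psi>\<close>, and the integral equals the integral of \<open>\<psi>\<close>, a positive number
  independent of \<open>\<epsilon>\<close> (\<open>degree_near_identity\<close>).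

  Second, let \<open>\<alpha>\<close> be the contact form. On the \<open>2 n\<close>-dimensional contact hyperplanes
  multiplication by \<open>d\<alpha>\<close> maps forms of degree \<open>n - 1\<close> onto forms of degree \<open>n + 1\<close>
  (the Lefschetz property, \<open>alternating_limit_zero\<close>), so
  \<open>\<omega> = \<alpha> \<and> \<beta> + d(\<alpha> \<and> \<tau>)\<close> with \<open>\<tau>\<close> vanishing near \<open>K\<close>. The exact part
  integrates to zero by Stokes' theorem (\<open>stokes_contact\<close>). For the other part the Hoelder
  conditions enter: \<open>F\<^sup>*\<alpha>\<close> is of order \<open>\<epsilon>\<close> to the power \<open>2 \<gamma> - 1\<close>, because the
  third coordinate of \<open>q\<^sup>-\<^sup>1 * p\<close> is at most the square of the Koranyi distance, and the
  derivative of \<open>F\<close> is of order \<open>\<epsilon>\<close> to the power \<open>\<theta> - 1\<close> (\<open>smoothing\<close>). As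
  \<open>F\<^sup>*(\<alpha> \<and> \<beta>)\<close> has one factor of the first kind and \<open>n\<close> of the second, its order is
  \<open>(2 \<gamma> - 1) + n (\<theta> - 1) = 0\<close>; a small constant in either Hoelder condition makes it
  tend to zero (\<open>polynomial_pullback_limit\<close>). This contradicts the first evaluation
  (\<open>no_sphere_embedding\<close>).

  A form of top degree on the ball is written below as the determinant of a matrix whose rows are
  gradients, so that the exterior calculus becomes multilinear algebra of determinants.
\<close>

section \<open>Continuously differentiable maps and gradients\<close>

text \<open>
  Continuity of the derivative is required for each direction separately; in finite dimension this is
  continuity in the operator norm.
\<close>

definition C1 :: "('a::euclidean_space \<Rightarrow> 'b::real_normed_vector) \<Rightarrow> bool"
  where "C1 u \<longleftrightarrow> (\<exists>u'. (\<forall>x. (u has_derivative u' x) (at x)) \<and> (\<forall>v. continuous_on UNIV (\<lambda>x. u' x v)))"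

abbreviation D :: "('a::euclidean_space \<Rightarrow> 'b::real_normed_vector) \<Rightarrow> 'a \<Rightarrow> 'a \<Rightarrow> 'b"
  where "D u x \<equiv> frechet_derivative u (at x)"

lemma C1_has_derivative: "C1 u \<Longrightarrow> (u has_derivative D u x) (at x)"
  unfolding C1_def using frechet_derivative_works differentiable_def by blast

lemma C1_D_eq: "C1 u \<Longrightarrow> (u has_derivative u') (at x) \<Longrightarrow> D u x = u'"
  by (metis frechet_derivative_at)

lemma C1_D_continuous:
  assumes "C1 u"
  shows "continuous_on UNIV (\<lambda>x. D u x v)"
proof -
  obtain u' where u': "\<And>x. (u has_derivative u' x) (at x)" "continuous_on UNIV (\<lambda>x. u' x v)"
    using assms unfolding C1_def by blast
  then show ?thesis using C1_D_eq[OF assms u'(1)] by simp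
qed

lemma C1_continuous_on: "C1 u \<Longrightarrow> continuous_on S u"
  by (meson C1_has_derivative continuous_at_imp_continuous_on has_derivative_continuous)

lemma C1I:
  assumes "\<And>x. (u has_derivative u' x) (at x)" "\<And>v. continuous_on UNIV (\<lambda>x. u' x v)"
  shows "C1 u"
  using assms unfolding C1_def by blast

lemma D_linear: "C1 u \<Longrightarrow> linear (D u x)"
  using C1_has_derivative has_derivative_linear by blast

lemma C1_D_expand:
  fixes u :: "'a::euclidean_space \<Rightarrow> 'b::real_normed_vector"
  assumes "C1 u"
  shows "D u x v = (\<Sum>b\<in>Basis. (v \<bullet> b) *\<^sub>R D u x b)"
proof -
  interpret linear "D u x" by (rule D_linear[OF assms])
  have "D u x v = D u x (\<Sum>b\<in>Basis. (v \<bullet> b) *\<^sub>R b)" by (simp add: euclidean_representation)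
  then show ?thesis by (simp add: sum scale)
qed

lemma C1_const [intro]: "C1 (\<lambda>x. c)"
  by (rule C1I[where u'="\<lambda>x v. 0"]) auto

lemma C1_bounded_linear: "bounded_linear u \<Longrightarrow> C1 u"
  by (rule C1I[where u'="\<lambda>x. u"]) (auto intro: bounded_linear_imp_has_derivative)

lemma C1_add [intro]:
  assumes "C1 u" "C1 w" shows "C1 (\<lambda>x. u x + w x)"
  by (rule C1I[where u'="\<lambda>x v. D u x v + D w x v"])
     (auto intro!: derivative_intros continuous_intros C1_has_derivative C1_D_continuous assms)

lemma C1_scaleR [intro]:
  fixes u :: "_ \<Rightarrow> real"
  assumes "C1 u" "C1 w" shows "C1 (\<lambda>x. u x *\<^sub>R w x)"
proof (rule C1I)
  show "((\<lambda>x. u x *\<^sub>R w x) has_derivative (\<lambda>h. u x *\<^sub>R D w x h + D u x h *\<^sub>R w x)) (at x)" for x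
    by (intro derivative_intros C1_has_derivative assms)
  show "continuous_on UNIV (\<lambda>x. u x *\<^sub>R D w x v + D u x v *\<^sub>R w x)" for v
    by (intro continuous_intros C1_D_continuous C1_continuous_on assms)
qed

lemma C1_mult [intro]:
  fixes u :: "_ \<Rightarrow> real"
  assumes "C1 u" "C1 w" shows "C1 (\<lambda>x. u x * w x)"
  using C1_scaleR[OF assms] by simp

lemma C1_sum [intro]:
  assumes "\<And>i. i \<in> A \<Longrightarrow> C1 (u i)" shows "C1 (\<lambda>x. \<Sum>i\<in>A. u i x)"
  using assms by (induction A rule: infinite_finite_induct) auto

lemma C1_prod [intro]:
  fixes u :: "_ \<Rightarrow> _ \<Rightarrow> real"
  assumes "\<And>i. i \<in> A \<Longrightarrow> C1 (u i)" shows "C1 (\<lambda>x. \<Prod>i\<in>A. u i x)"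
  using assms by (induction A rule: infinite_finite_induct) auto

lemma C1_diff [intro]:
  fixes u :: "_ \<Rightarrow> 'b::real_normed_vector"
  assumes "C1 u" "C1 w" shows "C1 (\<lambda>x. u x - w x)"
proof -
  have "C1 (\<lambda>x. u x + (-1) *\<^sub>R w x)" by (intro C1_add C1_scaleR C1_const assms)
  then show ?thesis by simp
qed

lemma C1_compose:
  fixes c :: "'b::euclidean_space \<Rightarrow> 'c::real_normed_vector"
  assumes "C1 c" "C1 u" shows "C1 (\<lambda>x. c (u x))"
proof (rule C1I)
  show "((\<lambda>x. c (u x)) has_derivative (\<lambda>v. D c (u x) (D u x v))) (at x)" for x
    by (rule has_derivative_compose[OF C1_has_derivative[OF assms(2)] C1_has_derivative[OF assms(1)]])
  have "continuous_on UNIV (\<lambda>x. \<Sum>b\<in>Basis. (D u x v \<bullet> b) *\<^sub>R D c (u x) b)" for v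
    by (intro continuous_intros C1_D_continuous assms
        continuous_on_compose2[OF C1_D_continuous[OF assms(1)] C1_continuous_on[OF assms(2)]]) auto
  then show "continuous_on UNIV (\<lambda>x. D c (u x) (D u x v))" for v
    by (subst C1_D_expand[OF assms(1)])
qed

lemma D_compose:
  assumes "C1 c" "C1 u" shows "D (\<lambda>x. c (u x)) x v = D c (u x) (D u x v)"
  using C1_D_eq[OF C1_compose[OF assms]
    has_derivative_compose[OF C1_has_derivative[OF assms(2)] C1_has_derivative[OF assms(1)]]] by simp

lemma C1_real_polynomial_function:
  assumes "real_polynomial_function g" shows "C1 g"
  using assms by induction (auto intro: C1_bounded_linear)

lemma C1_D_bounded_on_compact:
  fixes u :: "'a::euclidean_space \<Rightarrow> 'b::real_normed_vector"
  assumes "C1 u" "compact K"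
  obtains B where "B \<ge> 0" "\<And>x v. x \<in> K \<Longrightarrow> norm (D u x v) \<le> B * norm v"
proof -
  have "\<exists>B. \<forall>x\<in>K. norm (D u x b) \<le> B" for b
    using compact_imp_bounded[OF compact_continuous_image[OF continuous_on_subset[OF C1_D_continuous[OF assms(1)]] assms(2)]]
    unfolding bounded_iff by (metis image_eqI subset_UNIV)
  then obtain B where B: "\<And>b x. x \<in> K \<Longrightarrow> norm (D u x b) \<le> B b" by metis
  show ?thesis
  proof
    show "0 \<le> (\<Sum>b\<in>(Basis::'a set). \<bar>B b\<bar>)" by (simp add: sum_nonneg)
    fix x v assume x: "x \<in> K"
    have "norm (D u x v) \<le> (\<Sum>b\<in>Basis. \<bar>v \<bullet> b\<bar> * norm (D u x b))"
      unfolding C1_D_expand[OF assms(1), of x v] by (rule order_trans[OF norm_sum]) simp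
    also have "\<dots> \<le> (\<Sum>b\<in>Basis. norm v * \<bar>B b\<bar>)"
      by (intro sum_mono mult_mono) (auto simp: Basis_le_norm intro: order_trans[OF B[OF x]])
    finally show "norm (D u x v) \<le> (\<Sum>b\<in>Basis. \<bar>B b\<bar>) * norm v"
      by (simp add: sum_distrib_left sum_distrib_right mult.commute)
  qed
qed

definition grad :: "(real ^ 'k \<Rightarrow> real) \<Rightarrow> real ^ 'k \<Rightarrow> real ^ 'k::finite"
  where "grad u x = (\<chi> j. D u x (axis j 1))"

lemma grad_nth: "grad u x $ j = D u x (axis j 1)" by (simp add: grad_def)

lemma grad_add: "C1 u \<Longrightarrow> C1 w \<Longrightarrow> grad (\<lambda>x. u x + w x) x = grad u x + grad w x"
  unfolding vec_eq_iff grad_nth vector_add_component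
  by (metis (no_types) C1_D_eq C1_add C1_has_derivative has_derivative_add)

lemma grad_mult:
  assumes "C1 u" "C1 w" shows "grad (\<lambda>x. u x * w x) x = u x *\<^sub>R grad w x + w x *\<^sub>R grad u x"
proof -
  have "((\<lambda>x. u x * w x) has_derivative (\<lambda>h. u x * D w x h + D u x h * w x)) (at x)"
    by (intro has_derivative_mult C1_has_derivative assms)
  from C1_D_eq[OF C1_mult[OF assms] this] show ?thesis
    by (simp add: vec_eq_iff grad_nth)
qed

lemma grad_const [simp]: "grad (\<lambda>x. c) x = 0"
  by (simp add: vec_eq_iff grad_nth frechet_derivative_const)

lemma grad_cmult:
  assumes "C1 w" shows "grad (\<lambda>x. c * w x) x = c *\<^sub>R grad w x"
  using grad_mult[OF C1_const assms] by simp

lemma grad_diff: "C1 u \<Longrightarrow> C1 w \<Longrightarrow> grad (\<lambda>x. u x - w x) x = grad u x - grad w x"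
  using grad_add[of u "\<lambda>x. (-1) * w x" x] C1_mult[OF C1_const, of w "-1"] grad_cmult[of w "-1" x]
  by simp

lemma grad_sum:
  assumes "\<And>i. i \<in> A \<Longrightarrow> C1 (u i)"
  shows "grad (\<lambda>x. \<Sum>i\<in>A. u i x) x = (\<Sum>i\<in>A. grad (u i) x)"
  using assms by (induction A rule: infinite_finite_induct) (auto simp: grad_add C1_sum)

lemma grad_continuous:
  assumes "C1 u"
  shows "continuous_on UNIV (\<lambda>x. grad u x)"
  unfolding grad_def by (intro continuous_on_vec_lambda C1_D_continuous assms)

lemma grad_local:
  assumes "C1 u" "open S" "x \<in> S" "\<And>y. y \<in> S \<Longrightarrow> u y = w y"
  shows "grad w x = grad u x"
proof -
  have "(w has_derivative D u x) (at x)"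
    by (rule has_derivative_transform_within_open[OF C1_has_derivative[OF assms(1)] assms(2-4)])
  then have "D w x = D u x" by (metis frechet_derivative_at)
  then show ?thesis by (simp add: grad_def)
qed

lemma C1_coord: "C1 (\<lambda>x. x $ i)"
  by (intro C1_bounded_linear bounded_linear_vec_nth)

lemma grad_coord: "grad (\<lambda>x. x $ i) x = axis i 1"
proof -
  have "D (\<lambda>x. x $ i) x = (\<lambda>v. v $ i)"
    by (rule C1_D_eq[OF C1_coord]) (intro bounded_linear_imp_has_derivative bounded_linear_vec_nth)
  then show ?thesis by (simp add: vec_eq_iff grad_nth axis_def eq_commute)
qed

section \<open>Cutoff functions\<close>

definition ramp2 :: "real \<Rightarrow> real" where "ramp2 s = (max 0 s)\<^sup>2"

lemma DERIV_ramp2: "(ramp2 has_real_derivative 2 * max 0 s) (at s)"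
proof -
  consider "s < 0" | "s = 0" | "s > 0" by linarith
  then show ?thesis
  proof cases
    case 1
    have "((\<lambda>s. 0) has_real_derivative 0) (at s)" by simp
    then have "(ramp2 has_real_derivative 0) (at s)"
      by (rule has_field_derivative_transform_within_open[where S="{..<0}"]) (auto simp: 1 ramp2_def)
    then show ?thesis using 1 by simp
  next
    case 3
    have "((\<lambda>s. s\<^sup>2) has_real_derivative 2 * s) (at s)" by (auto intro!: derivative_eq_intros)
    then have "(ramp2 has_real_derivative 2 * s) (at s)"
      by (rule has_field_derivative_transform_within_open[where S="{0<..}"]) (auto simp: 3 ramp2_def)
    then show ?thesis using 3 by simp
  next
    case 2
    have "((\<lambda>h. max 0 h) \<longlongrightarrow> max 0 0) (at (0::real))" by (intro tendsto_intros)
    then have "((\<lambda>h. max 0 h) \<longlongrightarrow> 0) (at (0::real))" by simp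
    moreover have "eventually (\<lambda>h. max 0 h = (ramp2 (0 + h) - ramp2 0) / h) (at (0::real))"
      unfolding eventually_at_filter
      by (rule always_eventually) (auto simp: ramp2_def power2_eq_square max_def)
    ultimately have "((\<lambda>h. (ramp2 (0 + h) - ramp2 0) / h) \<longlongrightarrow> 0) (at 0)"
      by (rule Lim_transform_eventually)
    then show ?thesis using 2 by (simp add: DERIV_def)
  qed
qed

text \<open>
  The integral of a tent function on the unit interval, written by means of truncated squares so that
  its derivative is visibly continuous.
\<close>

definition step :: "real \<Rightarrow> real" where "step s = 2 * ramp2 s - 4 * ramp2 (s - 1 / 2) + 2 * ramp2 (s - 1)"

definition step' :: "real \<Rightarrow> real" where "step' s = 4 * max 0 s - 8 * max 0 (s - 1 / 2) + 4 * max 0 (s - 1)"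

lemma DERIV_step: "(step has_real_derivative step' s) (at s)"
proof -
  have *: "((\<lambda>s. ramp2 (s - a)) has_real_derivative 2 * max 0 (s - a)) (at s)" for a
    using DERIV_chain2[OF DERIV_ramp2, of "\<lambda>s. s - a" 1 s UNIV]
      DERIV_diff[OF DERIV_ident DERIV_const[of a]] by simp
  show ?thesis
    unfolding step_def[abs_def] step'_def
    using * by (auto intro!: derivative_eq_intros DERIV_ramp2)
qed

lemma C1_real:
  fixes u :: "real \<Rightarrow> real"
  assumes "\<And>s. (u has_real_derivative u' s) (at s)" "continuous_on UNIV u'"
  shows "C1 u"
  by (rule C1I[where u'="\<lambda>s v. u' s * v"])
     (use assms in \<open>auto simp: has_field_derivative_def intro!: continuous_intros\<close>)

lemma C1_ramp2: "C1 ramp2"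
  by (rule C1_real[OF DERIV_ramp2]) (intro continuous_intros)

lemma C1_step: "C1 step"
  by (rule C1_real[OF DERIV_step]) (unfold step'_def, intro continuous_intros)

lemma step_0: "s \<le> 0 \<Longrightarrow> step s = 0"
  by (simp add: step_def ramp2_def)

lemma step_1: "s \<ge> 1 \<Longrightarrow> step s = 1"
  by (simp add: step_def ramp2_def power2_eq_square algebra_simps)

lemma step'_nonneg: "step' s \<ge> 0" and step'_le: "step' s \<le> 2" and step'_outside: "s \<le> 0 \<or> 1 \<le> s \<Longrightarrow> step' s = 0"
  by (auto simp: step'_def max_def)

lemma step_mono: "s \<le> t \<Longrightarrow> step s \<le> step t"
  using DERIV_nonneg_imp_nondecreasing[of s t step] DERIV_step step'_nonneg by blast

lemma step_range: "0 \<le> step s" "step s \<le> 1"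
  using step_mono[of 0 s] step_mono[of s 1] step_mono[of s 0] step_0[of s] step_0[of 0] step_1[of s] step_1[of 1]
  by (cases "s \<le> 0"; cases "s \<ge> 1"; simp)+

definition cutoff :: "real \<Rightarrow> real \<Rightarrow> real ^ 'k::finite \<Rightarrow> real"
  where "cutoff a b x = step ((b\<^sup>2 - (norm x)\<^sup>2) / (b\<^sup>2 - a\<^sup>2))"

lemma C1_norm_sq: "C1 (\<lambda>x::'a::euclidean_space. (norm x)\<^sup>2)"
  by (rule C1I[where u'="\<lambda>x v. 2 * (x \<bullet> v)"])
     (auto simp: power2_norm_eq_inner inner_commute intro!: derivative_eq_intros continuous_intros)

lemma C1_cutoff: "C1 (cutoff a b)"
proof -
  have "C1 (\<lambda>x::real^'k. inverse (b\<^sup>2 - a\<^sup>2) * (b\<^sup>2 - (norm x)\<^sup>2))"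
    by (intro C1_mult C1_diff C1_norm_sq C1_const)
  from C1_compose[OF C1_step this] show ?thesis
    by (simp add: cutoff_def[abs_def] divide_inverse mult.commute)
qed

lemma cutoff_1:
  assumes "0 \<le> a" "a < b" "norm x \<le> a" shows "cutoff a b x = 1"
proof -
  have "a\<^sup>2 < b\<^sup>2" "(norm x)\<^sup>2 \<le> a\<^sup>2" using assms by (auto intro: power_strict_mono power_mono)
  then show ?thesis unfolding cutoff_def by (intro step_1) (simp add: field_simps)
qed

lemma cutoff_0:
  assumes "0 \<le> a" "a < b" "b \<le> norm x" shows "cutoff a b x = 0"
proof -
  have "a\<^sup>2 < b\<^sup>2" "b\<^sup>2 \<le> (norm x)\<^sup>2" using assms by (auto intro: power_strict_mono power_mono)
  then show ?thesis unfolding cutoff_def by (intro step_0) (simp add: field_simps)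
qed

lemma cutoff_range: "0 \<le> cutoff a b x" "cutoff a b x \<le> 1"
  by (simp_all add: cutoff_def step_range)

section \<open>The degree formula\<close>

lemma continuous_on_det:
  fixes A :: "'a::topological_space \<Rightarrow> real ^ 'k::finite ^ 'k"
  assumes "continuous_on S A" shows "continuous_on S (\<lambda>x. det (A x))"
  unfolding det_def
  by (intro continuous_intros continuous_on_component assms)

lemma absolutely_integrable_compact:
  fixes f :: "'a::euclidean_space \<Rightarrow> 'b::euclidean_space"
  assumes "compact S" "continuous_on S f"
  shows "f absolutely_integrable_on S"
proof -
  note * = borel_integrable_compact[OF assms]
  show ?thesis
    unfolding set_integrable_def
    using integrable_completion[OF borel_measurable_integrable[OF *]] * by simp
qed

lemma integrable_compact:
  fixes f :: "'a::euclidean_space \<Rightarrow> 'b::euclidean_space"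
  assumes "compact S" "continuous_on S f"
  shows "f integrable_on S"
  using absolutely_integrable_compact[OF assms] absolutely_integrable_on_def by blast

text \<open>
  Because of the uniform bound on the degree, the integral of such a family over a compact set is a
  polynomial in the parameter. An identity between integrals of this kind that holds for small
  parameters therefore holds for all of them.
\<close>

definition polyfam :: "('a::topological_space \<Rightarrow> real \<Rightarrow> real) \<Rightarrow> bool"
  where "polyfam q \<longleftrightarrow> (\<exists>Q d. (\<forall>x s. q x s = poly (Q x) s) \<and> (\<forall>x. degree (Q x) \<le> d) \<and>
      (\<forall>k. continuous_on UNIV (\<lambda>x. coeff (Q x) k)))"

lemma polyfam_const:
  assumes "continuous_on UNIV c" shows "polyfam (\<lambda>x s. c x)"
proof -
  have "continuous_on UNIV (\<lambda>x. coeff [:c x:] k)" for k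
    using assms by (cases k) auto
  then show ?thesis
    unfolding polyfam_def by (intro exI[of _ "\<lambda>x. [:c x:]"] exI[of _ 0]) auto
qed

lemma polyfam_param: "polyfam (\<lambda>x s. s)"
  unfolding polyfam_def
  by (rule exI[of _ "\<lambda>x. [:0, 1:]"], rule exI[of _ 1]) auto

lemma polyfam_add:
  assumes "polyfam q" "polyfam r" shows "polyfam (\<lambda>x s. q x s + r x s)"
proof -
  obtain Q d R e where "\<forall>x s. q x s = poly (Q x) s" "\<forall>x. degree (Q x) \<le> d" "\<forall>k. continuous_on UNIV (\<lambda>x. coeff (Q x) k)"
    "\<forall>x s. r x s = poly (R x) s" "\<forall>x. degree (R x) \<le> e" "\<forall>k. continuous_on UNIV (\<lambda>x. coeff (R x) k)"
    using assms unfolding polyfam_def by metis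
  then show ?thesis unfolding polyfam_def
    by (intro exI[of _ "\<lambda>x. Q x + R x"] exI[of _ "max d e"])
       (auto intro!: continuous_intros degree_add_le intro: max.coboundedI1 max.coboundedI2)
qed

lemma polyfam_mult:
  assumes "polyfam q" "polyfam r" shows "polyfam (\<lambda>x s. q x s * r x s)"
proof -
  obtain Q d R e where "\<forall>x s. q x s = poly (Q x) s" "\<forall>x. degree (Q x) \<le> d" "\<forall>k. continuous_on UNIV (\<lambda>x. coeff (Q x) k)"
    "\<forall>x s. r x s = poly (R x) s" "\<forall>x. degree (R x) \<le> e" "\<forall>k. continuous_on UNIV (\<lambda>x. coeff (R x) k)"
    using assms unfolding polyfam_def by metis
  then show ?thesis unfolding polyfam_def
    by (intro exI[of _ "\<lambda>x. Q x * R x"] exI[of _ "d + e"])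
       (auto intro!: continuous_intros order_trans[OF degree_mult_le] add_mono simp: coeff_mult)
qed

lemma polyfam_sum: "(\<And>i. i \<in> A \<Longrightarrow> polyfam (q i)) \<Longrightarrow> polyfam (\<lambda>x s. \<Sum>i\<in>A. q i x s)"
  by (induction A rule: infinite_finite_induct) (auto intro: polyfam_add polyfam_const)

lemma polyfam_prod: "(\<And>i. i \<in> A \<Longrightarrow> polyfam (q i)) \<Longrightarrow> polyfam (\<lambda>x s. \<Prod>i\<in>A. q i x s)"
  by (induction A rule: infinite_finite_induct) (auto intro: polyfam_mult polyfam_const)

lemma polyfam_det:
  assumes "\<And>i j. polyfam (\<lambda>x s. A x s $ i $ j)"
  shows "polyfam (\<lambda>x s. det (A x s :: real ^ 'k::finite ^ 'k))"
  unfolding det_def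
  by (intro polyfam_sum polyfam_mult polyfam_const polyfam_prod assms continuous_intros)

lemma polyfam_real_polynomial_function:
  fixes g :: "'b::euclidean_space \<Rightarrow> real" and y :: "'a::topological_space \<Rightarrow> real \<Rightarrow> 'b"
  assumes "real_polynomial_function g" "\<And>b. b \<in> Basis \<Longrightarrow> polyfam (\<lambda>x s. y x s \<bullet> b)"
  shows "polyfam (\<lambda>x s. g (y x s))"
  using assms(1)
proof induction
  case (linear f)
  interpret bounded_linear f by fact
  have "f v = (\<Sum>b\<in>Basis. (v \<bullet> b) * f b)" for v
  proof -
    have "f v = f (\<Sum>b\<in>Basis. (v \<bullet> b) *\<^sub>R b)" by (simp add: euclidean_representation)
    then show ?thesis by (simp add: sum scale)
  qed
  then show ?case
    by (subst \<open>\<And>v. f v = _\<close>) (intro polyfam_sum polyfam_mult polyfam_const assms(2) continuous_intros)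
qed (auto intro: polyfam_const polyfam_add polyfam_mult)

lemma polyfam_integral:
  fixes q :: "'a::euclidean_space \<Rightarrow> real \<Rightarrow> real"
  assumes "polyfam q" "compact S"
  shows "\<exists>p. \<forall>s. integral S (\<lambda>x. q x s) = poly p s"
proof -
  obtain Q d where Q: "\<And>x s. q x s = poly (Q x) s" "\<And>x. degree (Q x) \<le> d"
    "\<And>k. continuous_on UNIV (\<lambda>x. coeff (Q x) k)"
    using assms unfolding polyfam_def by metis
  define p where "p = (\<Sum>k\<le>d. monom (integral S (\<lambda>x. coeff (Q x) k)) k)"
  have "integral S (\<lambda>x. q x s) = poly p s" for s
  proof -
    have "q x s = (\<Sum>k\<le>d. coeff (Q x) k * s ^ k)" for x
      unfolding Q(1) poly_altdef
      by (rule sum.mono_neutral_left) (use Q(2) in \<open>auto intro: order_trans coeff_eq_0\<close>)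
    then have "integral S (\<lambda>x. q x s) = integral S (\<lambda>x. \<Sum>k\<le>d. coeff (Q x) k * s ^ k)" by simp
    also have "\<dots> = (\<Sum>k\<le>d. integral S (\<lambda>x. coeff (Q x) k * s ^ k))"
      by (intro integral_sum integrable_compact assms continuous_intros continuous_on_subset[OF Q(3)]) auto
    also have "\<dots> = poly p s" by (simp add: p_def poly_sum poly_monom)
    finally show ?thesis .
  qed
  then show ?thesis by blast
qed

lemma poly_eq_on_interval:
  fixes p q :: "real poly"
  assumes "a < b" "\<And>s. a < s \<Longrightarrow> s < b \<Longrightarrow> poly p s = poly q s"
  shows "p = q"
proof (rule ccontr)
  assume "p \<noteq> q"
  then have "finite {s. poly (p - q) s = 0}" by (intro poly_roots_finite) simp
  moreover have "{a<..<b} \<subseteq> {s. poly (p - q) s = 0}" using assms by auto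
  ultimately show False using infinite_Ioo[OF assms(1)] finite_subset by blast
qed

text \<open>
  For small \<open>s\<close> the map \<open>x \<mapsto> x + s U(x)\<close>, where \<open>U\<close> has the components \<open>u\<close>, is injective because
  \<open>s U\<close> is a contraction, is onto by Banach's fixed point theorem, and maps the ball to itself
  because it is the identity outside. Its Jacobian is close to one, hence positive, and the claim is
  the change of variables formula.
\<close>

lemma perturbed_identity_small:
  fixes u :: "'k::{finite,wellorder} \<Rightarrow> real^'k::_ \<Rightarrow> real"
  assumes u: "\<And>i. C1 (u i)" and zero: "\<And>i x. norm x \<ge> 1 \<Longrightarrow> u i x = 0"
  shows "\<exists>s0>0. \<forall>s \<psi>. 0 < s \<longrightarrow> s < s0 \<longrightarrow> continuous_on UNIV \<psi> \<longrightarrow>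
      integral (cball 0 1) (\<lambda>x. det (\<chi> i. axis i 1 + s *\<^sub>R grad (u i) x) * \<psi> (x + s *\<^sub>R (\<chi> i. u i x)))
      = integral (cball 0 1) (\<psi> :: _ \<Rightarrow> real)"
proof -
  define U where "U x = (\<chi> i. u i x)" for x
  define U' where "U' x v = (\<chi> i. D (u i) x v)" for x v
  have dU: "(U has_derivative U' x) (at x)" for x
  proof -
    have "((\<lambda>x. \<Sum>i\<in>UNIV. u i x *\<^sub>R axis i 1) has_derivative (\<lambda>v. \<Sum>i\<in>UNIV. D (u i) x v *\<^sub>R axis i 1)) (at x)"
      by (intro derivative_intros C1_has_derivative u)
    moreover have "(\<chi> i. a i) = (\<Sum>i\<in>UNIV. a i *\<^sub>R axis i 1)" for a :: "'k \<Rightarrow> real"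
      by (simp add: vec_eq_iff axis_def if_distrib cong: if_cong)
    ultimately show ?thesis unfolding U_def[abs_def] U'_def[abs_def] by simp
  qed
  have C1U: "C1 U"
    by (rule C1I[OF dU]) (unfold U'_def, intro continuous_on_vec_lambda C1_D_continuous u)
  have DU: "D U x = U' x" for x by (rule C1_D_eq[OF C1U dU])
  have U0: "U x = 0" if "norm x \<ge> 1" for x using zero[OF that] by (simp add: U_def vec_eq_iff)
  obtain B where B: "B \<ge> 0" "\<And>x v. x \<in> cball 0 1 \<Longrightarrow> norm (U' x v) \<le> B * norm v"
    using C1_D_bounded_on_compact[OF C1U compact_cball[of 0 1]] unfolding DU by blast
  have U'0: "U' x = (\<lambda>v. 0)" if "norm x > 1" for x
  proof -
    have "open (- cball (0::real^'k::_) 1)" by (intro open_Compl closed_cball)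
    then have "(U has_derivative (\<lambda>v. 0)) (at x)"
      by (rule has_derivative_transform_within_open[OF has_derivative_const[of 0]])
         (use that U0 in auto)
    then show ?thesis using C1_D_eq[OF C1U] DU by metis
  qed
  have B': "norm (U' x v) \<le> B * norm v" for x v
    using B U'0[of x] by (cases "norm x \<le> 1") auto
  have lip: "norm (U x - U y) \<le> B * norm (x - y)" for x y
    by (rule differentiable_bound[where S=UNIV and f'=U'])
       (auto intro: dU onorm_le B')
  define M where "M x = (\<chi> i. grad (u i) x)" for x
  have Mcont: "continuous_on UNIV M"
    unfolding M_def by (intro continuous_on_vec_lambda grad_continuous u)
  have "bounded (M ` cball 0 1)"
    by (intro compact_imp_bounded compact_continuous_image continuous_on_subset[OF Mcont]) auto
  then obtain m where m: "m > 0" "\<And>x. x \<in> cball 0 1 \<Longrightarrow> norm (M x) \<le> m"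
    unfolding bounded_pos by auto
  have "isCont det (mat 1 :: real^'k::_^'k::_)"
  proof -
    have "continuous_on UNIV (\<lambda>A :: real^'k::_^'k::_. det A)"
      by (rule continuous_on_det[OF continuous_on_id])
    then show ?thesis by (simp add: continuous_on_eq_continuous_at)
  qed
  then obtain \<delta> where \<delta>: "\<delta> > 0" "\<And>A. dist A (mat 1 :: real^'k::_^'k::_) < \<delta> \<Longrightarrow> dist (det A) (det (mat 1 :: real^'k::_^'k::_)) < 1"
    unfolding continuous_at_eps_delta dist_norm by (metis zero_less_one)
  \<comment> \<open>The first bound keeps the matrix in the neighbourhood of the identity where
    determinants are positive, the second makes \<open>s U\<close> a contraction.\<close>
  define s0 where "s0 = min (\<delta> / m) (1 / (B + 1))"
  show ?thesis
  proof (intro exI[of _ s0] conjI allI impI)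
    show "s0 > 0" using \<delta> m B by (simp add: s0_def)
    fix s :: real and \<psi> :: "real^'k::_ \<Rightarrow> real"
    assume s: "0 < s" "s < s0" and \<psi>: "continuous_on UNIV \<psi>"
    define g where "g x = x + s *\<^sub>R U x" for x
    have sm: "s * m < \<delta>" using s m by (simp add: s0_def field_simps)
    have "s * (B + 1) < 1" using s B by (simp add: s0_def pos_less_divide_eq)
    then have sB: "s * B < 1" using s by (simp add: algebra_simps)
    have sB0: "0 \<le> s * B" using s B by simp
    have gU: "norm (s *\<^sub>R U x - s *\<^sub>R U y) \<le> (s * B) * norm (x - y)" for x y
      using mult_left_mono[OF lip[of x y], of s] s by (simp add: mult.assoc flip: scaleR_diff_right)
    have inj: "inj g"
    proof (rule injI)
      fix x y assume "g x = g y"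
      then have "x - y = s *\<^sub>R U y - s *\<^sub>R U x" by (simp add: g_def algebra_simps)
      then have "norm (x - y) \<le> (s * B) * norm (x - y)" using gU[of y x] by (simp add: norm_minus_commute)
      then have "(1 - s * B) * norm (x - y) \<le> 0" by (simp add: algebra_simps)
      then show "x = y" using sB by (simp add: mult_le_0_iff)
    qed
    have gout: "g x = x" if "norm x \<ge> 1" for x using U0[OF that] by (simp add: g_def)
    have "g ` cball 0 1 = cball 0 1"
    proof
      show "g ` cball 0 1 \<subseteq> cball 0 1"
      proof safe
        fix x :: "real^'k::_" assume x: "x \<in> cball 0 1"
        show "g x \<in> cball 0 1"
        proof (rule ccontr)
          assume "g x \<notin> cball 0 1"
          then have n: "norm (g x) > 1" by simp
          then have "g (g x) = g x" by (intro gout) simp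
          then have "g x = x" using inj by (simp add: inj_eq)
          then show False using n x by simp
        qed
      qed
      show "cball 0 1 \<subseteq> g ` cball 0 1"
      proof
        fix y :: "real^'k::_" assume y: "y \<in> cball 0 1"
        have "\<exists>!x. y - s *\<^sub>R U x = x"
          by (rule banach_fix_type[OF sB0 sB]) (use gU in \<open>auto simp: dist_norm norm_minus_commute\<close>)
        then obtain x where "y - s *\<^sub>R U x = x" by blast
        then have gx: "g x = y" unfolding g_def by (metis diff_add_cancel)
        then have "x \<in> cball 0 1" using gout[of x] y by (cases "norm x \<ge> 1") auto
        then show "y \<in> g ` cball 0 1" using gx by blast
      qed
    qed
    note img = this
    define g' where "g' x v = v + s *\<^sub>R U' x v" for x v
    have dg: "(g has_derivative g' x) (at x within cball 0 1)" for x
      unfolding g_def[abs_def] g'_def[abs_def]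
      by (intro derivative_intros has_derivative_at_withinI[OF dU])
    have mat: "matrix (g' x) = (\<chi> i. axis i 1 + s *\<^sub>R grad (u i) x)" for x
      by (simp add: vec_eq_iff matrix_def g'_def U'_def grad_nth axis_def)
    have pos: "det (\<chi> i. axis i 1 + s *\<^sub>R grad (u i) x) > 0" if x: "x \<in> cball 0 1" for x
    proof -
      have "(\<chi> i. axis i 1 + s *\<^sub>R grad (u i) x) = mat 1 + s *\<^sub>R M x"
        by (simp add: vec_eq_iff mat_def axis_def M_def)
      moreover have "dist (mat 1 + s *\<^sub>R M x) (mat 1) < \<delta>"
        using le_less_trans[OF mult_left_mono[OF m(2)[OF x], of s] sm] s by (simp add: dist_norm)
      ultimately show ?thesis using \<delta>(2) by (simp add: dist_real_def) (smt (verit))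
    qed
    have abs1: "(\<lambda>x. vec (\<psi> x) :: real^1) absolutely_integrable_on (g ` cball 0 1)"
      unfolding img
      by (intro absolutely_integrable_compact continuous_on_vec_lambda continuous_on_subset[OF \<psi>])
         (auto simp: vec_def intro!: continuous_on_vec_lambda continuous_on_subset[OF \<psi>])
    have meas: "cball (0::real^'k::_) 1 \<in> sets lebesgue" by simp
    have cv: "integral (cball 0 1) (\<lambda>x. \<bar>det (matrix (g' x))\<bar> *\<^sub>R (vec (\<psi> (g x)) :: real^1)) =
      integral (g ` cball 0 1) (\<lambda>x. vec (\<psi> x) :: real^1)"
      using has_absolute_integral_change_of_variables[OF meas dg inj_on_subset[OF inj subset_UNIV],
        of "\<lambda>x. vec (\<psi> x) :: real^1" "integral (g ` cball 0 1) (\<lambda>x. vec (\<psi> x) :: real^1)"] abs1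
      by blast
    have Uc: "continuous_on UNIV U" by (rule C1_continuous_on[OF C1U])
    have gc: "continuous_on UNIV g" unfolding g_def by (intro continuous_intros Uc)
    have cont: "continuous_on (cball 0 1) (\<lambda>x. \<bar>det (matrix (g' x))\<bar> *\<^sub>R (vec (\<psi> (g x)) :: real^1))"
      unfolding mat vec_def
      by (intro continuous_intros continuous_on_det continuous_on_vec_lambda
          continuous_on_subset[OF grad_continuous[OF u]] continuous_on_subset[OF continuous_on_compose2[OF \<psi> gc]]) auto
    have comp: "integral S (\<lambda>x. F x) $ 1 = integral S (\<lambda>x. F x $ 1)" if "F integrable_on S" for F :: "real^'k::_ \<Rightarrow> real^1" and S
      using integral_linear[OF that bounded_linear_vec_nth[of 1]] by (simp add: o_def)
    have "integral (cball 0 1) (\<lambda>x. \<bar>det (matrix (g' x))\<bar> * \<psi> (g x)) = integral (cball 0 1) \<psi>"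
      using arg_cong[OF cv, of "\<lambda>v. v $ 1"]
        comp[OF integrable_compact[OF compact_cball cont]]
        comp[OF set_lebesgue_integral_eq_integral(1)[OF abs1]]
      by (simp add: img)
    moreover have "integral (cball 0 1) (\<lambda>x. \<bar>det (matrix (g' x))\<bar> * \<psi> (g x)) =
      integral (cball 0 1) (\<lambda>x. det (\<chi> i. axis i 1 + s *\<^sub>R grad (u i) x) * \<psi> (x + s *\<^sub>R (\<chi> i. u i x)))"
      by (rule integral_cong) (use pos in \<open>auto simp: mat g_def U_def less_imp_le\<close>)
    ultimately show "integral (cball 0 1) (\<lambda>x. det (\<chi> i. axis i 1 + s *\<^sub>R grad (u i) x) * \<psi> (x + s *\<^sub>R (\<chi> i. u i x)))
      = integral (cball 0 1) \<psi>" by simp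
  qed
qed

lemma polyfam_affine_det:
  fixes u :: "'k::finite \<Rightarrow> real^'k \<Rightarrow> real"
  assumes "\<And>i. C1 (u i)"
  shows "polyfam (\<lambda>x s. det (\<chi> i. axis i 1 + s *\<^sub>R grad (u i) x))"
    and "polyfam (\<lambda>x s. det (\<chi> i. s *\<^sub>R axis i 1 + grad (u i) x))"
  using assms
  by (auto intro!: polyfam_det polyfam_add polyfam_mult polyfam_const polyfam_param continuous_intros
      C1_D_continuous simp: grad_nth)

text \<open>
  For a polynomial integrand both sides are polynomials in \<open>s\<close>, and they agree for small \<open>s\<close>. For
  large \<open>s\<close> the map need no longer be injective.
\<close>

lemma perturbed_identity_polynomial:
  fixes u :: "'k::{finite,wellorder} \<Rightarrow> real^'k::_ \<Rightarrow> real"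
  assumes u: "\<And>i. C1 (u i)" and zero: "\<And>i x. norm x \<ge> 1 \<Longrightarrow> u i x = 0"
    and g: "real_polynomial_function g"
  shows "integral (cball 0 1) (\<lambda>x. det (\<chi> i. axis i 1 + s *\<^sub>R grad (u i) x) * g (x + s *\<^sub>R (\<chi> i. u i x)))
    = integral (cball 0 1) g"
proof -
  have "polyfam (\<lambda>x s. g (x + s *\<^sub>R (\<chi> i. u i x)))"
    by (rule polyfam_real_polynomial_function[OF g])
       (auto simp: inner_add_left intro!: polyfam_add polyfam_mult polyfam_const polyfam_param
         continuous_on_inner continuous_on_id continuous_on_const continuous_on_vec_lambda C1_continuous_on[OF u])
  then have "polyfam (\<lambda>x s. det (\<chi> i. axis i 1 + s *\<^sub>R grad (u i) x) * g (x + s *\<^sub>R (\<chi> i. u i x)))"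
    by (intro polyfam_mult polyfam_affine_det u)
  from polyfam_integral[OF this compact_cball[of 0 1]] obtain p where p:
    "\<And>s. integral (cball 0 1) (\<lambda>x. det (\<chi> i. axis i 1 + s *\<^sub>R grad (u i) x) * g (x + s *\<^sub>R (\<chi> i. u i x))) = poly p s"
    by blast
  have gc: "continuous_on UNIV g"
    by (rule C1_continuous_on[OF C1_real_polynomial_function[OF g]])
  obtain s0 where s0: "s0 > 0" "\<forall>s \<psi>. 0 < s \<longrightarrow> s < s0 \<longrightarrow> continuous_on UNIV \<psi> \<longrightarrow>
      integral (cball 0 1) (\<lambda>x. det (\<chi> i. axis i 1 + s *\<^sub>R grad (u i) x) * \<psi> (x + s *\<^sub>R (\<chi> i. u i x)))
      = integral (cball 0 1) (\<psi> :: _ \<Rightarrow> real)"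
    using perturbed_identity_small[of u, OF u zero] by blast
  have "p = [:integral (cball 0 1) g:]"
  proof (rule poly_eq_on_interval[OF s0(1)])
    fix s assume "0 < s" "s < s0"
    from s0(2)[rule_format, OF this gc] show "poly p s = poly [:integral (cball 0 1) g:] s"
      by (simp add: p)
  qed
  then show ?thesis using p by simp
qed

text \<open>
  A map of the ball that is the identity near the sphere has degree one. Approximation of \<open>\<psi>\<close> by
  polynomials on the ball and on its image reduces this to the polynomial case.
\<close>

lemma perturbed_identity_degree:
  fixes u :: "'k::{finite,wellorder} \<Rightarrow> real^'k::_ \<Rightarrow> real"
  assumes u: "\<And>i. C1 (u i)" and zero: "\<And>i x. norm x \<ge> 1 \<Longrightarrow> u i x = 0"
    and \<psi>: "continuous_on UNIV \<psi>"
  shows "integral (cball 0 1) (\<lambda>x. det (\<chi> i. axis i 1 + grad (u i) x) * \<psi> (x + (\<chi> i. u i x)))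
    = integral (cball 0 1) (\<psi> :: _ \<Rightarrow> real)"
proof -
  let ?B = "cball (0::real^'k::_) 1"
  define J where "J x = det (\<chi> i. axis i 1 + grad (u i) x)" for x
  define h where "h x = x + (\<chi> i. u i x)" for x
  have Jc: "continuous_on UNIV J" unfolding J_def
    by (intro continuous_on_det continuous_on_vec_lambda continuous_intros grad_continuous u)
  have hc: "continuous_on UNIV h" unfolding h_def
    by (intro continuous_intros continuous_on_vec_lambda C1_continuous_on u)
  let ?K = "?B \<union> h ` ?B"
  have K: "compact ?K"
    by (intro compact_Un compact_continuous_image continuous_on_subset[OF hc]) auto
  have Jh: "continuous_on UNIV (\<lambda>x. J x * f (h x))" if "continuous_on UNIV f" for f :: "_ \<Rightarrow> real"
    by (intro continuous_intros Jc continuous_on_compose2[OF that hc]) auto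
  have int: "f integrable_on ?B" if "continuous_on UNIV f" for f :: "_ \<Rightarrow> real"
    by (intro integrable_compact continuous_on_subset[OF that]) auto
  define C where "C = integral ?B (\<lambda>x. \<bar>J x\<bar>) + integral ?B (\<lambda>x. 1)"
  have C0: "C \<ge> 0" unfolding C_def by (intro add_nonneg_nonneg integral_nonneg int continuous_intros Jc) auto
  have "\<bar>integral ?B (\<lambda>x. J x * \<psi> (h x)) - integral ?B \<psi>\<bar> \<le> e * C" if e: "e > 0" for e
  proof -
    obtain g where g: "real_polynomial_function g" "\<And>x. x \<in> ?K \<Longrightarrow> \<bar>\<psi> x - g x\<bar> < e"
      using Stone_Weierstrass_real_polynomial_function[OF K continuous_on_subset[OF \<psi> subset_UNIV] e] by blast
    have gc: "continuous_on UNIV g" by (rule C1_continuous_on[OF C1_real_polynomial_function[OF g(1)]])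
    have eq: "integral ?B (\<lambda>x. J x * g (h x)) = integral ?B g"
      using perturbed_identity_polynomial[of u g 1, OF u zero g(1)] by (simp add: J_def h_def)
    have "\<bar>integral ?B (\<lambda>x. J x * \<psi> (h x)) - integral ?B (\<lambda>x. J x * g (h x))\<bar>
      = norm (integral ?B (\<lambda>x. J x * \<psi> (h x) - J x * g (h x)))"
      by (subst integral_diff[OF int int]) (auto intro: Jh \<psi> gc)
    also have "\<dots> \<le> integral ?B (\<lambda>x. e * \<bar>J x\<bar>)"
    proof (rule integral_norm_bound_integral)
      fix x assume x: "x \<in> ?B"
      have "\<bar>\<psi> (h x) - g (h x)\<bar> < e" by (rule g(2)) (use x in blast)
      then have "\<bar>J x\<bar> * \<bar>\<psi> (h x) - g (h x)\<bar> \<le> \<bar>J x\<bar> * e"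
        by (intro mult_left_mono) auto
      moreover have "norm (J x * \<psi> (h x) - J x * g (h x)) = \<bar>J x\<bar> * \<bar>\<psi> (h x) - g (h x)\<bar>"
        unfolding right_diff_distrib[symmetric] real_norm_def abs_mult ..
      ultimately show "norm (J x * \<psi> (h x) - J x * g (h x)) \<le> e * \<bar>J x\<bar>"
        by (simp only: mult.commute)
    qed (intro int continuous_intros Jh \<psi> gc Jc)+
    finally have 1: "\<bar>integral ?B (\<lambda>x. J x * \<psi> (h x)) - integral ?B g\<bar> \<le> e * integral ?B (\<lambda>x. \<bar>J x\<bar>)"
      by (simp add: eq)
    have "\<bar>integral ?B g - integral ?B \<psi>\<bar> = norm (integral ?B (\<lambda>x. g x - \<psi> x))"
      by (subst integral_diff[OF int int]) (auto intro: \<psi> gc)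
    also have "\<dots> \<le> integral ?B (\<lambda>x. e * 1)"
      by (rule integral_norm_bound_integral)
         (use g(2) in \<open>auto intro!: int continuous_intros \<psi> gc less_imp_le simp: abs_minus_commute\<close>)
    finally have 2: "\<bar>integral ?B g - integral ?B \<psi>\<bar> \<le> e * integral ?B (\<lambda>x. 1)" by (simp only: integral_mult_right)
    show ?thesis using 1 2 by (simp add: C_def distrib_left)
  qed
  note est = this
  have "integral ?B (\<lambda>x. J x * \<psi> (h x)) = integral ?B \<psi>"
  proof (rule ccontr)
    assume ne: "integral ?B (\<lambda>x. J x * \<psi> (h x)) \<noteq> integral ?B \<psi>"
    define d where "d = \<bar>integral ?B (\<lambda>x. J x * \<psi> (h x)) - integral ?B \<psi>\<bar>"
    have "d > 0" using ne by (simp add: d_def)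
    have "d \<le> (d / (2 * (C + 1))) * C" using est[of "d / (2 * (C + 1))"] \<open>d > 0\<close> C0 by (simp add: d_def)
    also have "\<dots> < d" using \<open>d > 0\<close> C0 by (simp add: field_simps) (smt (verit) mult_nonneg_nonneg)
    finally show False by simp
  qed
  then show ?thesis by (simp add: J_def h_def)
qed

text \<open>
  Stokes' theorem for \<open>du\<^sub>1 \<and> \<dots> \<and> du\<^sub>N\<close>. The degree formula with \<open>\<psi> = 1\<close> gives the
  integral of \<open>det (t I + Du)\<close> for \<open>t > 0\<close> as a multiple of \<open>t\<^sup>N\<close>; it is a polynomial in \<open>t\<close>, and its
  value at \<open>t = 0\<close> is the integral in question.
\<close>

lemma integral_det_compact_support:
  fixes u :: "'k::{finite,wellorder} \<Rightarrow> real^'k::_ \<Rightarrow> real"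
  assumes u: "\<And>i. C1 (u i)" and zero: "\<And>i x. norm x \<ge> 1 \<Longrightarrow> u i x = 0"
  shows "integral (cball 0 1) (\<lambda>x. det (\<chi> i. grad (u i) x)) = 0"
proof -
  define V where "V = integral (cball (0::real^'k::_) 1) (\<lambda>x. 1::real)"
  obtain p where p: "\<And>t. integral (cball 0 1) (\<lambda>x. det (\<chi> i. t *\<^sub>R axis i 1 + grad (u i) x)) = poly p t"
    using polyfam_integral[OF polyfam_affine_det(2)[of u, OF u] compact_cball[of 0 1]] by blast
  have "poly p t = V * t ^ CARD('k)" if t: "t > 0" for t
  proof -
    have "V = integral (cball 0 1) (\<lambda>x. det (\<chi> i. axis i 1 + (1 / t) *\<^sub>R grad (u i) x))"
      using perturbed_identity_polynomial[of u "\<lambda>_. 1" "1 / t", OF u zero] by (simp add: V_def real_polynomial_function_eq)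
    then have "V * t ^ CARD('k) =
      integral (cball 0 1) (\<lambda>x. t ^ CARD('k) * det (\<chi> i. axis i 1 + (1 / t) *\<^sub>R grad (u i) x))"
      by (simp add: mult.commute)
    also have "(\<lambda>x. t ^ CARD('k) * det (\<chi> i. axis i 1 + (1 / t) *\<^sub>R grad (u i) x)) =
      (\<lambda>x. det (\<chi> i. t *s (axis i 1 + (1 / t) *\<^sub>R grad (u i) x)))"
      by (subst det_rows_mul) simp
    also have "\<dots> = (\<lambda>x. det (\<chi> i. t *\<^sub>R axis i 1 + grad (u i) x))"
      using t by (simp add: scalar_mult_eq_scaleR scaleR_add_right)
    finally show ?thesis using p by simp
  qed
  then have "p = monom V CARD('k)"
    by (intro poly_eq_on_interval[of 0 1]) (auto simp: poly_monom)
  then have "poly p 0 = 0" by (simp add: poly_monom)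
  then show ?thesis using p[of 0] by simp
qed

text \<open>
  It is enough that one factor vanishes near the sphere. Multiplication of all functions by a cutoff
  produces compact supports and does not change the determinant: wherever the cutoff is not
  locally one, row \<open>p\<close> is zero.
\<close>

lemma integral_det_eq_0:
  fixes u :: "'k::{finite,wellorder} \<Rightarrow> real^'k::_ \<Rightarrow> real"
  assumes u: "\<And>i. C1 (u i)" and r: "0 \<le> r" "r < 1" "1 < R"
    and zero: "\<And>x. r < norm x \<Longrightarrow> norm x < R \<Longrightarrow> u p x = 0"
  shows "integral (cball 0 1) (\<lambda>x. det (\<chi> i. grad (u i) x)) = 0"
proof -
  define r1 where "r1 = (r + 1) / 2"
  have r1: "r < r1" "r1 < 1" "0 \<le> r1" using r by (auto simp: r1_def)
  define w where "w i x = cutoff r1 1 x * u i x" for i x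
  have w: "C1 (w i)" for i unfolding w_def by (intro C1_mult C1_cutoff u)
  have "integral (cball 0 1) (\<lambda>x. det (\<chi> i. grad (w i) x)) = 0"
    by (rule integral_det_compact_support[OF w]) (simp add: w_def cutoff_0 r1)
  moreover have "det (\<chi> i. grad (w i) x) = det (\<chi> i. grad (u i) x)" if x: "x \<in> cball 0 1" for x
  proof (cases "norm x < r1")
    case True
    have "grad (w i) x = grad (u i) x" for i
      by (rule grad_local[OF u, where S="ball 0 r1"]) (use True r1 in \<open>auto simp: w_def cutoff_1\<close>)
    then show ?thesis by simp
  next
    case False
    have op: "open (ball (0::real^'k::_) R - cball 0 r)" by auto
    have xin: "x \<in> ball 0 R - cball 0 r" using False r1 x r by auto
    have "grad (u p) x = 0"
      using grad_local[OF C1_const[of 0] op xin, of "u p"] zero by auto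
    moreover have "grad (w p) x = 0"
      using grad_local[OF C1_const[of 0] op xin, of "w p"] zero by (auto simp: w_def)
    ultimately have "row p (\<chi> i. grad (u i) x) = 0" "row p (\<chi> i. grad (w i) x) = 0"
      by (simp_all add: row_def vec_eq_iff)
    then show ?thesis by (simp add: det_zero_row)
  qed
  then have "integral (cball 0 1) (\<lambda>x. det (\<chi> i. grad (w i) x)) =
      integral (cball 0 1) (\<lambda>x. det (\<chi> i. grad (u i) x))"
    by (rule integral_cong)
  ultimately show ?thesis by simp
qed

text \<open>
  Near the sphere \<open>h\<close> is deformed to the identity along segments. A point of norm at least \<open>3/4\<close> that is
  moved by at most \<open>1/2\<close> keeps norm at least \<open>1/4\<close>, so the deformation stays outside the support of
  \<open>\<psi>\<close> and leaves the integrand unchanged.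
\<close>

lemma degree_near_identity:
  fixes h :: "real ^ 'k::{finite,wellorder} \<Rightarrow> real^'k::_"
  assumes h: "\<And>i. C1 (\<lambda>x. h x $ i)" and r: "3 / 4 \<le> r" "r < 1"
    and near: "\<And>x. r < norm x \<Longrightarrow> norm x \<le> 1 \<Longrightarrow> norm (h x - x) \<le> 1 / 2"
    and \<psi>: "continuous_on UNIV \<psi>" and \<psi>0: "\<And>y. norm y \<ge> 1 / 4 \<Longrightarrow> \<psi> y = 0"
  shows "integral (cball 0 1) (\<lambda>x. det (\<chi> i. grad (\<lambda>x. h x $ i) x) * \<psi> (h x))
    = integral (cball 0 1) (\<psi> :: _ \<Rightarrow> real)"
proof -
  define r1 where "r1 = (r + 1) / 2"
  have r1: "r < r1" "r1 < 1" "0 \<le> r1" using r by (auto simp: r1_def)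
  define \<chi>' where "\<chi>' = (cutoff r1 1 :: real^'k::_ \<Rightarrow> real)"
  define u where "u i x = \<chi>' x * (h x $ i - x $ i)" for i x
  have u: "C1 (u i)" for i unfolding u_def \<chi>'_def by (intro C1_mult C1_cutoff C1_diff C1_coord h)
  have "integral (cball 0 1) (\<lambda>x. det (\<chi> i. axis i 1 + grad (u i) x) * \<psi> (x + (\<chi> i. u i x)))
    = integral (cball 0 1) \<psi>"
    by (rule perturbed_identity_degree[OF u _ \<psi>]) (simp add: u_def \<chi>'_def cutoff_0 r1)
  moreover have "det (\<chi> i. axis i 1 + grad (u i) x) * \<psi> (x + (\<chi> i. u i x)) =
     det (\<chi> i. grad (\<lambda>x. h x $ i) x) * \<psi> (h x)" if x: "x \<in> cball 0 1" for x
  proof (cases "norm x < r1")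
    case True
    have "grad (u i) x = grad (\<lambda>x. h x $ i - x $ i) x" for i
      by (rule grad_local[where S="ball 0 r1"])
        (use True r1 in \<open>auto simp: u_def \<chi>'_def cutoff_1 intro!: C1_diff h C1_coord\<close>)
    then have "axis i 1 + grad (u i) x = grad (\<lambda>x. h x $ i) x" for i
      by (simp add: grad_diff h C1_coord grad_coord)
    moreover have "x + (\<chi> i. u i x) = h x"
      using True by (simp add: vec_eq_iff u_def \<chi>'_def cutoff_1 r1)
    ultimately show ?thesis by simp
  next
    case False
    have nx: "3 / 4 \<le> norm x" using False r1 r by simp
    have nr: "norm (h x - x) \<le> 1 / 2" using near False r1 x by simp
    have a: "norm (x + c *\<^sub>R (h x - x)) \<ge> 1 / 4" if "0 \<le> c" "c \<le> 1" for c
    proof -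
      have "norm (c *\<^sub>R (h x - x)) \<le> 1 / 2"
        using mult_mono[OF that(2) nr] that by (simp add: mult_le_one)
      then show ?thesis using nx norm_diff_ineq[of x "c *\<^sub>R (h x - x)"] by linarith
    qed
    have "x + (\<chi> i. u i x) = x + \<chi>' x *\<^sub>R (h x - x)"
      by (simp add: vec_eq_iff u_def)
    moreover have "norm (x + \<chi>' x *\<^sub>R (h x - x)) \<ge> 1 / 4"
      by (rule a) (simp_all add: \<chi>'_def cutoff_range)
    ultimately have "\<psi> (x + (\<chi> i. u i x)) = 0"
      by (simp only: \<psi>0)
    moreover have "\<psi> (h x) = 0" using \<psi>0 a[of 1] by simp
    ultimately show ?thesis by simp
  qed
  then have "integral (cball 0 1) (\<lambda>x. det (\<chi> i. axis i 1 + grad (u i) x) * \<psi> (x + (\<chi> i. u i x))) =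
      integral (cball 0 1) (\<lambda>x. det (\<chi> i. grad (\<lambda>x. h x $ i) x) * \<psi> (h x))"
    by (rule integral_cong)
  ultimately show ?thesis by simp
qed

section \<open>The Lefschetz property\<close>

text \<open>
  This is the Lefschetz property in coordinates. An index \<open>(j, True)\<close> stands for \<open>dx\<^sub>j\<close>, an index
  \<open>(j, False)\<close> for \<open>dy\<^sub>j\<close>, and \<open>\<Phi>\<close> is an alternating functional on products of more
  than \<open>n\<close> of these; the hypothesis is that the multiples of \<open>\<Sum>\<^sub>j dx\<^sub>j \<and> dy\<^sub>j\<close> are negligible.
  A nonzero product consists of the pairs \<open>dx\<^sub>j \<and> dy\<^sub>j\<close> with \<open>j\<close> in a set \<open>P\<close> and of single factors.
  Up to the factor \<open>card P!\<close> it is the product of the single factors with the power of order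
  \<open>card P\<close> of \<open>\<Sum>\<^bsub>j\<in>P\<^esub> dx\<^sub>j \<and> dy\<^sub>j\<close>. Modulo negligible terms this sum may be replaced by minus the sum
  over the complement of \<open>P\<close>. There the single factors kill all summands except those from the
  set \<open>Q\<close> of indices that do not occur at all, and \<open>card Q < card P\<close>, so the power is zero.
\<close>

lemma alternating_limit_zero:
  fixes \<Phi> :: "nat \<Rightarrow> ('k::finite \<Rightarrow> 'n::finite \<times> bool) \<Rightarrow> real"
  assumes alt: "\<And>i I p q. p \<noteq> q \<Longrightarrow> \<Phi> i (I \<circ> Transposition.transpose p q) = - \<Phi> i I"
    and rel: "\<And>I p q. p \<noteq> q \<Longrightarrow> (\<lambda>i. \<Sum>j\<in>UNIV. \<Phi> i (I(p := (j, True), q := (j, False)))) \<longlonglongrightarrow> 0"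
    and card: "CARD('n) < CARD('k)"
  shows "(\<lambda>i. \<Phi> i I) \<longlonglongrightarrow> 0"
proof -
  have rep: "\<Phi> i J = 0" if ninj: "\<not> inj J" for i J
  proof -
    obtain p q where pq: "p \<noteq> q" "J p = J q" using ninj unfolding inj_def by blast
    have "J \<circ> Transposition.transpose p q = J"
      by (rule ext) (simp add: Transposition.transpose_def pq(2))
    then have "\<Phi> i J = - \<Phi> i J" using alt[OF pq(1), of i J] by metis
    then show ?thesis by linarith
  qed
  show ?thesis
  proof (cases "inj I")
    case False
    then show ?thesis by (simp add: rep)
  next
    case inj: True
    \<comment> \<open>\<open>P\<close> indexes the complete pairs, \<open>Q\<close> the indices that do
      not occur.\<close>
    define P where "P = {j. (j, True) \<in> range I \<and> (j, False) \<in> range I}"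
    define Q where "Q = {j. (j, True) \<notin> range I \<and> (j, False) \<notin> range I}"
    have QP: "card Q < card P"
    proof -
      define c where "c j = card {v. (j, v) \<in> range I}" for j
      have c: "c j + of_bool (j \<in> Q) = 1 + of_bool (j \<in> P)" for j
      proof -
        have "{v. (j, v) \<in> range I} =
          (if (j, True) \<in> range I then {True} else {}) \<union> (if (j, False) \<in> range I then {False} else {})"
          (is "_ = ?C")
        proof (rule set_eqI)
          fix v show "v \<in> {v. (j, v) \<in> range I} \<longleftrightarrow> v \<in> ?C" by (cases v) auto
        qed
        then show ?thesis unfolding c_def P_def Q_def by simp
      qed
      have R: "range I = Sigma UNIV (\<lambda>j. {v. (j, v) \<in> range I})"
        by (simp add: Sigma_def set_eq_iff)
      have "card (Sigma UNIV (\<lambda>j. {v. (j, v) \<in> range I})) = (\<Sum>j\<in>UNIV. c j)"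
        unfolding c_def by (rule card_SigmaI) auto
      then have "card (range I) = (\<Sum>j\<in>UNIV. c j)"
        by (simp only: R[symmetric])
      then have "CARD('k) + card Q = (\<Sum>j\<in>UNIV. c j + of_bool (j \<in> Q))"
        by (simp add: card_image[OF inj] sum.distrib)
      also have "\<dots> = CARD('n) + card P" unfolding c by (simp only: sum.distrib) simp
      finally show ?thesis using card by simp
    qed
    \<comment> \<open>\<open>sub b\<close> replaces the pair with index \<open>j\<close> by the pair
      with index \<open>b j\<close>. The sum \<open>S i (X R)\<close> is the expansion of a product of
      \<open>card P\<close> factors: those with index in \<open>R\<close> are sums of pairs over the
      complement of \<open>P\<close>, the others over \<open>P\<close>.\<close>
    define sub where "sub b p = (if fst (I p) \<in> P then (b (fst (I p)), snd (I p)) else I p)" for b :: "'n \<Rightarrow> 'n" and p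
    define X where "X R = (\<lambda>j. if j \<notin> P then {j} else if j \<in> R then - P else P)" for R
    define S where "S i Y = (\<Sum>b\<in>{b. \<forall>j. b j \<in> Y j}. \<Phi> i (sub b))" for i and Y :: "'n \<Rightarrow> 'n set"
    have step: "(\<lambda>i. S i (X R) + S i (X (insert p R))) \<longlonglongrightarrow> 0" if p: "p \<in> P" "p \<notin> R" for p R
    proof -
      define Y where "Y = (X R)(p := UNIV)"
      define Y0 where "Y0 = (X R)(p := {p})"
      have XR: "X R p = P" "X (insert p R) p = - P" "\<And>j. j \<noteq> p \<Longrightarrow> X (insert p R) j = X R j"
        using p by (auto simp: X_def)
      have "{b. \<forall>j. b j \<in> Y j} = {b. \<forall>j. b j \<in> X R j} \<union> {b. \<forall>j. b j \<in> X (insert p R) j}"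
        unfolding Y_def using XR by (auto simp: fun_upd_def split: if_splits) (metis Compl_iff)+
      moreover have "{b. \<forall>j. b j \<in> X R j} \<inter> {b. \<forall>j. b j \<in> X (insert p R) j} = {}"
        using XR by auto
      ultimately have 1: "S i (X R) + S i (X (insert p R)) = S i Y" for i
        unfolding S_def by (subst sum.union_disjoint[symmetric]) auto
      obtain k1 k2 where k: "I k1 = (p, True)" "I k2 = (p, False)"
        using p(1) unfolding P_def by (metis (no_types, lifting) mem_Collect_eq rangeE)
      have k12: "k1 \<noteq> k2" using k by auto
      have upd: "sub (b(p := j)) = (sub b)(k1 := (j, True), k2 := (j, False))" for b j
      proof
        fix l
        show "sub (b(p := j)) l = ((sub b)(k1 := (j, True), k2 := (j, False))) l"
        proof (cases "fst (I l) = p")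
          case True
          then have "I l = I k1 \<or> I l = I k2" using k by (cases "I l") auto
          then have "l = k1 \<or> l = k2" using inj by (auto simp: inj_eq)
          then show ?thesis using k k12 p by (auto simp: sub_def)
        next
          case False
          then have "l \<noteq> k1" "l \<noteq> k2" using k by auto
          then show ?thesis using False by (simp add: sub_def)
        qed
      qed
      have "S i Y = (\<Sum>b\<in>{b. \<forall>j. b j \<in> Y0 j}. \<Sum>j\<in>UNIV. \<Phi> i (sub (b(p := j))))" for i
      proof -
        have "(\<Sum>b\<in>{b. \<forall>j. b j \<in> Y0 j}. \<Sum>j\<in>UNIV. \<Phi> i (sub (b(p := j)))) =
           (\<Sum>(b, j)\<in>{b. \<forall>j. b j \<in> Y0 j} \<times> UNIV. \<Phi> i (sub (b(p := j))))"
          by (simp add: sum.cartesian_product)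
        also have "\<dots> = S i Y" unfolding S_def
        proof (rule sum.reindex_bij_witness[where i="\<lambda>b. (b(p := p), b p)" and j="\<lambda>(b, j). b(p := j)"])
          have Yp: "Y0 p = {p}" "Y p = UNIV" "\<And>j. j \<noteq> p \<Longrightarrow> Y j = Y0 j" by (auto simp: Y0_def Y_def)
          fix a assume a: "a \<in> {b. \<forall>j. b j \<in> Y0 j} \<times> (UNIV :: 'n set)"
          obtain b x where bx: "a = (b, x)" by (cases a)
          then have b: "\<And>j. b j \<in> Y0 j" using a by simp
          then have bp: "b p = p" using Yp(1) by auto
          show "(\<lambda>b. (b(p := p), b p)) ((\<lambda>(b, j). b(p := j)) a) = a"
            using bp bx fun_upd_triv[of b p] by simp
          show "(\<lambda>(b, j). b(p := j)) a \<in> {b. \<forall>j. b j \<in> Y j}"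
            using b Yp by (simp add: bx)
          show "\<Phi> i (sub ((\<lambda>(b, j). b(p := j)) a)) = (case a of (b, j) \<Rightarrow> \<Phi> i (sub (b(p := j))))"
            by (simp add: bx)
        next
          have Yp: "Y0 p = {p}" "Y p = UNIV" "\<And>j. j \<noteq> p \<Longrightarrow> Y j = Y0 j" by (auto simp: Y0_def Y_def)
          fix b assume b: "b \<in> {b. \<forall>j. b j \<in> Y j}"
          show "(\<lambda>(b, j). b(p := j)) (b(p := p), b p) = b" by simp
          show "(b(p := p), b p) \<in> {b. \<forall>j. b j \<in> Y0 j} \<times> (UNIV :: 'n set)"
            using b Yp(1) by (auto simp flip: Yp(3))
        qed
        finally show ?thesis by simp
      qed
      then have "(\<lambda>i. S i Y) = (\<lambda>i. \<Sum>b\<in>{b. \<forall>j. b j \<in> Y0 j}. \<Sum>j\<in>UNIV. \<Phi> i ((sub b)(k1 := (j, True), k2 := (j, False))))"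
        by (simp add: upd)
      also have "\<dots> \<longlonglongrightarrow> (\<Sum>b\<in>{b. \<forall>j. b j \<in> Y0 j}. 0)"
        by (intro tendsto_sum rel k12)
      finally show ?thesis unfolding 1 by simp
    qed
    \<comment> \<open>Every summand repeats an index: either \<open>b\<close> sends two pairs to the
      same place, or it hits one of the single factors, as \<open>Q\<close> is too small to receive all
      of \<open>P\<close>.\<close>
    have SP: "S i (X P) = 0" for i
      unfolding S_def
    proof (rule sum.neutral, rule ballI, rule rep)
      fix b assume "b \<in> {b. \<forall>j. b j \<in> X P j}"
      then have b: "\<And>j. j \<in> P \<Longrightarrow> b j \<notin> P" by (auto simp: X_def split: if_splits)
      show "\<not> inj (sub b)"
      proof (cases "inj_on b P")
        case False
        then obtain j j' where j: "j \<in> P" "j' \<in> P" "j \<noteq> j'" "b j = b j'" unfolding inj_on_def by blast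
        obtain k k' where "I k = (j, True)" "I k' = (j', True)"
          using j unfolding P_def by (metis (no_types, lifting) mem_Collect_eq rangeE)
        then have "sub b k = sub b k'" "k \<noteq> k'" using j by (auto simp: sub_def)
        then show ?thesis by (auto simp: inj_def)
      next
        case True
        have "\<not> b ` P \<subseteq> Q" using QP card_mono[of Q "b ` P"] card_image[OF True] by auto
        then obtain j where j: "j \<in> P" "b j \<notin> Q" by blast
        then obtain v k where k: "I k = (b j, v)" unfolding Q_def by (metis (no_types, lifting) mem_Collect_eq rangeE)
        obtain k' where k': "I k' = (j, v)"
          using j(1) unfolding P_def by (metis (full_types, lifting) mem_Collect_eq rangeE)
        have "sub b k = sub b k'" "k \<noteq> k'" using k k' b[OF j(1)] j(1) by (auto simp: sub_def)
        then show ?thesis by (auto simp: inj_def)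
      qed
    qed
    have "R \<subseteq> P \<Longrightarrow> (\<lambda>i. S i (X (P - R))) \<longlonglongrightarrow> 0" for R
    proof (induction R rule: infinite_finite_induct)
      case (insert p R)
      have "insert p (P - insert p R) = P - R" using insert by auto
      then have "(\<lambda>i. S i (X (P - insert p R)) + S i (X (P - R))) \<longlonglongrightarrow> 0"
        using step[of p "P - insert p R"] insert.prems by simp
      from tendsto_diff[OF this insert.IH] insert.prems show ?case by simp
    qed (auto simp: SP)
    from this[of P] have S0: "(\<lambda>i. S i (X {})) \<longlonglongrightarrow> 0" by simp
    \<comment> \<open>Exchanging two pairs is an even permutation of the factors.\<close>
    have perm: "\<Phi> i (sub b) = \<Phi> i I" if "b permutes P" for b i
      using that finite[of P]
    proof (induction rule: permutes_induct)
      case id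
      have "sub id = I" by (auto simp: sub_def fun_eq_iff)
      then show ?case by (simp only:)
    next
      case (swap a b \<pi>)
      have "a \<in> \<pi> ` P" "b \<in> \<pi> ` P"
        using \<open>a \<in> P\<close> \<open>b \<in> P\<close> permutes_image[OF \<open>\<pi> permutes P\<close>] by simp_all
      then obtain a' b' where ab: "a' \<in> P" "\<pi> a' = a" "b' \<in> P" "\<pi> b' = b"
        by blast
      obtain k1 k2 k3 k4 where k: "I k1 = (a', True)" "I k2 = (b', True)" "I k3 = (a', False)" "I k4 = (b', False)"
        using ab unfolding P_def by (metis (no_types, lifting) mem_Collect_eq rangeE)
      have ne: "k1 \<noteq> k2" "k3 \<noteq> k4" "k1 \<noteq> k3" "k1 \<noteq> k4" "k2 \<noteq> k3" "k2 \<noteq> k4"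
        using k ab swap by auto
      have "sub (Transposition.transpose a b \<circ> \<pi>) = (sub \<pi> \<circ> Transposition.transpose k1 k2) \<circ> Transposition.transpose k3 k4"
      proof
        fix l
        have abP: "\<pi> j = a \<longleftrightarrow> j = a'" "\<pi> j = b \<longleftrightarrow> j = b'" for j
          using permutes_inj[OF \<open>\<pi> permutes P\<close>] ab by (auto simp: inj_eq)
        show "sub (Transposition.transpose a b \<circ> \<pi>) l = ((sub \<pi> \<circ> Transposition.transpose k1 k2) \<circ> Transposition.transpose k3 k4) l"
        proof (cases "l \<in> {k1, k2, k3, k4}")
          case True
          then show ?thesis using ne k ab by (auto simp: sub_def Transposition.transpose_def)
        next
          case False
          then have "I l \<noteq> I k1" "I l \<noteq> I k2" "I l \<noteq> I k3" "I l \<noteq> I k4" using inj by (auto simp: inj_eq)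
          then have "fst (I l) \<noteq> a'" "fst (I l) \<noteq> b'" using k by (cases "I l"; cases "snd (I l)"; auto)+
          then show ?thesis using False abP by (auto simp: sub_def Transposition.transpose_def)
        qed
      qed
      then have "\<Phi> i (sub (Transposition.transpose a b \<circ> \<pi>)) = \<Phi> i (sub \<pi>)"
        using alt[OF ne(2)] alt[OF ne(1)] by (simp only: minus_minus)
      then show ?case using swap by (simp only:)
    qed
    have "S i (X {}) = fact (card P) * \<Phi> i I" for i
    proof -
      have "S i (X {}) = (\<Sum>b\<in>{b. b permutes P}. \<Phi> i (sub b))"
        unfolding S_def
      proof (rule sum.mono_neutral_right)
        show "{b. b permutes P} \<subseteq> {b. \<forall>j. b j \<in> X {} j}"
          by (auto simp: X_def permutes_in_image permutes_def)
        show "\<forall>b\<in>{b. \<forall>j. b j \<in> X {} j} - {b. b permutes P}. \<Phi> i (sub b) = 0"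
        proof (rule ballI, rule rep)
          fix b assume b: "b \<in> {b. \<forall>j. b j \<in> X {} j} - {b. b permutes P}"
          then have out: "\<And>j. j \<notin> P \<Longrightarrow> b j = j" and into: "b ` P \<subseteq> P"
            by (auto simp: X_def split: if_splits)
          have "\<not> inj_on b P"
          proof
            assume i: "inj_on b P"
            then have "bij_betw b P P"
              using into by (simp add: bij_betw_def endo_inj_surj)
            then have "b permutes P" using out by (intro bij_imp_permutes) auto
            then show False using b by blast
          qed
          then obtain j j' where j: "j \<in> P" "j' \<in> P" "j \<noteq> j'" "b j = b j'" unfolding inj_on_def by blast
          obtain k k' where "I k = (j, True)" "I k' = (j', True)"
            using j unfolding P_def by (metis (no_types, lifting) mem_Collect_eq rangeE)
          then have "sub b k = sub b k'" "k \<noteq> k'" using j by (auto simp: sub_def)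
          then show "\<not> inj (sub b)" by (auto simp: inj_def)
        qed
      qed simp
      also have "\<dots> = fact (card P) * \<Phi> i I"
        by (simp add: perm card_permutations[OF refl])
      finally show ?thesis .
    qed
    then have "(\<lambda>i. inverse (fact (card P)) * (fact (card P) * \<Phi> i I)) \<longlonglongrightarrow> inverse (fact (card P)) * 0"
      using S0 by (intro tendsto_intros) simp
    then show ?thesis by (simp add: mult.assoc[symmetric])
  qed
qed

section \<open>A partition of unity on a grid\<close>

text \<open>
  The translates of this function by the integers sum to one, by telescoping.
\<close>

definition hat :: "real \<Rightarrow> real" where "hat s = step s - step (s - 1)"

definition hat' :: "real \<Rightarrow> real" where "hat' s = step' s - step' (s - 1)"

lemma DERIV_hat: "(hat has_real_derivative hat' s) (at s)"
proof -
  have "((\<lambda>s. step (s - 1)) has_real_derivative step' (s - 1)) (at s)"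
    using DERIV_chain2[OF DERIV_step, of "\<lambda>s. s - 1" 1 s UNIV] DERIV_diff[OF DERIV_ident DERIV_const[of "1::real"]] by simp
  then show ?thesis unfolding hat_def[abs_def] hat'_def by (intro DERIV_diff DERIV_step)
qed

lemma hat_range: "0 \<le> hat s" "hat s \<le> 1"
  using step_mono[of "s - 1" s] step_range[of s] step_range[of "s - 1"] by (auto simp: hat_def)

lemma hat_outside: "\<not> (0 < s \<and> s < 2) \<Longrightarrow> hat s = 0 \<and> hat' s = 0"
  using step_0[of s] step_0[of "s - 1"] step_1[of s] step_1[of "s - 1"] step'_outside[of s] step'_outside[of "s - 1"]
  by (auto simp: hat_def hat'_def)

lemma hat'_le: "\<bar>hat' s\<bar> \<le> 2"
  using step'_nonneg[of s] step'_nonneg[of "s - 1"] step'_le[of s] step'_le[of "s - 1"] by (auto simp: hat'_def)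

lemma C1_hat: "C1 hat"
  by (rule C1_real[OF DERIV_hat]) (unfold hat'_def step'_def, intro continuous_intros)

lemma sum_hat:
  assumes "\<bar>s\<bar> + 1 \<le> real n"
  shows "(\<Sum>m\<in>{- int n..int n}. hat (s - of_int m)) = 1"
proof -
  have "(\<Sum>m\<in>{- int n..int n}. hat (s - of_int m)) = step (s + real n) - step (s - real n - 1)"
  proof (induction n)
    case 0
    then show ?case by (simp add: hat_def)
  next
    case (Suc n)
    have "{- int (Suc n)..int (Suc n)} = insert (- int (Suc n)) (insert (int (Suc n)) {- int n..int n})" by auto
    moreover have "- int (Suc n) \<notin> insert (int (Suc n)) {- int n..int n}" "int (Suc n) \<notin> {- int n..int n}" by auto
    ultimately have "(\<Sum>m\<in>{- int (Suc n)..int (Suc n)}. hat (s - of_int m)) =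
      hat (s + real (Suc n)) + (hat (s - real (Suc n)) + (\<Sum>m\<in>{- int n..int n}. hat (s - of_int m)))"
      by (simp add: algebra_simps)
    then show ?case unfolding Suc by (simp add: hat_def algebra_simps)
  qed
  then show ?thesis using assms step_1[of "s + real n"] step_0[of "s - real n - 1"] by simp
qed

definition bump :: "real \<Rightarrow> ('k::finite \<Rightarrow> int) \<Rightarrow> real ^ 'k \<Rightarrow> real"
  where "bump \<epsilon> v x = (\<Prod>i\<in>UNIV. hat (x $ i / \<epsilon> - of_int (v i)))"

lemma C1_bump: "C1 (bump \<epsilon> v)"
proof -
  have "C1 (\<lambda>x::real^'a. inverse \<epsilon> * x $ i - of_int (v i))" for i
    by (intro C1_diff C1_mult C1_const C1_coord)
  from C1_compose[OF C1_hat this] have "C1 (\<lambda>x::real^'a. hat (x $ i / \<epsilon> - of_int (v i)))" for i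
    by (simp add: divide_inverse mult.commute)
  then show ?thesis unfolding bump_def by (intro C1_prod)
qed

lemma grad_bump:
  "grad (bump \<epsilon> v) x $ j =
    hat' (x $ j / \<epsilon> - of_int (v j)) / \<epsilon> * (\<Prod>i\<in>UNIV - {j}. hat (x $ i / \<epsilon> - of_int (v i)))"
proof -
  let ?s = "\<lambda>i. x $ i / \<epsilon> - of_int (v i)"
  have 1: "((\<lambda>x. hat (x $ i / \<epsilon> - of_int (v i))) has_derivative (\<lambda>y. y $ i / \<epsilon> * hat' (?s i))) (at x)" for i
  proof -
    have a: "((\<lambda>x. x $ i / \<epsilon> - of_int (v i)) has_derivative (\<lambda>y. y $ i / \<epsilon>)) (at x)"
      unfolding divide_inverse
      by (auto intro!: derivative_eq_intros bounded_linear_imp_has_derivative bounded_linear_vec_nth)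
    have b: "(hat has_derivative (\<lambda>y. y * hat' (?s i))) (at (?s i))"
      using DERIV_hat[of "?s i"] by (simp add: has_field_derivative_def mult.commute[of _ "hat' (?s i)"])
    show ?thesis using has_derivative_compose[OF a b] by simp
  qed
  have "(bump \<epsilon> v has_derivative (\<lambda>y. \<Sum>i\<in>UNIV. (y $ i / \<epsilon> * hat' (?s i)) * (\<Prod>l\<in>UNIV - {i}. hat (?s l)))) (at x)"
    unfolding bump_def[abs_def] by (rule has_derivative_prod) (rule 1)
  from C1_D_eq[OF C1_bump this] have "grad (bump \<epsilon> v) x $ j =
     (\<Sum>i\<in>UNIV. (axis j 1 $ i / \<epsilon> * hat' (?s i)) * (\<Prod>l\<in>UNIV - {i}. hat (?s l)))"
    by (simp add: grad_nth)
  also have "\<dots> = (\<Sum>i\<in>UNIV. if i = j then hat' (?s i) / \<epsilon> * (\<Prod>l\<in>UNIV - {i}. hat (?s l)) else 0)"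
    by (rule sum.cong) (auto simp: axis_def)
  finally show ?thesis by simp
qed

lemma bump_support:
  assumes "bump \<epsilon> v x \<noteq> 0 \<or> grad (bump \<epsilon> v) x $ j \<noteq> 0"
  shows "0 < x $ i / \<epsilon> - of_int (v i) \<and> x $ i / \<epsilon> - of_int (v i) < 2"
proof (rule ccontr)
  assume "\<not> ?thesis"
  then have *: "hat (x $ i / \<epsilon> - of_int (v i)) = 0" "hat' (x $ i / \<epsilon> - of_int (v i)) = 0"
    using hat_outside by blast+
  then have "bump \<epsilon> v x = 0" unfolding bump_def by (intro prod_zero) auto
  moreover have "grad (bump \<epsilon> v) x $ j = 0"
  proof (cases "i = j")
    case False
    then have "(\<Prod>i\<in>UNIV - {j}. hat (x $ i / \<epsilon> - of_int (v i))) = 0"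
      using * by (intro prod_zero) auto
    then show ?thesis by (simp add: grad_bump)
  qed (use * in \<open>simp add: grad_bump\<close>)
  ultimately show False using assms by simp
qed

lemma bump_nonneg: "0 \<le> bump \<epsilon> v x"
  unfolding bump_def by (intro prod_nonneg) (simp add: hat_range)

lemma sum_bump:
  fixes x :: "real ^ 'k::finite"
  assumes "0 < \<epsilon>" "norm x / \<epsilon> + 1 \<le> real n"
  shows "(\<Sum>v\<in>PiE UNIV (\<lambda>_. {- int n..int n}). bump \<epsilon> v x) = 1"
proof -
  have "(\<Sum>v\<in>PiE UNIV (\<lambda>_. {- int n..int n}). bump \<epsilon> v x) =
      (\<Prod>i\<in>UNIV. \<Sum>m\<in>{- int n..int n}. hat (x $ i / \<epsilon> - of_int m))"
    unfolding bump_def by (rule prod_sum_PiE[symmetric]) auto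
  also have "\<dots> = 1"
  proof (rule prod.neutral, rule ballI, rule sum_hat)
    fix i
    have "\<bar>x $ i\<bar> / \<epsilon> \<le> norm x / \<epsilon>" using assms by (intro divide_right_mono component_le_norm_cart) auto
    then show "\<bar>x $ i / \<epsilon>\<bar> + 1 \<le> real n" using assms by (simp add: abs_divide)
  qed
  finally show ?thesis .
qed

lemma norm_le_card_mult:
  fixes x :: "real ^ 'k::finite"
  assumes "\<And>i. \<bar>x $ i\<bar> \<le> e" shows "norm x \<le> real CARD('k) * e"
proof -
  have "norm x \<le> (\<Sum>i\<in>UNIV. \<bar>x $ i\<bar>)" by (rule norm_le_l1_cart)
  also have "\<dots> \<le> (\<Sum>i\<in>(UNIV::'k set). e)" by (intro sum_mono assms)
  finally show ?thesis by simp
qed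

text \<open>
  A partition of unity with the scale-invariant bounds of a mollifier. At each point at most two
  integers are active in each coordinate, so at most \<open>2\<^sup>N\<close> bumps contribute, \<open>N\<close> being the dimension,
  and the partial derivatives of each are at most \<open>2 / \<epsilon>\<close>.
\<close>

lemma grid_partition:
  "\<exists>C>0. \<forall>\<epsilon>>0. \<exists>V pt k. finite (V :: ('k::finite \<Rightarrow> int) set) \<and> (\<forall>v. C1 (k v)) \<and> (\<forall>v x. 0 \<le> k v x) \<and>
     (\<forall>x::real^'k. norm x \<le> 2 \<longrightarrow> (\<Sum>v\<in>V. k v x) = 1) \<and>
     (\<forall>x j. norm x \<le> 2 \<longrightarrow> (\<Sum>v\<in>V. grad (k v) x $ j) = 0) \<and>
     (\<forall>v x j. k v x \<noteq> 0 \<or> grad (k v) x $ j \<noteq> 0 \<longrightarrow> norm (x - pt v) \<le> C * \<epsilon>) \<and>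
     (\<forall>x j. norm x \<le> 2 \<longrightarrow> (\<Sum>v\<in>V. \<bar>grad (k v) x $ j\<bar>) \<le> C / \<epsilon>)"
proof -
  \<comment> \<open>The first number bounds the sum of the gradients, the second the distance to an
    active node.\<close>
  define C where "C = max (2 ^ CARD('k) * 2) (2 * real CARD('k))"
  have "C > 0" by (simp add: C_def)
  moreover have "\<exists>V pt k. finite (V :: ('k::finite \<Rightarrow> int) set) \<and> (\<forall>v. C1 (k v)) \<and> (\<forall>v x. 0 \<le> k v x) \<and>
     (\<forall>x::real^'k. norm x \<le> 2 \<longrightarrow> (\<Sum>v\<in>V. k v x) = 1) \<and>
     (\<forall>x j. norm x \<le> 2 \<longrightarrow> (\<Sum>v\<in>V. grad (k v) x $ j) = 0) \<and>
     (\<forall>v x j. k v x \<noteq> 0 \<or> grad (k v) x $ j \<noteq> 0 \<longrightarrow> norm (x - pt v) \<le> C * \<epsilon>) \<and>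
     (\<forall>x j. norm x \<le> 2 \<longrightarrow> (\<Sum>v\<in>V. \<bar>grad (k v) x $ j\<bar>) \<le> C / \<epsilon>)" if \<epsilon>: "\<epsilon> > 0" for \<epsilon> :: real
  proof -
    obtain n :: nat where n: "3 / \<epsilon> + 1 \<le> real n" using real_arch_simple by blast
    define V where "V = PiE (UNIV :: 'k set) (\<lambda>_. {- int n..int n})"
    have finV: "finite V" unfolding V_def by (intro finite_PiE) auto
    define pt where "pt v = (\<chi> i. \<epsilon> * of_int (v i))" for v :: "'k \<Rightarrow> int"
    have one: "(\<Sum>v\<in>V. bump \<epsilon> v x) = 1" if "norm x \<le> 3" for x :: "real^'k"
      unfolding V_def
      by (rule sum_bump[OF \<epsilon>]) (use divide_right_mono[OF that, of \<epsilon>] \<epsilon> n in simp)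
    have zero: "(\<Sum>v\<in>V. grad (bump \<epsilon> v) x $ j) = 0" if "norm x \<le> 2" for x :: "real^'k" and j
    proof -
      have "grad (\<lambda>x. \<Sum>v\<in>V. bump \<epsilon> v x) x = grad (\<lambda>x. 1) x"
        by (rule grad_local[where S="ball 0 3"]) (use that one in auto)
      then have "(\<Sum>v\<in>V. grad (bump \<epsilon> v) x) = 0" by (simp add: grad_sum C1_bump)
      then show ?thesis by (simp flip: sum_component)
    qed
    have near: "norm (x - pt v) \<le> C * \<epsilon>" if "bump \<epsilon> v x \<noteq> 0 \<or> grad (bump \<epsilon> v) x $ j \<noteq> 0" for v x j
    proof -
      have "\<bar>(x - pt v) $ i\<bar> \<le> 2 * \<epsilon>" for i
        using bump_support[OF that, of i] \<epsilon> by (simp add: pt_def field_simps)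
      then have "norm (x - pt v) \<le> real CARD('k) * (2 * \<epsilon>)" by (rule norm_le_card_mult)
      also have "\<dots> = (2 * real CARD('k)) * \<epsilon>" by simp
      also have "\<dots> \<le> C * \<epsilon>" using \<epsilon> by (intro mult_right_mono) (auto simp: C_def)
      finally show ?thesis .
    qed
    have le: "(\<Sum>v\<in>V. \<bar>grad (bump \<epsilon> v) x $ j\<bar>) \<le> C / \<epsilon>" for x j
    proof -
      define B where "B i = {\<lceil>x $ i / \<epsilon>\<rceil> - 2, \<lceil>x $ i / \<epsilon>\<rceil> - 1}" for i
      define W where "W = PiE (UNIV :: 'k set) B"
      have finW: "finite W" unfolding W_def by (intro finite_PiE) (auto simp: B_def)
      have "card W = (\<Prod>i\<in>UNIV. card (B i))" unfolding W_def by (rule card_PiE) simp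
      also have "\<dots> \<le> (\<Prod>i\<in>(UNIV::'k set). 2)"
        by (intro prod_mono) (auto simp: B_def card_insert_if)
      finally have cW: "card W \<le> 2 ^ CARD('k)" by simp
      have inW: "v \<in> W" if "grad (bump \<epsilon> v) x $ j \<noteq> 0" for v
      proof -
        have "v i \<in> B i" for i
          using bump_support[of \<epsilon> v x j i] that unfolding B_def by simp linarith
        then show ?thesis by (simp add: W_def PiE_def)
      qed
      have each: "\<bar>grad (bump \<epsilon> v) x $ j\<bar> \<le> 2 / \<epsilon>" for v
      proof -
        have "(\<Prod>i\<in>UNIV - {j}. hat (x $ i / \<epsilon> - of_int (v i))) \<le> 1"
          by (intro prod_le_1) (simp add: hat_range)
        moreover have "0 \<le> (\<Prod>i\<in>UNIV - {j}. hat (x $ i / \<epsilon> - of_int (v i)))"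
          by (intro prod_nonneg) (simp add: hat_range)
        moreover have "\<bar>hat' (x $ j / \<epsilon> - of_int (v j))\<bar> / \<epsilon> \<le> 2 / \<epsilon>"
          using \<epsilon> hat'_le by (intro divide_right_mono) auto
        ultimately have "\<bar>hat' (x $ j / \<epsilon> - of_int (v j))\<bar> / \<epsilon> * (\<Prod>i\<in>UNIV - {j}. hat (x $ i / \<epsilon> - of_int (v i))) \<le> 2 / \<epsilon> * 1"
          using \<epsilon> by (intro mult_mono) auto
        then show ?thesis using \<epsilon> \<open>0 \<le> (\<Prod>i\<in>UNIV - {j}. _ i)\<close>
          by (simp add: grad_bump abs_mult abs_divide)
      qed
      have "(\<Sum>v\<in>V. \<bar>grad (bump \<epsilon> v) x $ j\<bar>) = (\<Sum>v\<in>V \<inter> W. \<bar>grad (bump \<epsilon> v) x $ j\<bar>)"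
        by (rule sum.mono_neutral_right[OF finV]) (use inW in auto)
      also have "\<dots> \<le> (\<Sum>v\<in>W. \<bar>grad (bump \<epsilon> v) x $ j\<bar>)"
        by (rule sum_mono2[OF finW]) auto
      also have "\<dots> \<le> real (card W) * (2 / \<epsilon>)"
        by (rule sum_bounded_above) (rule each)
      also have "\<dots> \<le> 2 ^ CARD('k) * (2 / \<epsilon>)"
        using cW \<epsilon> by (intro mult_right_mono) (simp_all flip: of_nat_le_iff)
      also have "\<dots> = (2 ^ CARD('k) * 2) / \<epsilon>" by simp
      also have "\<dots> \<le> C / \<epsilon>" using \<epsilon> by (intro divide_right_mono) (auto simp: C_def)
      finally show ?thesis .
    qed
    show ?thesis
      by (rule exI[of _ V], rule exI[of _ pt], rule exI[of _ "bump \<epsilon>"])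
        (use finV one zero near le bump_nonneg C1_bump in auto)
  qed
  ultimately show ?thesis by blast
qed

section \<open>Determinants with two distinguished rows\<close>

lemma abs_det_le:
  fixes A :: "real ^ 'k::finite ^ 'k"
  assumes "\<And>i j. \<bar>A $ i $ j\<bar> \<le> b i"
  shows "\<bar>det A\<bar> \<le> fact CARD('k) * (\<Prod>i\<in>UNIV. b i)"
proof -
  have "\<bar>det A\<bar> \<le> (\<Sum>p\<in>{p. p permutes (UNIV::'k set)}. \<bar>of_int (sign p) * (\<Prod>i\<in>UNIV. A $ i $ p i)\<bar>)"
    unfolding det_def by (rule sum_abs)
  also have "\<dots> \<le> (\<Sum>p\<in>{p. p permutes (UNIV::'k set)}. (\<Prod>i\<in>UNIV. b i))"
  proof (rule sum_mono)
    fix p :: "'k \<Rightarrow> 'k"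
    have "\<bar>of_int (sign p) * (\<Prod>i\<in>UNIV. A $ i $ p i)\<bar> = (\<Prod>i\<in>UNIV. \<bar>A $ i $ p i\<bar>)"
      by (simp add: abs_mult abs_prod sign_def)
    also have "\<dots> \<le> (\<Prod>i\<in>UNIV. b i)" by (rule prod_mono) (simp add: assms)
    finally show "\<bar>of_int (sign p) * (\<Prod>i\<in>UNIV. A $ i $ p i)\<bar> \<le> (\<Prod>i\<in>UNIV. b i)" .
  qed
  also have "\<dots> = fact CARD('k) * (\<Prod>i\<in>UNIV. b i)"
    by (simp add: card_permutations[OF refl])
  finally show ?thesis .
qed

lemma det_sum_rows:
  fixes a :: "'k::finite \<Rightarrow> 'l::finite \<Rightarrow> 'a::comm_ring_1 ^ 'k"
  shows "det (\<chi> i. \<Sum>l\<in>UNIV. a i l) = (\<Sum>f\<in>UNIV. det (\<chi> i. a i (f i)))"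
proof -
  have "det (\<chi> i. \<Sum>l\<in>UNIV. a i l) =
    (\<Sum>p\<in>{p. p permutes (UNIV::'k set)}. of_int (sign p) * (\<Prod>i\<in>UNIV. \<Sum>l\<in>UNIV. a i l $ p i))"
    by (simp add: det_def)
  also have "\<dots> = (\<Sum>p\<in>{p. p permutes (UNIV::'k set)}. \<Sum>f\<in>UNIV. of_int (sign p) * (\<Prod>i\<in>UNIV. a i (f i) $ p i))"
    by (subst prod_sum_PiE) (simp_all add: sum_distrib_left PiE_UNIV_domain)
  also have "\<dots> = (\<Sum>f\<in>UNIV. det (\<chi> i. a i (f i)))"
    by (subst sum.swap) (simp add: det_def)
  finally show ?thesis .
qed

definition det2 :: "'k \<Rightarrow> 'k \<Rightarrow> ('k \<Rightarrow> real ^ 'k) \<Rightarrow> real ^ 'k \<Rightarrow> real ^ 'k \<Rightarrow> real"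
  where "det2 p q w v u = det (\<chi> i::'k::finite. if i = p then v else if i = q then u else w i)"

lemma linear_det2_left: "linear (\<lambda>v. det2 p q w v u)"
proof (rule linearI)
  show "det2 p q w (v + v') u = det2 p q w v u + det2 p q w v' u" for v v'
    unfolding det2_def by (rule det_row_add)
  show "det2 p q w (c *\<^sub>R v) u = c *\<^sub>R det2 p q w v u" for c v
    unfolding det2_def using det_row_mul[of p c "\<lambda>i. v" "\<lambda>i. if i = q then u else w i"]
    by (simp add: scalar_mult_eq_scaleR cong: if_cong)
qed

lemma det2_swap:
  assumes "p \<noteq> q" shows "det2 p q w u v = - det2 p q w v u"
proof -
  let ?A = "\<chi> i. if i = p then v else if i = q then u else w i"
  let ?t = "Transposition.transpose p q"
  have "det (\<chi> i. ?A $ ?t i) = of_int (sign ?t) * det ?A"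
    by (rule det_permute_rows) (simp add: permutes_swap_id)
  moreover have "(\<chi> i. ?A $ ?t i) = (\<chi> i. if i = p then u else if i = q then v else w i)"
    using assms by (auto simp: vec_eq_iff Transposition.transpose_def)
  ultimately show ?thesis using assms by (simp add: det2_def sign_swap_id)
qed

lemma linear_det2_right:
  assumes "p \<noteq> q" shows "linear (\<lambda>u. det2 p q w v u)"
proof -
  have "linear (\<lambda>u. - det2 p q w u v)" by (intro linear_compose_neg linear_det2_left)
  then show ?thesis using det2_swap[OF assms, of w v] by simp
qed

lemma abs_det2_le:
  fixes w :: "'k::finite \<Rightarrow> real ^ 'k"
  assumes "p \<noteq> q" "\<And>j. \<bar>v $ j\<bar> \<le> a" "\<And>j. \<bar>u $ j\<bar> \<le> b" "\<And>i j. \<bar>w i $ j\<bar> \<le> c"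
  shows "\<bar>det2 p q w v u\<bar> \<le> fact CARD('k) * (a * b * c ^ (CARD('k) - 2))"
proof -
  let ?b = "\<lambda>i. if i = p then a else if i = q then b else c"
  have "\<bar>det2 p q w v u\<bar> \<le> fact CARD('k) * (\<Prod>i\<in>UNIV. ?b i)"
    unfolding det2_def by (rule abs_det_le) (use assms in auto)
  also have "(\<Prod>i\<in>UNIV. ?b i) = a * (b * (\<Prod>i\<in>UNIV - {p} - {q}. ?b i))"
    using assms(1) by (subst prod.remove[of _ p], simp, simp, subst prod.remove[of _ q]) auto
  also have "(\<Prod>i\<in>UNIV - {p} - {q}. ?b i) = (\<Prod>i\<in>UNIV - {p} - {q}. c)"
    by (rule prod.cong) auto
  also have "\<dots> = c ^ (CARD('k) - 2)"
    using assms(1) by (simp add: card_Diff_singleton numeral_2_eq_2)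
  finally show ?thesis by (simp add: mult.assoc)
qed

section \<open>Stokes' theorem for the contact form\<close>

definition crd :: "'n::finite \<times> bool \<Rightarrow> 'n heis \<Rightarrow> real"
  where "crd l p = (if snd l then fst p else fst (snd p)) $ fst l"

definition tcrd :: "'n::finite heis \<Rightarrow> real" where "tcrd p = snd (snd p)"

definition horizontal_basis :: "'n \<times> bool \<Rightarrow> 'n::finite heis"
  where "horizontal_basis l = (if snd l then (axis (fst l) 1, 0, 0) else (0, axis (fst l) 1, 0))"

lemma bounded_linear_crd: "bounded_linear (crd l)"
proof -
  have "bounded_linear (\<lambda>p :: 'a heis. fst p $ fst l)" "bounded_linear (\<lambda>p :: 'a heis. fst (snd p) $ fst l)"
    by (intro bounded_linear_compose[OF bounded_linear_vec_nth] bounded_linear_fst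
        bounded_linear_compose[OF bounded_linear_fst] bounded_linear_snd)+
  then show ?thesis unfolding crd_def[abs_def] by (cases "snd l") simp_all
qed

lemma bounded_linear_tcrd: "bounded_linear tcrd"
  unfolding tcrd_def[abs_def] by (intro bounded_linear_compose[OF bounded_linear_snd] bounded_linear_snd)

lemmas C1_crd = C1_bounded_linear[OF bounded_linear_crd]
lemmas C1_tcrd = C1_bounded_linear[OF bounded_linear_tcrd]

lemma abs_crd_le: "\<bar>crd l p\<bar> \<le> norm p"
proof -
  have "\<bar>crd l p\<bar> \<le> norm (if snd l then fst p else fst (snd p))"
    unfolding crd_def by (rule component_le_norm_cart)
  also have "\<dots> \<le> norm p"
    using norm_fst_le[of "fst p" "snd p"] norm_snd_le[of "snd p" "fst p"]
      norm_fst_le[of "fst (snd p)" "snd (snd p)"] by auto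
  finally show ?thesis .
qed

lemma heis_expand: "p = (\<Sum>l\<in>UNIV. crd l p *\<^sub>R horizontal_basis l) + tcrd p *\<^sub>R (0, 0, 1)"
proof -
  have "(\<Sum>l\<in>UNIV. crd l p *\<^sub>R horizontal_basis l) = (\<Sum>j\<in>UNIV. \<Sum>b\<in>UNIV. crd (j, b) p *\<^sub>R horizontal_basis (j, b))"
    by (simp add: sum.cartesian_product flip: UNIV_Times_UNIV)
  also have "\<dots> = (\<Sum>j\<in>UNIV. (fst p $ j *\<^sub>R axis j 1, fst (snd p) $ j *\<^sub>R axis j 1, 0))"
    by (simp add: UNIV_bool crd_def horizontal_basis_def)
  also have "\<dots> = (\<Sum>j\<in>UNIV. fst p $ j *\<^sub>R axis j 1, \<Sum>j\<in>UNIV. fst (snd p) $ j *\<^sub>R axis j 1, 0)"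
    by (simp add: sum_prod)
  also have "\<dots> = (fst p, fst (snd p), 0)"
    by (simp add: vec_eq_iff axis_def if_distrib cong: if_cong)
  finally show ?thesis by (simp add: tcrd_def)
qed

lemma grad_compose_linear:
  fixes F :: "real ^ 'k::finite \<Rightarrow> 'b::euclidean_space"
  assumes "bounded_linear g" "C1 F"
  shows "grad (\<lambda>x. g (F x)) x $ j = g (D F x (axis j 1))"
proof -
  have "D g p = g" for p
    by (rule C1_D_eq[OF C1_bounded_linear[OF assms(1)] bounded_linear_imp_has_derivative[OF assms(1)]])
  then show ?thesis by (simp add: grad_nth D_compose[OF C1_bounded_linear[OF assms(1)] assms(2)])
qed

text \<open>
  The pullback by \<open>F\<close> of the contact form \<open>dt + 2 \<Sum>\<^sub>j (x\<^sub>j dy\<^sub>j - y\<^sub>j dx\<^sub>j)\<close>, as a row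
  vector.
\<close>

definition contact :: "(real ^ 'k::finite \<Rightarrow> 'n::finite heis) \<Rightarrow> real ^ 'k \<Rightarrow> real ^ 'k"
  where "contact F x = grad (\<lambda>x. tcrd (F x)) x + 2 *\<^sub>R (\<Sum>j\<in>UNIV.
    crd (j, True) (F x) *\<^sub>R grad (\<lambda>x. crd (j, False) (F x)) x -
    crd (j, False) (F x) *\<^sub>R grad (\<lambda>x. crd (j, True) (F x)) x)"

text \<open>
  With \<open>\<alpha>\<close> the pulled back contact form and \<open>w\<close> the product of the remaining differentials, this is
  \<open>\<integral> a d\<alpha> \<and> w = - \<integral> da \<and> \<alpha> \<and> w\<close>, where \<open>d\<alpha> = 4 \<Sum>\<^sub>j dx\<^sub>j \<and> dy\<^sub>j\<close>. It follows from
  \<open>integral_det_eq_0\<close> applied to \<open>d(a x\<^sub>j) \<and> dy\<^sub>j \<and> w\<close>, to \<open>d(a y\<^sub>j) \<and> dx\<^sub>j \<and> w\<close> and to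
  \<open>da \<and> dt \<and> w\<close>, so that second derivatives do not occur.
\<close>

lemma stokes_contact:
  fixes F :: "real^'k::{finite,wellorder} \<Rightarrow> 'n::finite heis" and a :: "real^'k::_ \<Rightarrow> real"
    and w :: "'k \<Rightarrow> real^'k::_ \<Rightarrow> real"
  assumes F: "C1 F" and a: "C1 a" and w: "\<And>i. C1 (w i)" and pq: "p \<noteq> q"
    and r: "0 \<le> r" "r < 1" "1 < R" and zero: "\<And>x. r < norm x \<Longrightarrow> norm x < R \<Longrightarrow> a x = 0"
  shows "4 * integral (cball 0 1) (\<lambda>x. a x * (\<Sum>j\<in>UNIV. det2 p q (\<lambda>i. grad (w i) x)
        (grad (\<lambda>x. crd (j, True) (F x)) x) (grad (\<lambda>x. crd (j, False) (F x)) x)))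
    = - integral (cball 0 1) (\<lambda>x. det2 p q (\<lambda>i. grad (w i) x) (grad a x) (contact F x))"
proof -
  let ?B = "cball (0::real^'k::_) 1"
  define X where "X j x = crd (j, True) (F x)" for j x
  define Y where "Y j x = crd (j, False) (F x)" for j x
  define T where "T x = tcrd (F x)" for x
  have C1s: "C1 (X j)" "C1 (Y j)" "C1 T" for j
    unfolding X_def Y_def T_def by (intro C1_compose[OF C1_crd F] C1_compose[OF C1_tcrd F])+
  define d where "d x v u = det2 p q (\<lambda>i. grad (w i) x) v u" for x v u
  have dc: "continuous_on UNIV (\<lambda>x. d x (grad f x) (grad g x))" if "C1 f" "C1 g" for f g
    unfolding d_def det2_def
  proof (intro continuous_on_det continuous_on_vec_lambda)
    show "continuous_on UNIV (\<lambda>x. if i = p then grad f x else if i = q then grad g x else grad (w i) x)" for i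
      by (cases "i = p"; cases "i = q") (simp_all add: grad_continuous that w)
  qed
  have int: "f integrable_on ?B" if "continuous_on UNIV f" for f :: "_ \<Rightarrow> real"
    by (intro integrable_compact continuous_on_subset[OF that]) auto
  have st: "integral ?B (\<lambda>x. d x (grad f x) (grad g x)) = 0"
    if "C1 f" "C1 g" "\<And>x. r < norm x \<Longrightarrow> norm x < R \<Longrightarrow> f x = 0" for f g
  proof -
    have "integral ?B (\<lambda>x. det (\<chi> i. grad (if i = p then f else if i = q then g else w i) x)) = 0"
      by (rule integral_det_eq_0[where p=p, OF _ r]) (use that w in auto)
    moreover have "(\<chi> i. grad (if i = p then f else if i = q then g else w i) x) =
      (\<chi> i. if i = p then grad f x else if i = q then grad g x else grad (w i) x)" for x
      by (simp add: vec_eq_iff)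
    ultimately show ?thesis by (simp add: d_def det2_def)
  qed
  have lin1: "linear (\<lambda>v. d x v u)" for x u unfolding d_def by (rule linear_det2_left)
  have lin2: "linear (\<lambda>u. d x v u)" for x v unfolding d_def by (rule linear_det2_right[OF pq])
  have swap: "d x v u = - d x u v" for x u v unfolding d_def by (rule det2_swap[OF pq])
  have contact: "contact F x = grad T x + 2 *\<^sub>R (\<Sum>j\<in>UNIV. X j x *\<^sub>R grad (Y j) x - Y j x *\<^sub>R grad (X j) x)" for x
    by (simp add: contact_def X_def[abs_def] Y_def[abs_def] T_def[abs_def])
  define E where "E x = (\<Sum>j\<in>UNIV. d x (grad (\<lambda>x. a x * X j x) x) (grad (Y j) x) -
      d x (grad (\<lambda>x. a x * Y j x) x) (grad (X j) x))" for x
  have E: "E x = 2 * (a x * (\<Sum>j\<in>UNIV. d x (grad (X j) x) (grad (Y j) x))) +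
      d x (grad a x) (\<Sum>j\<in>UNIV. X j x *\<^sub>R grad (Y j) x - Y j x *\<^sub>R grad (X j) x)" for x
  proof -
    have "d x (grad (\<lambda>x. a x * X j x) x) (grad (Y j) x) - d x (grad (\<lambda>x. a x * Y j x) x) (grad (X j) x) =
      2 * (a x * d x (grad (X j) x) (grad (Y j) x)) + d x (grad a x) (X j x *\<^sub>R grad (Y j) x - Y j x *\<^sub>R grad (X j) x)" for j
      unfolding grad_mult[OF a C1s(1)] grad_mult[OF a C1s(2)]
      using swap[of x "grad (Y j) x" "grad (X j) x"]
      by (simp add: linear_add[OF lin1] linear_cmul[OF lin1] linear_diff[OF lin2] linear_cmul[OF lin2])
    then show ?thesis
      unfolding E_def by (simp add: sum.distrib linear_sum[OF lin2] sum_distrib_left)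
  qed
  have total: "4 * (a x * (\<Sum>j\<in>UNIV. d x (grad (X j) x) (grad (Y j) x))) =
      2 * E x + d x (grad a x) (grad T x) - d x (grad a x) (contact F x)" for x
    unfolding contact by (simp add: E linear_add[OF lin2] linear_cmul[OF lin2])
  have E0: "integral ?B E = 0"
  proof -
    define G where "G j x = d x (grad (\<lambda>x. a x * X j x) x) (grad (Y j) x) -
      d x (grad (\<lambda>x. a x * Y j x) x) (grad (X j) x)" for j x
    have "integral ?B (G j) = 0" for j
    proof -
      have "integral ?B (G j) = integral ?B (\<lambda>x. d x (grad (\<lambda>x. a x * X j x) x) (grad (Y j) x)) -
        integral ?B (\<lambda>x. d x (grad (\<lambda>x. a x * Y j x) x) (grad (X j) x))"
        unfolding G_def[abs_def] by (intro integral_diff int dc C1s C1_mult a)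
      then show ?thesis by (simp add: st C1s C1_mult a zero)
    qed
    moreover have "integral ?B (\<lambda>x. \<Sum>j\<in>UNIV. G j x) = (\<Sum>j\<in>UNIV. integral ?B (G j))"
      by (intro integral_sum int) (auto simp: G_def[abs_def] intro!: continuous_on_diff dc C1s C1_mult a)
    moreover have "E = (\<lambda>x. \<Sum>j\<in>UNIV. G j x)" by (simp add: E_def[abs_def] G_def)
    ultimately show ?thesis by simp
  qed
  have Ec: "continuous_on UNIV E" unfolding E_def[abs_def]
    by (intro continuous_intros dc C1s C1_mult a)
  have T0: "integral ?B (\<lambda>x. d x (grad a x) (grad T x)) = 0"
    by (rule st) (use a C1s zero in auto)
  have contc: "continuous_on UNIV (contact F)" unfolding contact
    by (intro continuous_intros grad_continuous C1s C1_continuous_on)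
  have cc: "continuous_on UNIV (\<lambda>x. d x (grad a x) (contact F x))"
    unfolding d_def det2_def
  proof (intro continuous_on_det continuous_on_vec_lambda)
    show "continuous_on UNIV (\<lambda>x. if i = p then grad a x else if i = q then contact F x else grad (w i) x)" for i
      by (cases "i = p"; cases "i = q") (simp_all add: grad_continuous a contc w)
  qed
  have "4 * integral ?B (\<lambda>x. a x * (\<Sum>j\<in>UNIV. d x (grad (X j) x) (grad (Y j) x))) =
      integral ?B (\<lambda>x. 4 * (a x * (\<Sum>j\<in>UNIV. d x (grad (X j) x) (grad (Y j) x))))"
    by simp
  also have "\<dots> = integral ?B (\<lambda>x. 2 * E x + d x (grad a x) (grad T x) - d x (grad a x) (contact F x))"
    by (simp only: total)
  also have "\<dots> = 2 * integral ?B E + integral ?B (\<lambda>x. d x (grad a x) (grad T x)) - integral ?B (\<lambda>x. d x (grad a x) (contact F x))"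
    by (subst integral_diff integral_add; (intro int continuous_intros dc C1s a Ec cc)?)+ simp
  finally show ?thesis using E0 T0 by (simp add: d_def X_def[abs_def] Y_def[abs_def])
qed

section \<open>Vanishing of the pulled back integral\<close>

lemma real_polynomial_function_D:
  assumes "real_polynomial_function g" shows "real_polynomial_function (\<lambda>p. D g p v)"
  using assms
proof induction
  case (linear f)
  have "D f p = f" for p
    by (rule C1_D_eq[OF C1_bounded_linear[OF linear] bounded_linear_imp_has_derivative[OF linear]])
  then show ?case by (simp add: real_polynomial_function_eq)
next
  case (const c)
  then show ?case by (simp add: frechet_derivative_const real_polynomial_function_eq)
next
  case (add f g)
  have C: "C1 f" "C1 g" using add.hyps C1_real_polynomial_function by blast+
  have "D (\<lambda>x. f x + g x) p = (\<lambda>v. D f p v + D g p v)" for p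
    by (rule C1_D_eq[OF C1_add[OF C]]) (intro has_derivative_add C1_has_derivative C)
  then show ?case using add.IH by auto
next
  case (mult f g)
  have C: "C1 f" "C1 g" using mult.hyps C1_real_polynomial_function by blast+
  have "D (\<lambda>x. f x * g x) p = (\<lambda>v. f p * D g p v + D f p v * g p)" for p
    by (rule C1_D_eq[OF C1_mult[OF C]]) (intro has_derivative_mult C1_has_derivative C)
  then show ?case using mult.IH mult.hyps by auto
qed

text \<open>
  The sequence of approximations, reduced to what the vanishing argument uses: bounds for the
  derivative and for the pulled back contact form under which a product of one contact form and
  \<open>n\<close> differentials is negligible.
\<close>

locale contact_sequence =
  fixes F :: "nat \<Rightarrow> real^'k::{finite,wellorder} \<Rightarrow> 'n::finite heis"
    and d e :: "nat \<Rightarrow> real" and M r R :: real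
  assumes dim: "CARD('k) = CARD('n) + 1"
    and C1F: "\<And>i. C1 (F i)"
    and bound: "\<And>i x. x \<in> cball 0 1 \<Longrightarrow> norm (F i x) \<le> M"
    and d: "\<And>i x j. x \<in> cball 0 1 \<Longrightarrow> norm (D (F i) x (axis j 1)) \<le> d i"
    and e: "\<And>i x j. x \<in> cball 0 1 \<Longrightarrow> \<bar>contact (F i) x $ j\<bar> \<le> e i"
    and lim: "(\<lambda>i. e i * d i ^ CARD('n)) \<longlonglongrightarrow> 0"
    and r: "0 \<le> r" "r < 1" "1 < R"
begin

abbreviation B where "B \<equiv> cball (0 :: real^'k::_) 1"

definition row where "row i l x = grad (\<lambda>x. crd l (F i x)) x"

lemma C1_crdF: "C1 (\<lambda>x. crd l (F i x))"
  by (rule C1_compose[OF C1_crd C1F])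

lemma row_le: "x \<in> B \<Longrightarrow> \<bar>row i l x $ j\<bar> \<le> d i"
  unfolding row_def grad_compose_linear[OF bounded_linear_crd C1F]
  using order_trans[OF abs_crd_le d] by blast

lemma integrable_B: "continuous_on UNIV f \<Longrightarrow> f integrable_on B" for f :: "real^'k::_ \<Rightarrow> real"
  by (rule integrable_compact[OF compact_cball]) (rule continuous_on_subset[OF _ subset_UNIV])

lemma continuous_weighted:
  fixes c :: "'n heis \<Rightarrow> real"
  assumes "C1 c" "continuous_on UNIV g" shows "continuous_on UNIV (\<lambda>x. c (F i x) * g x)"
  by (rule continuous_on_mult[OF C1_continuous_on[OF C1_compose[OF assms(1) C1F]] assms(2)])

lemma continuous_det_rows:
  fixes w :: "'k \<Rightarrow> real^'k::_ \<Rightarrow> real^'k::_"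
  assumes "\<And>k. continuous_on UNIV (w k)" shows "continuous_on UNIV (\<lambda>x. det (\<chi> k. w k x))"
  by (intro continuous_on_det continuous_on_vec_lambda assms)

lemma integral_det2_le:
  fixes p q :: 'k and v u :: "real^'k::_ \<Rightarrow> real^'k::_" and w :: "'k \<Rightarrow> real^'k::_ \<Rightarrow> real^'k::_"
  assumes "p \<noteq> q" "\<And>x j. x \<in> B \<Longrightarrow> \<bar>v x $ j\<bar> \<le> a" "\<And>x j. x \<in> B \<Longrightarrow> \<bar>u x $ j\<bar> \<le> b"
    "\<And>x i j. x \<in> B \<Longrightarrow> \<bar>w i x $ j\<bar> \<le> c"
    "continuous_on UNIV (\<lambda>x. det2 p q (\<lambda>i. w i x) (v x) (u x))"
  shows "\<bar>integral B (\<lambda>x. det2 p q (\<lambda>i. w i x) (v x) (u x))\<bar>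
    \<le> integral B (\<lambda>x. 1) * (fact CARD('k) * (a * b * c ^ (CARD('k) - 2)))"
proof -
  have "norm (integral B (\<lambda>x. det2 p q (\<lambda>i. w i x) (v x) (u x)))
     \<le> integral B (\<lambda>x. 1 * (fact CARD('k) * (a * b * c ^ (CARD('k) - 2))))"
  proof (rule integral_norm_bound_integral)
    show "(\<lambda>x. det2 p q (\<lambda>i. w i x) (v x) (u x)) integrable_on B"
      by (rule integrable_B[OF assms(5)])
    show "(\<lambda>x. 1 * (fact CARD('k) * (a * b * c ^ (CARD('k) - 2)))) integrable_on B"
      by (intro integrable_B continuous_on_const)
    show "norm (det2 p q (\<lambda>i. w i x) (v x) (u x)) \<le> 1 * (fact CARD('k) * (a * b * c ^ (CARD('k) - 2)))"
      if "x \<in> B" for x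
      using abs_det2_le[OF assms(1), of "v x" a "u x" b "\<lambda>i. w i x" c] assms(2-4) that by simp
  qed
  then show ?thesis by (simp only: real_norm_def integral_mult_left)
qed

lemma continuous_det2:
  fixes p q :: 'k and v u :: "real^'k::_ \<Rightarrow> real^'k::_" and w :: "'k \<Rightarrow> real^'k::_ \<Rightarrow> real^'k::_"
  assumes "continuous_on UNIV v" "continuous_on UNIV u" "\<And>i. continuous_on UNIV (w i)"
  shows "continuous_on UNIV (\<lambda>x. det2 p q (\<lambda>i. w i x) (v x) (u x) :: real)"
  unfolding det2_def
proof (intro continuous_on_det continuous_on_vec_lambda)
  show "continuous_on UNIV (\<lambda>x. if i = p then v x else if i = q then u x else w i x)" for i
    by (cases "i = p"; cases "i = q") (simp_all add: assms)
qed

lemma continuous_row: "continuous_on UNIV (row i l)"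
  unfolding row_def[abs_def] by (intro grad_continuous C1_crdF)

lemma continuous_contact: "continuous_on UNIV (contact (F i))"
  unfolding contact_def[abs_def]
  by (intro continuous_intros grad_continuous C1_crdF C1_continuous_on C1_compose[OF C1_tcrd C1F])

lemma compact_image_bound:
  assumes "continuous_on UNIV (c :: 'n heis \<Rightarrow> real)"
  obtains C where "C \<ge> 0" "\<And>i x. x \<in> B \<Longrightarrow> \<bar>c (F i x)\<bar> \<le> C"
proof -
  have "bounded (c ` cball 0 M)"
    by (intro compact_imp_bounded compact_continuous_image continuous_on_subset[OF assms]) auto
  then obtain C where "C > 0" "\<And>p. p \<in> cball 0 M \<Longrightarrow> \<bar>c p\<bar> \<le> C" unfolding bounded_pos by auto
  then show ?thesis using that[of C] bound by (simp add: less_imp_le)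
qed

text \<open>
  The weight \<open>c \<circ> F\<close> vanishes on a collar of the sphere, so \<open>stokes_contact\<close> applies and turns
  multiples of \<open>d\<alpha>\<close> into products that contain the contact form, which are negligible. By
  \<open>alternating_limit_zero\<close> every product of \<open>n + 1\<close> horizontal differentials is then negligible.
\<close>

lemma horizontal_limit:
  fixes c :: "'n heis \<Rightarrow> real" and I :: "'k \<Rightarrow> 'n \<times> bool"
  assumes c: "C1 c" and zero: "\<And>i x. r < norm x \<Longrightarrow> norm x < R \<Longrightarrow> c (F i x) = 0"
  shows "(\<lambda>i. integral B (\<lambda>x. c (F i x) * det (\<chi> k. row i (I k) x))) \<longlonglongrightarrow> 0"
proof (rule alternating_limit_zero[where \<Phi> = "\<lambda>i I. integral B (\<lambda>x. c (F i x) * det (\<chi> k. row i (I k) x))"])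
  show "CARD('n) < CARD('k)" using dim by simp
next
  fix i and I :: "'k \<Rightarrow> 'n \<times> bool" and p q :: 'k
  assume pq: "p \<noteq> q"
  have "det (\<chi> k. row i ((I \<circ> Transposition.transpose p q) k) x) = - det (\<chi> k. row i (I k) x)" for x
    using det_permute_rows[of "Transposition.transpose p q" "\<chi> k. row i (I k) x"] pq
    by (simp add: permutes_swap_id sign_swap_id)
  then show "integral B (\<lambda>x. c (F i x) * det (\<chi> k. row i ((I \<circ> Transposition.transpose p q) k) x)) =
    - integral B (\<lambda>x. c (F i x) * det (\<chi> k. row i (I k) x))" by simp
next
  fix I :: "'k \<Rightarrow> 'n \<times> bool" and p q :: 'k
  assume pq: "p \<noteq> q"
  obtain C where C: "C \<ge> 0" "\<And>p v. p \<in> cball 0 M \<Longrightarrow> norm (D c p v) \<le> C * norm v"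
    using C1_D_bounded_on_compact[OF c compact_cball[of 0 M]] by blast
  define a where "a i x = c (F i x)" for i x
  have C1a: "C1 (a i)" for i unfolding a_def by (rule C1_compose[OF c C1F])
  have ga: "\<bar>grad (a i) x $ j\<bar> \<le> C * d i" if "x \<in> B" for i x j
  proof -
    have "\<bar>grad (a i) x $ j\<bar> = norm (D c (F i x) (D (F i) x (axis j 1)))"
      unfolding a_def by (simp add: grad_nth D_compose[OF c C1F])
    also have "\<dots> \<le> C * norm (D (F i) x (axis j 1))" using C(2) bound[OF that] by simp
    also have "\<dots> \<le> C * d i" by (intro mult_left_mono d that C)
    finally show ?thesis .
  qed
  define K where "K = integral B (\<lambda>x. 1) * (fact CARD('k) * C)"
  define S where "S i = (\<Sum>j\<in>UNIV. integral B (\<lambda>x. c (F i x) * det (\<chi> k. row i ((I(p := (j, True), q := (j, False))) k) x)))" for i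
  have "4 * S i = - integral B (\<lambda>x. det2 p q (\<lambda>k. row i (I k) x) (grad (a i) x) (contact (F i) x))" for i
  proof -
    have dt: "det (\<chi> k. row i ((I(p := (j, True), q := (j, False))) k) x) =
      det2 p q (\<lambda>k. row i (I k) x) (row i (j, True) x) (row i (j, False) x)" for j x
      unfolding det2_def using pq by (intro arg_cong[where f=det]) (simp add: vec_eq_iff)
    have "S i = integral B (\<lambda>x. \<Sum>j\<in>UNIV. a i x * det2 p q (\<lambda>k. row i (I k) x) (row i (j, True) x) (row i (j, False) x))"
      unfolding S_def dt a_def
      by (rule integral_sum[symmetric])
         (auto intro!: integrable_B continuous_weighted c continuous_det2 continuous_row)
    also have "\<dots> = integral B (\<lambda>x. a i x * (\<Sum>j\<in>UNIV. det2 p q (\<lambda>k. row i (I k) x) (row i (j, True) x) (row i (j, False) x)))"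
      by (simp add: sum_distrib_left)
    finally show ?thesis
      using stokes_contact[OF C1F[of i] C1a[of i] C1_crdF[where i=i and l="I _"] pq r] zero
      unfolding row_def a_def by simp
  qed
  note S4 = this
  have S: "4 * \<bar>S i\<bar> = \<bar>integral B (\<lambda>x. det2 p q (\<lambda>k. row i (I k) x) (grad (a i) x) (contact (F i) x))\<bar>" for i
  proof -
    have "4 * \<bar>S i\<bar> = \<bar>4 * S i\<bar>" by simp
    then show ?thesis unfolding S4 abs_minus_cancel .
  qed
  have "norm (S i) \<le> K * (e i * d i ^ CARD('n))" for i
  proof -
    have "4 * \<bar>S i\<bar> \<le> integral B (\<lambda>x. 1) * (fact CARD('k) * ((C * d i) * e i * d i ^ (CARD('k) - 2)))"
      unfolding S
      by (rule integral_det2_le[OF pq]) (auto intro!: ga e row_le continuous_det2[OF grad_continuous[OF C1a] continuous_contact continuous_row])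
    also have "\<dots> = K * (e i * (d i * d i ^ (CARD('n) - 1)))" unfolding dim K_def by (simp add: mult_ac)
    also have "d i * d i ^ (CARD('n) - 1) = d i ^ CARD('n)" by (simp add: power_eq_if)
    finally show ?thesis by (simp only: real_norm_def)
  qed
  then have "\<forall>i. norm (S i) \<le> K * (e i * d i ^ CARD('n))" ..
  from Lim_null_comparison[OF always_eventually[OF this] tendsto_mult_right_zero[OF lim]] have "S \<longlonglongrightarrow> 0" .
  then show "(\<lambda>i. \<Sum>j\<in>UNIV. integral B (\<lambda>x. c (F i x) * det (\<chi> k. row i ((I(p := (j, True), q := (j, False))) k) x))) \<longlonglongrightarrow> 0"
    unfolding S_def[abs_def] .
qed

text \<open>
  The coframe consisting of the contact form, with index \<open>None\<close>, and of the horizontal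
  differentials.
\<close>

definition row_opt where "row_opt i l x = (case l of None \<Rightarrow> contact (F i) x | Some l \<Rightarrow> row i l x)"

text \<open>
  A product that contains the contact form twice is zero; one that contains it once is
  estimated directly.
\<close>

lemma mixed_limit:
  fixes c :: "'n heis \<Rightarrow> real" and L :: "'k \<Rightarrow> ('n \<times> bool) option"
  assumes c: "C1 c" and zero: "\<And>i x. r < norm x \<Longrightarrow> norm x < R \<Longrightarrow> c (F i x) = 0"
  shows "(\<lambda>i. integral B (\<lambda>x. c (F i x) * det (\<chi> k. row_opt i (L k) x))) \<longlonglongrightarrow> 0"
proof (cases "None \<in> range L")
  case False
  then have "L k = Some (the (L k))" for k by (metis option.collapse rangeI)
  then have "row_opt i (L k) x = row i (the (L k)) x" for i k x
    unfolding row_opt_def by (metis option.simps(5))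
  then show ?thesis using horizontal_limit[OF assms, of "\<lambda>k. the (L k)"] by simp
next
  case True
  then obtain p where p: "L p = None" by (metis rangeE)
  show ?thesis
  proof (cases "\<exists>q. q \<noteq> p \<and> L q = None")
    case True
    then obtain q where q: "q \<noteq> p" "L q = None" by blast
    have "det (\<chi> k. row_opt i (L k) x) = 0" for i x
      by (rule det_identical_rows[OF q(1)]) (simp add: Finite_Cartesian_Product.row_def vec_eq_iff p q(2))
    then show ?thesis by simp
  next
    case False
    define I where "I k = the (L k)" for k
    have I: "L k = Some (I k)" if "k \<noteq> p" for k
      using False that unfolding I_def by (metis option.collapse)
    obtain C where C: "C \<ge> 0" "\<And>i x. x \<in> B \<Longrightarrow> \<bar>c (F i x)\<bar> \<le> C"
      using compact_image_bound[OF C1_continuous_on[OF c]] by blast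
    define K where "K = integral B (\<lambda>x. 1) * (C * fact CARD('k))"
    have "norm (integral B (\<lambda>x. c (F i x) * det (\<chi> k. row_opt i (L k) x))) \<le> K * (e i * d i ^ CARD('n))" for i
    proof -
      have cont: "continuous_on UNIV (\<lambda>x. row_opt i l x)" for l
        unfolding row_opt_def by (cases l) (simp_all add: continuous_row continuous_contact)
      have "norm (integral B (\<lambda>x. c (F i x) * det (\<chi> k. row_opt i (L k) x))) \<le>
        integral B (\<lambda>x. 1 * (C * (fact CARD('k) * (e i * d i ^ CARD('n)))))"
      proof (rule integral_norm_bound_integral)
        show "(\<lambda>x. c (F i x) * det (\<chi> k. row_opt i (L k) x)) integrable_on B"
          by (intro integrable_B continuous_weighted c continuous_det_rows cont)
        show "(\<lambda>x. 1 * (C * (fact CARD('k) * (e i * d i ^ CARD('n))))) integrable_on B"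
          by (intro integrable_B continuous_on_const)
        fix x assume x: "x \<in> B"
        have "\<bar>det (\<chi> k. row_opt i (L k) x)\<bar> \<le> fact CARD('k) * (\<Prod>k\<in>UNIV. if k = p then e i else d i)"
          by (rule abs_det_le) (use x in \<open>auto simp: row_opt_def p I e row_le\<close>)
        also have "(\<Prod>k\<in>UNIV. if k = p then e i else d i) = e i * d i ^ CARD('n)"
          by (subst prod.remove[of _ p]) (simp_all add: dim card_Diff_singleton)
        finally have "\<bar>c (F i x)\<bar> * \<bar>det (\<chi> k. row_opt i (L k) x)\<bar> \<le> C * (fact CARD('k) * (e i * d i ^ CARD('n)))"
          by (intro mult_mono C x) auto
        then show "norm (c (F i x) * det (\<chi> k. row_opt i (L k) x)) \<le> 1 * (C * (fact CARD('k) * (e i * d i ^ CARD('n))))"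
          by (simp only: real_norm_def abs_mult mult_1_left)
      qed
      also have "\<dots> = K * (e i * d i ^ CARD('n))"
        unfolding integral_mult_left K_def by (simp only: mult.assoc)
      finally show ?thesis .
    qed
    then have "\<forall>i. norm (integral B (\<lambda>x. c (F i x) * det (\<chi> k. row_opt i (L k) x))) \<le> K * (e i * d i ^ CARD('n))" ..
    from Lim_null_comparison[OF always_eventually[OF this] tendsto_mult_right_zero[OF lim]] show ?thesis .
  qed
qed

text \<open>
  The differentials of the polynomials are expanded in the coframe of \<open>row_opt\<close>. The coefficients are
  again polynomials, and \<open>dt\<close> is eliminated in favour of the contact form.
\<close>

lemma polynomial_pullback_limit:
  fixes G :: "'k \<Rightarrow> 'n heis \<Rightarrow> real" and \<psi> :: "'n heis \<Rightarrow> real"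
  assumes G: "\<And>k. real_polynomial_function (G k)" and \<psi>: "C1 \<psi>"
    and zero: "\<And>i x. r < norm x \<Longrightarrow> norm x < R \<Longrightarrow> \<psi> (F i x) = 0"
  shows "(\<lambda>i. integral B (\<lambda>x. \<psi> (F i x) * det (\<chi> k. grad (\<lambda>x. G k (F i x)) x))) \<longlonglongrightarrow> 0"
proof -
  define co :: "'k \<Rightarrow> ('n \<times> bool) option \<Rightarrow> 'n heis \<Rightarrow> real" where
    "co k l p = (case l of None \<Rightarrow> D (G k) p (0, 0, 1)
      | Some (j, b) \<Rightarrow> D (G k) p (horizontal_basis (j, b)) +
          (if b then 2 * crd (j, False) p else - 2 * crd (j, True) p) * D (G k) p (0, 0, 1))" for k l p
  have C1G: "C1 (G k)" for k by (rule C1_real_polynomial_function[OF G])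
  have C1co: "C1 (co k l)" for k l
  proof -
    have *: "C1 (\<lambda>p. D (G k) p v)" for v
      by (intro C1_real_polynomial_function real_polynomial_function_D G)
    show ?thesis
    proof (cases l)
      case (Some jb)
      then show ?thesis unfolding co_def
        by (cases jb; cases "snd jb") (auto intro!: C1_add C1_mult C1_const C1_crd *)
    qed (simp add: co_def[abs_def] *)
  qed
  have gr: "grad (\<lambda>x. G k (F i x)) x = (\<Sum>l\<in>UNIV. co k l (F i x) *s row_opt i l x)" for i k x
  proof -
    let ?t = "D (G k) (F i x) (0, 0, 1)"
    let ?T = "grad (\<lambda>x. tcrd (F i x)) x"
    have lin: "linear (D (G k) (F i x))" by (rule D_linear[OF C1G])
    have "grad (\<lambda>x. G k (F i x)) x = (\<Sum>l\<in>UNIV. D (G k) (F i x) (horizontal_basis l) *\<^sub>R row i l x) + ?t *\<^sub>R ?T"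
    proof (rule vec_eq_iff[THEN iffD2], rule allI)
      fix j
      have "grad (\<lambda>x. G k (F i x)) x $ j = D (G k) (F i x) (D (F i) x (axis j 1))"
        by (simp add: grad_nth D_compose[OF C1G C1F])
      also have "D (F i) x (axis j 1) = (\<Sum>l\<in>UNIV. row i l x $ j *\<^sub>R horizontal_basis l) + (?T $ j) *\<^sub>R (0, 0, 1)"
        unfolding row_def grad_compose_linear[OF bounded_linear_crd C1F]
          grad_compose_linear[OF bounded_linear_tcrd C1F]
        by (rule heis_expand)
      also have "D (G k) (F i x) \<dots> = (\<Sum>l\<in>UNIV. row i l x $ j * D (G k) (F i x) (horizontal_basis l)) + (?T $ j) * ?t"
        by (simp add: linear_add[OF lin] linear_sum[OF lin] linear_cmul[OF lin] del: scaleR_Pair)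
      finally show "grad (\<lambda>x. G k (F i x)) x $ j =
          ((\<Sum>l\<in>UNIV. D (G k) (F i x) (horizontal_basis l) *\<^sub>R row i l x) + ?t *\<^sub>R ?T) $ j"
        by (simp add: mult.commute)
    qed
    also have "?T = contact (F i) x - 2 *\<^sub>R (\<Sum>j\<in>UNIV.
      crd (j, True) (F i x) *\<^sub>R row i (j, False) x - crd (j, False) (F i x) *\<^sub>R row i (j, True) x)"
      unfolding contact_def row_def by simp
    also have "(\<Sum>l\<in>UNIV. D (G k) (F i x) (horizontal_basis l) *\<^sub>R row i l x) + ?t *\<^sub>R \<dots> =
      ?t *\<^sub>R contact (F i) x + (\<Sum>j\<in>UNIV. \<Sum>b\<in>UNIV. co k (Some (j, b)) (F i x) *\<^sub>R row i (j, b) x)"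
    proof -
      have "(\<Sum>l\<in>UNIV. D (G k) (F i x) (horizontal_basis l) *\<^sub>R row i l x) =
        (\<Sum>j\<in>UNIV. \<Sum>b\<in>UNIV. D (G k) (F i x) (horizontal_basis (j, b)) *\<^sub>R row i (j, b) x)"
        by (simp add: sum.cartesian_product flip: UNIV_Times_UNIV)
      then show ?thesis
        by (simp add: UNIV_bool co_def scaleR_diff_right scaleR_add_left scaleR_sum_right sum.distrib sum_subtractf sum_negf
            algebra_simps)
    qed
    also have "\<dots> = (\<Sum>l\<in>UNIV. co k l (F i x) *s row_opt i l x)"
      by (simp add: UNIV_option_conv sum.reindex row_opt_def co_def[of k None] scalar_mult_eq_scaleR sum.cartesian_product
          flip: UNIV_Times_UNIV)
    finally show ?thesis .
  qed
  define c where "c L p = \<psi> p * (\<Prod>k\<in>UNIV. co k (L k) p)" for L p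
  have c: "C1 (c L)" for L unfolding c_def by (intro C1_mult \<psi> C1_prod C1co)
  have "integral B (\<lambda>x. \<psi> (F i x) * det (\<chi> k. grad (\<lambda>x. G k (F i x)) x)) =
    (\<Sum>L\<in>UNIV. integral B (\<lambda>x. c L (F i x) * det (\<chi> k. row_opt i (L k) x)))" for i
  proof -
    have cont: "continuous_on UNIV (\<lambda>x. row_opt i l x)" for l
      unfolding row_opt_def by (cases l) (simp_all add: continuous_row continuous_contact)
    have "\<psi> (F i x) * det (\<chi> k. grad (\<lambda>x. G k (F i x)) x) =
      (\<Sum>L\<in>UNIV. c L (F i x) * det (\<chi> k. row_opt i (L k) x))" for x
    proof -
      have "det (\<chi> k. \<Sum>l\<in>UNIV. co k l (F i x) *s row_opt i l x) =
        (\<Sum>L\<in>UNIV. det (\<chi> k. co k (L k) (F i x) *s row_opt i (L k) x))"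
        by (rule det_sum_rows)
      then show ?thesis
        unfolding gr det_rows_mul c_def by (simp add: sum_distrib_left mult.assoc)
    qed
    then have "integral B (\<lambda>x. \<psi> (F i x) * det (\<chi> k. grad (\<lambda>x. G k (F i x)) x)) =
      integral B (\<lambda>x. \<Sum>L\<in>UNIV. c L (F i x) * det (\<chi> k. row_opt i (L k) x))" by simp
    also have "\<dots> = (\<Sum>L\<in>UNIV. integral B (\<lambda>x. c L (F i x) * det (\<chi> k. row_opt i (L k) x)))"
      by (intro integral_sum integrable_B continuous_weighted c continuous_det_rows cont) simp
    finally show ?thesis .
  qed
  moreover have "(\<lambda>i. \<Sum>L\<in>UNIV. integral B (\<lambda>x. c L (F i x) * det (\<chi> k. row_opt i (L k) x))) \<longlonglongrightarrow>
    (\<Sum>L\<in>(UNIV :: ('k \<Rightarrow> ('n \<times> bool) option) set). 0)"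
    by (intro tendsto_sum mixed_limit c) (simp add: c_def zero)
  ultimately show ?thesis by simp
qed

end

section \<open>Smoothing of maps into the Heisenberg group\<close>

text \<open>
  The third coordinate of \<open>q\<^sup>-\<^sup>1 * p\<close>, which the Koranyi distance controls quadratically.
\<close>

definition heis_increment :: "'n::finite heis \<Rightarrow> 'n heis \<Rightarrow> real"
  where "heis_increment q p = tcrd p - tcrd q +
    2 * (\<Sum>j\<in>UNIV. crd (j, True) q * crd (j, False) p - crd (j, False) q * crd (j, True) p)"

lemma abs_heis_increment_le: "\<bar>heis_increment q p\<bar> \<le> koranyi_dist p q ^ 2"
proof -
  obtain x y t where p: "p = (x, y, t)" by (cases p)
  obtain x' y' t' where q: "q = (x', y', t')" by (cases q)
  have "heis_mult (heis_inv q) p = (x - x', y - y', heis_increment q p)"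
    by (simp add: p q heis_mult_def heis_inv_simp heis_increment_def crd_def tcrd_def algebra_simps)
  then show ?thesis
    using koranyi_norm_ge(2)[of "heis_increment q p" "x - x'" "y - y'"] by (simp add: koranyi_dist_def)
qed

lemma contact_nth:
  fixes F :: "real ^ 'k::finite \<Rightarrow> 'n::finite heis"
  assumes "C1 F"
  shows "contact F x $ j = tcrd (D F x (axis j 1)) +
    2 * (\<Sum>l\<in>UNIV. crd (l, True) (F x) * crd (l, False) (D F x (axis j 1)) -
      crd (l, False) (F x) * crd (l, True) (D F x (axis j 1)))"
  unfolding contact_def
  by (simp add: grad_compose_linear[OF bounded_linear_crd assms] grad_compose_linear[OF bounded_linear_tcrd assms])

text \<open>
  Weights of sum one for the values and of sum zero for the derivatives turn the contact form of a
  weighted mean into a mean of group increments.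
\<close>

lemma contact_average:
  fixes P :: "'v \<Rightarrow> 'n::finite heis"
  assumes "(\<Sum>v\<in>V. k v) = 1" "(\<Sum>v\<in>V. g v) = (0::real)"
    and q: "q = (\<Sum>v\<in>V. k v *\<^sub>R P v)" and p: "p = (\<Sum>v\<in>V. g v *\<^sub>R P v)"
  shows "tcrd p + 2 * (\<Sum>l\<in>UNIV. crd (l, True) q * crd (l, False) p - crd (l, False) q * crd (l, True) p) =
    (\<Sum>v\<in>V. \<Sum>w\<in>V. g v * k w * heis_increment (P w) (P v))"
proof -
  have c: "crd l p = (\<Sum>v\<in>V. g v * crd l (P v))" "crd l q = (\<Sum>v\<in>V. k v * crd l (P v))" for l
    unfolding p q using bounded_linear.linear[OF bounded_linear_crd[of l]]
    by (simp_all add: linear_sum linear_cmul)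
  have t: "tcrd p = (\<Sum>v\<in>V. g v * tcrd (P v))"
    unfolding p linear_sum[OF bounded_linear.linear[OF bounded_linear_tcrd]]
      linear_cmul[OF bounded_linear.linear[OF bounded_linear_tcrd]] by simp
  have 1: "(\<Sum>v\<in>V. \<Sum>w\<in>V. g v * k w * tcrd (P v)) = tcrd p"
  proof -
    have "(\<Sum>v\<in>V. \<Sum>w\<in>V. g v * k w * tcrd (P v)) = (\<Sum>v\<in>V. (g v * tcrd (P v)) * (\<Sum>w\<in>V. k w))"
      unfolding sum_distrib_left by (intro sum.cong refl) (simp only: mult_ac)
    then show ?thesis using assms(1) by (simp add: t)
  qed
  have 2: "(\<Sum>v\<in>V. \<Sum>w\<in>V. g v * k w * tcrd (P w)) = 0"
  proof -
    have "(\<Sum>v\<in>V. \<Sum>w\<in>V. g v * k w * tcrd (P w)) = (\<Sum>v\<in>V. g v) * (\<Sum>w\<in>V. k w * tcrd (P w))"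
      by (simp add: sum_product mult.assoc)
    then show ?thesis using assms(2) by simp
  qed
  have 3: "(\<Sum>v\<in>V. \<Sum>w\<in>V. g v * k w * (crd l (P w) * crd l' (P v))) = crd l q * crd l' p" for l l'
  proof -
    have "(\<Sum>v\<in>V. \<Sum>w\<in>V. g v * k w * (crd l (P w) * crd l' (P v))) =
      (\<Sum>v\<in>V. g v * crd l' (P v)) * (\<Sum>w\<in>V. k w * crd l (P w))"
      by (simp add: sum_product mult_ac)
    then show ?thesis by (simp add: c mult.commute)
  qed
  have "(\<Sum>v\<in>V. \<Sum>w\<in>V. g v * k w * heis_increment (P w) (P v)) =
    (\<Sum>v\<in>V. \<Sum>w\<in>V. g v * k w * tcrd (P v)) - (\<Sum>v\<in>V. \<Sum>w\<in>V. g v * k w * tcrd (P w)) +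
    2 * (\<Sum>v\<in>V. \<Sum>w\<in>V. \<Sum>l\<in>UNIV. g v * k w * (crd (l, True) (P w) * crd (l, False) (P v)) -
      g v * k w * (crd (l, False) (P w) * crd (l, True) (P v)))"
    unfolding heis_increment_def
    by (simp add: algebra_simps sum.distrib sum_subtractf sum_distrib_left)
  also have "(\<Sum>v\<in>V. \<Sum>w\<in>V. \<Sum>l\<in>UNIV. g v * k w * (crd (l, True) (P w) * crd (l, False) (P v)) -
      g v * k w * (crd (l, False) (P w) * crd (l, True) (P v))) =
    (\<Sum>l\<in>UNIV. (\<Sum>v\<in>V. \<Sum>w\<in>V. g v * k w * (crd (l, True) (P w) * crd (l, False) (P v))) -
      (\<Sum>v\<in>V. \<Sum>w\<in>V. g v * k w * (crd (l, False) (P w) * crd (l, True) (P v))))"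
    unfolding sum_subtractf[symmetric]
    by (subst (2) sum.swap) (subst sum.swap, rule sum.cong, simp_all)
  finally show ?thesis unfolding 1 2 3 by simp
qed

text \<open>
  The approximation is \<open>\<Sum>\<^sub>v k\<^sub>v f(v)\<close> for a partition of unity \<open>k\<close> on a grid of mesh \<open>\<epsilon>\<close>. Since the
  gradients of the \<open>k\<^sub>v\<close> sum to zero, its derivative is a sum of increments of \<open>f\<close> over distances
  comparable to \<open>\<epsilon>\<close>, and by \<open>contact_average\<close> its contact form is a sum of group increments over such
  distances; only the latter see the square of the Koranyi distance.
\<close>

lemma smoothing:
  "\<exists>C>0. \<forall>\<epsilon>>0. \<forall>a b. \<forall>f :: real ^ 'k::finite \<Rightarrow> 'n::finite heis.
    (\<forall>x y. dist x y \<le> 2 * C * \<epsilon> \<longrightarrow> dist (f x) (f y) \<le> a \<and> koranyi_dist (f x) (f y) \<le> b) \<longrightarrow>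
    (\<exists>F. C1 F \<and> (\<forall>x. norm x \<le> 2 \<longrightarrow> dist (F x) (f x) \<le> a \<and>
      (\<forall>j. norm (D F x (axis j 1)) \<le> C / \<epsilon> * a) \<and> (\<forall>j. \<bar>contact F x $ j\<bar> \<le> C / \<epsilon> * b\<^sup>2)))"
proof -
  obtain C where C: "C > 0" and part: "\<forall>\<epsilon>>0. \<exists>V pt k. finite (V :: ('k \<Rightarrow> int) set) \<and> (\<forall>v. C1 (k v)) \<and> (\<forall>v x. 0 \<le> k v x) \<and>
     (\<forall>x::real^'k. norm x \<le> 2 \<longrightarrow> (\<Sum>v\<in>V. k v x) = 1) \<and>
     (\<forall>x j. norm x \<le> 2 \<longrightarrow> (\<Sum>v\<in>V. grad (k v) x $ j) = 0) \<and>
     (\<forall>v x j. k v x \<noteq> 0 \<or> grad (k v) x $ j \<noteq> 0 \<longrightarrow> norm (x - pt v) \<le> C * \<epsilon>) \<and>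
     (\<forall>x j. norm x \<le> 2 \<longrightarrow> (\<Sum>v\<in>V. \<bar>grad (k v) x $ j\<bar>) \<le> C / \<epsilon>)"
    using grid_partition[where 'k='k] by blast
  show ?thesis
  proof (rule exI[of _ C], intro conjI allI impI)
    fix \<epsilon> a b :: real and f :: "real ^ 'k \<Rightarrow> 'n heis"
    assume \<epsilon>: "\<epsilon> > 0"
      and f: "\<forall>x y. dist x y \<le> 2 * C * \<epsilon> \<longrightarrow> dist (f x) (f y) \<le> a \<and> koranyi_dist (f x) (f y) \<le> b"
    obtain V :: "('k \<Rightarrow> int) set" and pt k where fin: "finite V" and k: "\<And>v. C1 (k v)" "\<And>v x. 0 \<le> k v x"
      "\<And>x::real^'k. norm x \<le> 2 \<Longrightarrow> (\<Sum>v\<in>V. k v x) = 1"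
      "\<And>x j. norm x \<le> 2 \<Longrightarrow> (\<Sum>v\<in>V. grad (k v) x $ j) = 0"
      "\<And>v x j. k v x \<noteq> 0 \<or> grad (k v) x $ j \<noteq> 0 \<Longrightarrow> norm (x - pt v) \<le> C * \<epsilon>"
      "\<And>x j. norm x \<le> 2 \<Longrightarrow> (\<Sum>v\<in>V. \<bar>grad (k v) x $ j\<bar>) \<le> C / \<epsilon>"
      using part[rule_format, OF \<epsilon>] by blast
    define P where "P v = f (pt v)" for v
    have f': "dist (f x) (f y) \<le> a" "koranyi_dist (f x) (f y) \<le> b" if "dist x y \<le> 2 * C * \<epsilon>" for x y
      using f that by blast+
    have a0: "0 \<le> a" using f'(1)[of 0 0] C \<epsilon> by simp
    define F where "F x = (\<Sum>v\<in>V. k v x *\<^sub>R P v)" for x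
    have C1F: "C1 F" unfolding F_def by (intro C1_sum C1_scaleR k C1_const)
    have DF: "D F x (axis j 1) = (\<Sum>v\<in>V. grad (k v) x $ j *\<^sub>R P v)" for x j
    proof -
      have "(F has_derivative (\<lambda>u. \<Sum>v\<in>V. D (k v) x u *\<^sub>R P v)) (at x)"
        unfolding F_def[abs_def]
        by (intro has_derivative_sum has_derivative_scaleR_left C1_has_derivative k)
      from C1_D_eq[OF C1F this] show ?thesis by (simp add: grad_nth)
    qed
    have near: "dist (P v) (f x) \<le> a" if "k v x \<noteq> 0 \<or> grad (k v) x $ j \<noteq> 0" for v x j
    proof -
      have "dist (pt v) x \<le> C * \<epsilon>" using k(5)[OF that] by (simp add: dist_norm norm_minus_commute)
      also have "\<dots> \<le> 2 * C * \<epsilon>" using C \<epsilon> by simp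
      finally show ?thesis unfolding P_def by (rule f'(1))
    qed
    have near2: "koranyi_dist (P v) (P w) \<le> b" if "grad (k v) x $ j \<noteq> 0" "k w x \<noteq> 0" for v w x j
    proof -
      have "norm (x - pt v) \<le> C * \<epsilon>" "norm (x - pt w) \<le> C * \<epsilon>" using k(5) that by blast+
      then have "dist (pt v) (pt w) \<le> 2 * C * \<epsilon>"
        using dist_triangle[of "pt v" "pt w" x] by (simp add: dist_norm norm_minus_commute)
      then show ?thesis unfolding P_def by (rule f'(2))
    qed
    have 1: "dist (F x) (f x) \<le> a" if x: "norm x \<le> 2" for x
    proof -
      have "f x = (\<Sum>v\<in>V. k v x *\<^sub>R f x)" using k(3)[OF x] by (simp flip: scaleR_sum_left)
      then have "dist (F x) (f x) = norm (\<Sum>v\<in>V. k v x *\<^sub>R (P v - f x))"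
        unfolding F_def dist_norm by (simp add: scaleR_diff_right sum_subtractf)
      also have "\<dots> \<le> (\<Sum>v\<in>V. k v x * a)"
      proof (rule sum_norm_le)
        fix v
        show "norm (k v x *\<^sub>R (P v - f x)) \<le> k v x * a"
          using near[of v x] k(2)[of v x] by (cases "k v x = 0") (auto simp: dist_norm intro: mult_left_mono)
      qed
      also have "\<dots> = a" using k(3)[OF x] by (simp flip: sum_distrib_right)
      finally show ?thesis .
    qed
    have 2: "norm (D F x (axis j 1)) \<le> C / \<epsilon> * a" if x: "norm x \<le> 2" for x j
    proof -
      have "(\<Sum>v\<in>V. grad (k v) x $ j *\<^sub>R f x) = 0" using k(4)[OF x] by (simp flip: scaleR_sum_left)
      then have "norm (D F x (axis j 1)) = norm (\<Sum>v\<in>V. grad (k v) x $ j *\<^sub>R (P v - f x))"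
        unfolding DF by (simp add: scaleR_diff_right sum_subtractf)
      also have "\<dots> \<le> (\<Sum>v\<in>V. \<bar>grad (k v) x $ j\<bar> * a)"
      proof (rule sum_norm_le)
        fix v
        show "norm (grad (k v) x $ j *\<^sub>R (P v - f x)) \<le> \<bar>grad (k v) x $ j\<bar> * a"
          using near[of v x j] by (cases "grad (k v) x $ j = 0") (auto simp: dist_norm intro: mult_left_mono)
      qed
      also have "\<dots> = (\<Sum>v\<in>V. \<bar>grad (k v) x $ j\<bar>) * a" by (simp add: sum_distrib_right)
      also have "\<dots> \<le> C / \<epsilon> * a" by (intro mult_right_mono k(6) x a0)
      finally show ?thesis .
    qed
    have 3: "\<bar>contact F x $ j\<bar> \<le> C / \<epsilon> * b\<^sup>2" if x: "norm x \<le> 2" for x j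
    proof -
      have "contact F x $ j = (\<Sum>v\<in>V. \<Sum>w\<in>V. grad (k v) x $ j * k w x * heis_increment (P w) (P v))"
        unfolding contact_nth[OF C1F]
        by (rule contact_average[OF k(3)[OF x] k(4)[OF x] F_def DF])
      also have "\<bar>\<dots>\<bar> \<le> (\<Sum>v\<in>V. \<Sum>w\<in>V. \<bar>grad (k v) x $ j\<bar> * (k w x * b\<^sup>2))"
      proof (intro order_trans[OF sum_abs] sum_mono order_trans[OF sum_abs])
        fix v w
        show "\<bar>grad (k v) x $ j * k w x * heis_increment (P w) (P v)\<bar> \<le> \<bar>grad (k v) x $ j\<bar> * (k w x * b\<^sup>2)"
        proof (cases "grad (k v) x $ j \<noteq> 0 \<and> k w x \<noteq> 0")
          case True
          have "koranyi_dist (P v) (P w) ^ 2 \<le> b\<^sup>2"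
            by (rule power_mono) (use near2 True in \<open>auto simp: koranyi_dist_def\<close>)
          then have "\<bar>heis_increment (P w) (P v)\<bar> \<le> b\<^sup>2" using abs_heis_increment_le[of "P w" "P v"] by linarith
          then have "\<bar>grad (k v) x $ j\<bar> * (k w x * \<bar>heis_increment (P w) (P v)\<bar>) \<le> \<bar>grad (k v) x $ j\<bar> * (k w x * b\<^sup>2)"
            by (intro mult_left_mono k) auto
          then show ?thesis using k(2)[of w x] by (simp add: abs_mult mult.assoc)
        qed auto
      qed
      also have "\<dots> = (\<Sum>v\<in>V. \<bar>grad (k v) x $ j\<bar>) * (\<Sum>w\<in>V. k w x) * b\<^sup>2"
        by (simp only: sum_distrib_left[symmetric] sum_distrib_right[symmetric] mult.assoc)
      also have "\<dots> = (\<Sum>v\<in>V. \<bar>grad (k v) x $ j\<bar>) * b\<^sup>2" using k(3)[OF x] by simp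
      also have "\<dots> \<le> C / \<epsilon> * b\<^sup>2" by (intro mult_right_mono k(6) x) simp
      finally show ?thesis .
    qed
    show "\<exists>F. C1 F \<and> (\<forall>x. norm x \<le> 2 \<longrightarrow> dist (F x) (f x) \<le> a \<and>
      (\<forall>j. norm (D F x (axis j 1)) \<le> C / \<epsilon> * a) \<and> (\<forall>j. \<bar>contact F x $ j\<bar> \<le> C / \<epsilon> * b\<^sup>2))"
      using C1F 1 2 3 by blast
  qed (rule C)
qed

section \<open>The contradiction in the critical dimension\<close>

lemma integral_bump_pos:
  fixes \<psi> :: "real ^ 'k::finite \<Rightarrow> real"
  assumes "continuous_on UNIV \<psi>" "\<And>y. 0 \<le> \<psi> y" "\<psi> 0 > 0"
  shows "integral (cball 0 1) \<psi> > 0"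
proof -
  have "isCont \<psi> 0" using assms(1) by (simp add: continuous_on_eq_continuous_at)
  then obtain \<delta> where \<delta>: "\<delta> > 0" "\<And>y. dist y 0 < \<delta> \<Longrightarrow> dist (\<psi> y) (\<psi> 0) < \<psi> 0 / 2"
    unfolding continuous_at_eps_delta dist_norm using assms(3) by (meson half_gt_zero)
  define r where "r = min 1 (\<delta> / 2)"
  have r: "0 < r" "r \<le> 1" "r < \<delta>" using \<delta> by (auto simp: r_def)
  have "0 < \<psi> 0 / 2 * measure lborel (cball (0::real^'k) r)"
    using assms(3) r by (intro mult_pos_pos content_cball_pos) auto
  also have "\<dots> = integral (cball (0::real^'k) r) (\<lambda>y. \<psi> 0 / 2 * 1)"
    using lmeasure_integral[OF lmeasurable_cball[of "0::real^'k" r]]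
    by (simp only: integral_mult_right) (simp add: measure_completion)
  also have "\<dots> \<le> integral (cball 0 r) \<psi>"
  proof (rule integral_le)
    fix y :: "real^'k" assume "y \<in> cball 0 r"
    then have "dist (\<psi> y) (\<psi> 0) < \<psi> 0 / 2" using r by (intro \<delta>) auto
    then show "\<psi> 0 / 2 * 1 \<le> \<psi> y" unfolding dist_real_def by linarith
  qed (auto intro!: integrable_compact continuous_on_subset[OF assms(1)])
  also have "\<dots> \<le> integral (cball 0 1) \<psi>"
    using r assms(2) by (intro integral_subset_le) (auto intro!: integrable_compact continuous_on_subset[OF assms(1)])
  finally show ?thesis .
qed

text \<open>
  The contradiction between the two evaluations of the integral in the critical dimension. The
  hypothesis provides, at some scale \<open>\<epsilon>\<close>, moduli \<open>a\<close> and \<open>b\<close> for the Euclidean and the Koranyi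
  distance for which the bounds of \<open>smoothing\<close> have a small product.
\<close>

lemma no_sphere_embedding:
  fixes f :: "real^'k::{finite,wellorder} \<Rightarrow> 'n::finite heis"
  assumes dim: "CARD('k) = CARD('n) + 1" and inj: "inj_on f (sphere 0 1)"
    and moduli: "\<And>C \<eta>. C > 0 \<Longrightarrow> \<eta> > 0 \<Longrightarrow> \<exists>\<epsilon>>0. \<exists>a b. 0 \<le> a \<and> a \<le> \<eta> \<and>
      (C / \<epsilon> * b\<^sup>2) * (C / \<epsilon> * a) ^ CARD('n) \<le> \<eta> \<and>
      (\<forall>x\<in>cball 0 1. \<forall>y\<in>cball 0 1. dist x y \<le> 2 * C * \<epsilon> \<longrightarrow> dist (f x) (f y) \<le> a \<and> koranyi_dist (f x) (f y) \<le> b)"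
  shows False
proof -
  let ?B = "cball (0::real^'k::_) 1" and ?S = "sphere (0::real^'k::_) 1"
  have contf: "continuous_on ?B f"
    unfolding continuous_on_iff
  proof (intro ballI allI impI)
    fix x and \<eta> :: real assume "x \<in> ?B" and \<eta>: "0 < \<eta>"
    obtain \<epsilon> a where *: "\<epsilon> > 0" "a \<le> \<eta> / 2"
      "\<forall>x\<in>?B. \<forall>y\<in>?B. dist x y \<le> 2 * 1 * \<epsilon> \<longrightarrow> dist (f x) (f y) \<le> a"
      using moduli[of 1 "\<eta> / 2"] \<eta> by (metis half_gt_zero zero_less_one)
    show "\<exists>d>0. \<forall>x'\<in>?B. dist x' x < d \<longrightarrow> dist (f x') (f x) < \<eta>"
    proof (intro exI[of _ "2 * \<epsilon>"] conjI ballI impI)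
      fix x' assume "x' \<in> ?B" "dist x' x < 2 * \<epsilon>"
      then have "dist (f x') (f x) \<le> a" using *(3) \<open>x \<in> ?B\<close> by simp
      then show "dist (f x') (f x) < \<eta>" using *(2) \<eta> by linarith
    qed (use * in simp)
  qed
  \<comment> \<open>The nearest point projection \<open>\<pi>\<close> does not increase distances, so
    \<open>f \<circ> \<pi>\<close> is defined everywhere and keeps the moduli of \<open>f\<close>; the
    smooth approximations are made from it.\<close>
  define \<pi> where "\<pi> = closest_point ?B"
  have \<pi>in: "\<pi> x \<in> ?B" for x unfolding \<pi>_def by (rule closest_point_in_set) auto
  have \<pi>id: "\<pi> x = x" if "x \<in> ?B" for x unfolding \<pi>_def using that by (rule closest_point_self)
  have \<pi>lip: "dist (\<pi> x) (\<pi> y) \<le> dist x y" for x y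
    unfolding \<pi>_def by (rule closest_point_lipschitz) auto
  define g where "g x = f (\<pi> x)" for x
  have \<pi>c: "continuous_on UNIV \<pi>" unfolding \<pi>_def by (rule continuous_on_closest_point) auto
  have gc: "continuous_on UNIV g" unfolding g_def
    by (rule continuous_on_compose2[OF contf \<pi>c]) (use \<pi>in in blast)
  have "bounded (f ` ?B)" by (intro compact_imp_bounded compact_continuous_image contf) auto
  then obtain M where M: "\<And>x. norm (g x) \<le> M" unfolding bounded_iff g_def using \<pi>in by blast
  have contS: "continuous_on ?S f" by (rule continuous_on_subset[OF contf]) auto
  have contI: "continuous_on (f ` ?S) (the_inv_into ?S f)"
    by (rule continuous_on_inv[OF contS compact_sphere]) (simp add: the_inv_into_f_f[OF inj])
  \<comment> \<open>An error \<open>\<eta>\<close> in each coordinate gives an error \<open>1/8\<close>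
    in norm. The collar below costs another \<open>1/8\<close> and the smoothing \<open>1/4\<close>,
    which adds up to the \<open>1/2\<close> that \<open>degree_near_identity\<close> allows.\<close>
  define \<eta> where "\<eta> = 1 / (8 * real CARD('k))"
  have \<eta>: "\<eta> > 0" by (simp add: \<eta>_def)
  have "\<exists>G. real_polynomial_function G \<and> (\<forall>p\<in>f ` ?S. \<bar>the_inv_into ?S f p $ k - G p\<bar> < \<eta>)" for k
    by (rule Stone_Weierstrass_real_polynomial_function[OF compact_continuous_image[OF contS compact_sphere]
         continuous_on_component[OF contI] \<eta>]) blast
  then obtain G where G: "\<And>k. real_polynomial_function (G k)"
    "\<And>k p. p \<in> f ` ?S \<Longrightarrow> \<bar>the_inv_into ?S f p $ k - G k p\<bar> < \<eta>" by metis
  define H where "H p = (\<chi> k. G k p)" for p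
  have C1G: "C1 (G k)" for k by (rule C1_real_polynomial_function[OF G(1)])
  have Hc: "continuous_on UNIV H" unfolding H_def
    by (intro continuous_on_vec_lambda C1_continuous_on C1G)
  have HS: "norm (H (f x) - x) \<le> 1 / 8" if x: "x \<in> ?S" for x
  proof -
    have "norm (H (f x) - x) \<le> real CARD('k) * \<eta>"
      using G(2)[of "f x"] x by (intro norm_le_card_mult)
        (auto simp: H_def the_inv_into_f_f[OF inj] abs_minus_commute less_imp_le)
    then show ?thesis by (simp add: \<eta>_def)
  qed
  \<comment> \<open>By uniform continuity the estimate on the sphere persists, with \<open>1/4\<close>,
    on a collar \<open>r < |x| < R\<close> around it.\<close>
  define h0 where "h0 x = H (g x) - x" for x
  have "uniformly_continuous_on (cball 0 2) h0"
    unfolding h0_def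
    by (intro compact_uniformly_continuous continuous_on_diff continuous_on_id compact_cball
        continuous_on_subset[OF continuous_on_compose2[OF Hc gc]]) auto
  then obtain \<delta> where \<delta>: "\<delta> > 0"
    "\<And>x y. x \<in> cball 0 2 \<Longrightarrow> y \<in> cball 0 2 \<Longrightarrow> dist x y < \<delta> \<Longrightarrow> dist (h0 x) (h0 y) < 1 / 8"
    unfolding uniformly_continuous_on_def by (metis zero_less_divide_1_iff zero_less_numeral)
  define \<delta>' where "\<delta>' = min (\<delta> / 2) (1 / 4)"
  have \<delta>': "0 < \<delta>'" "\<delta>' < \<delta>" "\<delta>' \<le> 1 / 4" using \<delta> by (auto simp: \<delta>'_def)
  define r where "r = 1 - \<delta>'"
  define R where "R = 1 + \<delta>'"
  have rR: "3 / 4 \<le> r" "r < 1" "1 < R" "R \<le> 2" using \<delta>' by (auto simp: r_def R_def)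
  have collar: "norm (h0 x) \<le> 1 / 4" if x: "r < norm x" "norm x < R" for x
  proof -
    define y where "y = x /\<^sub>R norm x"
    have nx: "norm x > 0" using x rR by linarith
    then have ny: "norm y = 1" by (simp add: y_def)
    have "x - y = (norm x - 1) *\<^sub>R y" using nx by (simp add: y_def algebra_simps)
    then have "dist x y = \<bar>norm x - 1\<bar>" using ny by (simp add: dist_norm)
    then have "dist x y < \<delta>" using x \<delta>' by (auto simp: r_def R_def abs_if)
    then have "dist (h0 x) (h0 y) < 1 / 8" using x rR ny by (intro \<delta>) auto
    moreover have "norm (h0 y) \<le> 1 / 8" using HS[of y] ny \<pi>id[of y] by (simp add: h0_def g_def)
    ultimately show ?thesis
      using norm_triangle_ineq2[of "h0 x" "h0 y"] unfolding dist_norm by linarith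
  qed
  have "uniformly_continuous_on (cball 0 (M + 1)) H"
    by (intro compact_uniformly_continuous continuous_on_subset[OF Hc] compact_cball) auto
  then obtain \<rho> where \<rho>: "\<rho> > 0"
    "\<And>p q. p \<in> cball 0 (M + 1) \<Longrightarrow> q \<in> cball 0 (M + 1) \<Longrightarrow> dist p q < \<rho> \<Longrightarrow> dist (H p) (H q) < 1 / 4"
    unfolding uniformly_continuous_on_def by (metis zero_less_divide_1_iff zero_less_numeral)
  define \<rho>' where "\<rho>' = min (\<rho> / 2) 1"
  have \<rho>': "0 < \<rho>'" "\<rho>' < \<rho>" "\<rho>' \<le> 1" using \<rho> by (auto simp: \<rho>'_def)
  \<comment> \<open>Distances at most \<open>\<rho>'\<close> are small enough for \<open>H\<close> to
    change by less than \<open>1/4\<close>, which keeps \<open>H \<circ> F\<close> close to the identity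
    on the collar.\<close>
  obtain C where C: "C > 0" and smooth: "\<forall>\<epsilon>>0. \<forall>a b. \<forall>f :: real^'k::_ \<Rightarrow> 'n heis.
    (\<forall>x y. dist x y \<le> 2 * C * \<epsilon> \<longrightarrow> dist (f x) (f y) \<le> a \<and> koranyi_dist (f x) (f y) \<le> b) \<longrightarrow>
    (\<exists>F. C1 F \<and> (\<forall>x. norm x \<le> 2 \<longrightarrow> dist (F x) (f x) \<le> a \<and>
      (\<forall>j. norm (D F x (axis j 1)) \<le> C / \<epsilon> * a) \<and> (\<forall>j. \<bar>contact F x $ j\<bar> \<le> C / \<epsilon> * b\<^sup>2)))"
    using smoothing[where 'k='k and 'n='n] by blast
  have "\<exists>F d e. C1 F \<and> (\<forall>x. norm x \<le> 2 \<longrightarrow> dist (F x) (g x) \<le> \<rho>' \<and>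
      (\<forall>j. norm (D F x (axis j 1)) \<le> d) \<and> (\<forall>j. \<bar>contact F x $ j\<bar> \<le> e)) \<and> 0 \<le> e * d ^ CARD('n) \<and> e * d ^ CARD('n) \<le> 1 / real (Suc i)" for i
  proof -
    define \<eta>' where "\<eta>' = min \<rho>' (1 / real (Suc i))"
    have "\<eta>' > 0" using \<rho>' by (simp add: \<eta>'_def)
    from moduli[OF C this] obtain \<epsilon> a b where *: "\<epsilon> > 0" "0 \<le> a" "a \<le> \<eta>'" "(C / \<epsilon> * b\<^sup>2) * (C / \<epsilon> * a) ^ CARD('n) \<le> \<eta>'"
      "\<forall>x\<in>?B. \<forall>y\<in>?B. dist x y \<le> 2 * C * \<epsilon> \<longrightarrow> dist (f x) (f y) \<le> a \<and> koranyi_dist (f x) (f y) \<le> b"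
      by blast
    have "\<forall>x y. dist x y \<le> 2 * C * \<epsilon> \<longrightarrow> dist (g x) (g y) \<le> a \<and> koranyi_dist (g x) (g y) \<le> b"
    proof (intro allI impI)
      fix x y :: "real^'k::_" assume "dist x y \<le> 2 * C * \<epsilon>"
      then have "dist (\<pi> x) (\<pi> y) \<le> 2 * C * \<epsilon>" using \<pi>lip[of x y] by linarith
      then show "dist (g x) (g y) \<le> a \<and> koranyi_dist (g x) (g y) \<le> b"
        unfolding g_def using *(5) \<pi>in by blast
    qed
    with smooth *(1) have "\<exists>F. C1 F \<and> (\<forall>x. norm x \<le> 2 \<longrightarrow> dist (F x) (g x) \<le> a \<and>
      (\<forall>j. norm (D F x (axis j 1)) \<le> C / \<epsilon> * a) \<and> (\<forall>j. \<bar>contact F x $ j\<bar> \<le> C / \<epsilon> * b\<^sup>2))"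
      by simp
    then obtain F where F: "C1 F" "\<And>x. norm x \<le> 2 \<Longrightarrow> dist (F x) (g x) \<le> a"
      "\<And>x j. norm x \<le> 2 \<Longrightarrow> norm (D F x (axis j 1)) \<le> C / \<epsilon> * a"
      "\<And>x j. norm x \<le> 2 \<Longrightarrow> \<bar>contact F x $ j\<bar> \<le> C / \<epsilon> * b\<^sup>2"
      by blast
    have pos: "0 \<le> (C / \<epsilon> * b\<^sup>2) * (C / \<epsilon> * a) ^ CARD('n)"
      using C * by (intro mult_nonneg_nonneg zero_le_power2 zero_le_power divide_nonneg_nonneg) auto
    have "a \<le> \<rho>'" "(C / \<epsilon> * b\<^sup>2) * (C / \<epsilon> * a) ^ CARD('n) \<le> 1 / real (Suc i)"
      using *(3,4) by (simp_all add: \<eta>'_def)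
    then show ?thesis
      by (intro exI[of _ F] exI[of _ "C / \<epsilon> * a"] exI[of _ "C / \<epsilon> * b\<^sup>2"] conjI allI impI F pos order_trans[OF F(2)])
  qed
  then obtain F d e where F: "\<And>i. C1 (F i)" "\<And>i x. norm x \<le> 2 \<Longrightarrow> dist (F i x) (g x) \<le> \<rho>'"
    "\<And>i x j. norm x \<le> 2 \<Longrightarrow> norm (D (F i) x (axis j 1)) \<le> d i"
    "\<And>i x j. norm x \<le> 2 \<Longrightarrow> \<bar>contact (F i) x $ j\<bar> \<le> e i"
    "\<And>i. 0 \<le> e i * d i ^ CARD('n)" "\<And>i. e i * d i ^ CARD('n) \<le> 1 / real (Suc i)"
    by metis
  have lim: "(\<lambda>i. e i * d i ^ CARD('n)) \<longlonglongrightarrow> 0"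
    by (rule tendsto_sandwich[OF _ _ tendsto_const LIMSEQ_Suc[OF lim_1_over_n]])
      (use F(5,6) in auto)
  have FM: "norm (F i x) \<le> M + 1" if "norm x \<le> 2" for i x
  proof -
    have "norm (F i x) \<le> norm (g x) + dist (F i x) (g x)"
      using norm_triangle_sub[of "F i x" "g x"] by (simp add: dist_norm)
    then show ?thesis using F(2)[OF that, of i] M[of x] \<rho>' by linarith
  qed
  have near: "norm (H (F i x) - x) \<le> 1 / 2" if x: "r < norm x" "norm x < R" for i x
  proof -
    have x2: "norm x \<le> 2" using x rR by linarith
    have "dist (F i x) (g x) < \<rho>" using F(2)[OF x2, of i] \<rho>' by linarith
    moreover have "g x \<in> cball 0 (M + 1)" using M[of x] by simp
    moreover have "F i x \<in> cball 0 (M + 1)" using FM[OF x2] by simp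
    ultimately have "dist (H (F i x)) (H (g x)) < 1 / 4" by (intro \<rho>(2))
    moreover have "H (F i x) - x = (H (F i x) - H (g x)) + h0 x" by (simp add: h0_def)
    then have "norm (H (F i x) - x) \<le> norm (H (F i x) - H (g x)) + norm (h0 x)"
      by (simp only: norm_triangle_ineq)
    ultimately show ?thesis using collar[OF x] unfolding dist_norm by linarith
  qed
  define \<psi> where "\<psi> y = ramp2 (1 / 16 - (norm y)\<^sup>2)" for y :: "real^'k::_"
  have C1\<psi>: "C1 \<psi>" unfolding \<psi>_def
    by (intro C1_compose[OF C1_ramp2] C1_diff C1_const C1_norm_sq)
  have \<psi>0: "\<psi> y = 0" if "norm y \<ge> 1 / 4" for y
  proof -
    have "(1 / 4)\<^sup>2 \<le> (norm y)\<^sup>2" using that by (intro power_mono) auto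
    then show ?thesis by (simp add: \<psi>_def ramp2_def power2_eq_square)
  qed
  have C1H: "C1 H"
  proof -
    have "H = (\<lambda>p. \<Sum>k\<in>UNIV. G k p *\<^sub>R axis k 1)"
      by (simp add: fun_eq_iff vec_eq_iff H_def axis_def if_distrib cong: if_cong)
    moreover have "C1 (\<lambda>p. \<Sum>k\<in>UNIV. G k p *\<^sub>R (axis k 1 :: real^'k::_))"
      by (intro C1_sum C1_scaleR C1G C1_const)
    ultimately show ?thesis by simp
  qed
  have zero: "\<psi> (H (F i x)) = 0" if x: "r < norm x" "norm x < R" for i x
  proof (rule \<psi>0)
    show "1 / 4 \<le> norm (H (F i x))"
      using near[OF x, of i] x(1) rR(1) norm_triangle_ineq2[of x "x - H (F i x)"] by (simp add: norm_minus_commute)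
  qed
  interpret contact_sequence F d e "M + 1" r R
    by unfold_locales (use dim F FM lim rR in \<open>auto\<close>)
  have "(\<lambda>i. integral B (\<lambda>x. \<psi> (H (F i x)) * det (\<chi> k. grad (\<lambda>x. G k (F i x)) x))) \<longlonglongrightarrow> 0"
    by (rule polynomial_pullback_limit[OF G(1) C1_compose[OF C1\<psi> C1H]]) (rule zero)
  moreover have "integral B (\<lambda>x. \<psi> (H (F i x)) * det (\<chi> k. grad (\<lambda>x. G k (F i x)) x)) = integral B \<psi>" for i
  proof -
    have "integral B (\<lambda>x. det (\<chi> k. grad (\<lambda>x. H (F i x) $ k) x) * \<psi> (H (F i x))) = integral B \<psi>"
    proof (rule degree_near_identity[OF _ rR(1,2)])
      show "C1 (\<lambda>x. H (F i x) $ k)" for k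
        by (intro C1_compose[OF C1_coord] C1_compose[OF C1H] F)
      show "norm (H (F i x) - x) \<le> 1 / 2" if "r < norm x" "norm x \<le> 1" for x
        by (rule near) (use that rR in auto)
    qed (use C1_continuous_on[OF C1\<psi>] \<psi>0 in auto)
    then show ?thesis by (simp add: H_def mult.commute)
  qed
  ultimately have "integral B \<psi> = 0" by (simp add: LIMSEQ_const_iff)
  moreover have "integral B \<psi> > 0"
    by (rule integral_bump_pos[OF C1_continuous_on[OF C1\<psi>]]) (auto simp: \<psi>_def ramp2_def)
  ultimately show False by simp
qed

section \<open>An index type with one element more\<close>

text \<open>
  An index type with \<open>n + 1\<close> elements. It is given a well-order, which the change of variables
  formula requires of the coordinates.
\<close>

typedef 'n idx = "{..CARD('n::finite)}" by auto

instance idx :: (finite) finite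
proof
  have "(UNIV :: 'a idx set) = Abs_idx ` {..CARD('a)}"
    by (metis type_definition.Abs_image type_definition_idx)
  then show "finite (UNIV :: 'a idx set)" by (metis finite_imageI finite_atMost)
qed

instantiation idx :: (finite) linorder
begin

definition less_eq_idx :: "'a idx \<Rightarrow> 'a idx \<Rightarrow> bool" where "x \<le> y \<longleftrightarrow> Rep_idx x \<le> Rep_idx y"
definition less_idx :: "'a idx \<Rightarrow> 'a idx \<Rightarrow> bool" where "x < y \<longleftrightarrow> Rep_idx x < Rep_idx y"

instance by standard (auto simp: less_eq_idx_def less_idx_def Rep_idx_inject)

end

instance idx :: (finite) wellorder
proof
  fix P :: "'a idx \<Rightarrow> bool" and a
  assume step: "\<And>x. (\<And>y. y < x \<Longrightarrow> P y) \<Longrightarrow> P x"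
  show "P a"
    by (induction a rule: measure_induct_rule[of Rep_idx]) (rule step, simp add: less_idx_def)
qed

lemma card_idx: "CARD('n::finite idx) = CARD('n) + 1"
  using type_definition.card[OF type_definition_idx[where 'n='n]] by simp

section \<open>Hoelder exponents\<close>

lemma holder_plus_modulus:
  assumes f: "f \<in> holder_plus_class \<alpha> S X" and c: "c > 0"
  obtains t where "t > 0" "\<And>x y. x \<in> S \<Longrightarrow> y \<in> S \<Longrightarrow> dist x y \<le> t \<Longrightarrow> mdist X (f x) (f y) \<le> c * dist x y powr \<alpha>"
proof -
  define Q where "Q t = {ennreal (mdist X (f x) (f y) / dist x y powr \<alpha>) | x y. x \<in> S \<and> y \<in> S \<and> 0 < dist x y \<and> dist x y \<le> t}" for t
  have fS: "f \<in> S \<rightarrow> mspace X" and lim: "((\<lambda>t. Sup (Q t)) \<longlongrightarrow> 0) (at_right 0)"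
    using f unfolding holder_plus_class_def Q_def by auto
  have "eventually (\<lambda>t. Sup (Q t) < ennreal c) (at_right 0)"
    by (rule order_tendstoD(2)[OF lim]) (use c in simp)
  then obtain b where b: "b > 0" "\<And>t. t > 0 \<Longrightarrow> t < b \<Longrightarrow> Sup (Q t) < ennreal c"
    unfolding eventually_at_right_field by blast
  show ?thesis
  proof (rule that[of "b / 2"])
    show "b / 2 > 0" using b by simp
    fix x y assume xy: "x \<in> S" "y \<in> S" "dist x y \<le> b / 2"
    show "mdist X (f x) (f y) \<le> c * dist x y powr \<alpha>"
    proof (cases "x = y")
      case True
      have "f y \<in> mspace X" using fS xy(2) by (rule funcset_mem)
      then have "mdist X (f y) (f y) = 0" by simp
      then show ?thesis using True by simp
    next
      case False
      then have pos: "dist x y > 0" by simp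
      have "ennreal (mdist X (f x) (f y) / dist x y powr \<alpha>) \<le> Sup (Q (b / 2))"
        by (rule Sup_upper) (use xy pos in \<open>auto simp: Q_def\<close>)
      also have "\<dots> < ennreal c" using b by simp
      finally have "mdist X (f x) (f y) / dist x y powr \<alpha> < c"
        by (subst (asm) ennreal_less_iff) auto
      then show ?thesis using pos by (simp add: field_simps)
    qed
  qed
qed

text \<open>
  The relation between the exponents is \<open>2 \<gamma> + n \<theta> = n + 1\<close>.
\<close>

lemma critical_scaling:
  assumes n: "n > 0" and \<theta>: "\<theta> = (real n + 1) / real n - 2 * \<gamma> / real n" and s: "s > 0"
  shows "(s powr \<gamma>)\<^sup>2 * (s powr \<theta>) ^ n = s ^ (n + 1)"
proof -
  have "(s powr \<gamma>)\<^sup>2 * (s powr \<theta>) ^ n = s powr (2 * \<gamma> + real n * \<theta>)"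
    using s by (simp add: powr_add powr_power mult.commute)
  also have "2 * \<gamma> + real n * \<theta> = real (n + 1)" using n by (simp add: \<theta> field_simps)
  finally show ?thesis using s by (simp only: powr_realpow)
qed

text \<open>
  For \<open>s = 2 C \<epsilon>\<close>, \<open>a = H s\<^sup>\<theta>\<close> and \<open>b = K s\<^sup>\<gamma>\<close> all powers of \<open>s\<close> cancel, and the product is
  \<open>K\<^sup>2 H\<^sup>n\<close> times a constant that depends on \<open>C\<close> and \<open>n\<close> alone. It is therefore small
  at every scale once \<open>K\<^sup>2 H\<^sup>n\<close> is small, and \<open>\<epsilon>\<close> is still free to make \<open>a\<close> small.
\<close>

lemma critical_moduli:
  fixes f :: "real ^ 'k::finite \<Rightarrow> 'n::finite heis"
  assumes n: "n > 0" and \<theta>: "\<theta> = (real n + 1) / real n - 2 * \<gamma> / real n" "\<theta> > 0"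
    and \<kappa>: "\<And>\<kappa>. \<kappa> > 0 \<Longrightarrow> \<exists>H K t. 0 \<le> H \<and> 0 \<le> K \<and> 0 < t \<and> K\<^sup>2 * H ^ n \<le> \<kappa> \<and>
      (\<forall>x\<in>S. \<forall>y\<in>S. dist x y \<le> t \<longrightarrow> dist (f x) (f y) \<le> H * dist x y powr \<theta> \<and>
         koranyi_dist (f x) (f y) \<le> K * dist x y powr \<gamma>)"
    and \<gamma>: "\<gamma> \<ge> 0" and C: "C > 0" and \<eta>: "\<eta> > 0"
  shows "\<exists>\<epsilon>>0. \<exists>a b. 0 \<le> a \<and> a \<le> \<eta> \<and> (C / \<epsilon> * b\<^sup>2) * (C / \<epsilon> * a) ^ n \<le> \<eta> \<and>
      (\<forall>x\<in>S. \<forall>y\<in>S. dist x y \<le> 2 * C * \<epsilon> \<longrightarrow> dist (f x) (f y) \<le> a \<and> koranyi_dist (f x) (f y) \<le> b)"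
proof -
  define L where "L = (2 * C\<^sup>2) ^ (n + 1)"
  have L: "L > 0" using C by (simp add: L_def)
  obtain H K t where HK: "0 \<le> H" "0 \<le> K" "0 < t" "K\<^sup>2 * H ^ n \<le> \<eta> / L"
    and mod: "\<forall>x\<in>S. \<forall>y\<in>S. dist x y \<le> t \<longrightarrow> dist (f x) (f y) \<le> H * dist x y powr \<theta> \<and>
         koranyi_dist (f x) (f y) \<le> K * dist x y powr \<gamma>"
    using \<kappa>[of "\<eta> / L"] \<eta> L by auto
  \<comment> \<open>The second term makes \<open>H s\<^sup>\<theta> \<le> \<eta>\<close>; adding 1
    avoids division by zero when \<open>H = 0\<close>.\<close>
  define s where "s = min t ((\<eta> / (H + 1)) powr (1 / \<theta>))"
  have s: "0 < s" "s \<le> t" using HK \<eta> by (auto simp: s_def)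
  have "s powr \<theta> \<le> ((\<eta> / (H + 1)) powr (1 / \<theta>)) powr \<theta>"
    using s \<theta> by (intro powr_mono2) (auto simp: s_def)
  also have "\<dots> = \<eta> / (H + 1)" using \<theta>(2) HK \<eta> by (simp add: powr_powr)
  finally have s\<theta>: "s powr \<theta> \<le> \<eta> / (H + 1)" .
  define \<epsilon> where "\<epsilon> = s / (2 * C)"
  have \<epsilon>: "\<epsilon> > 0" "2 * C * \<epsilon> = s" "C / \<epsilon> = 2 * C\<^sup>2 / s" using s C by (auto simp: \<epsilon>_def power2_eq_square)
  show ?thesis
  proof (rule exI[of _ \<epsilon>], rule conjI[OF \<epsilon>(1)], rule exI[of _ "H * s powr \<theta>"], rule exI[of _ "K * s powr \<gamma>"],
      intro conjI ballI impI)
    show "0 \<le> H * s powr \<theta>" using HK by simp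
    have "H * s powr \<theta> \<le> (H + 1) * (\<eta> / (H + 1))"
      using HK s\<theta> by (intro mult_mono) auto
    then show "H * s powr \<theta> \<le> \<eta>" using HK by simp
    have "(C / \<epsilon> * (K * s powr \<gamma>)\<^sup>2) * (C / \<epsilon> * (H * s powr \<theta>)) ^ n =
       (C / \<epsilon>) ^ (n + 1) * (K\<^sup>2 * H ^ n) * ((s powr \<gamma>)\<^sup>2 * (s powr \<theta>) ^ n)"
    proof -
      have "(A * (K * p)\<^sup>2) * (A * (H * q)) ^ n = A ^ (n + 1) * (K\<^sup>2 * H ^ n) * (p\<^sup>2 * q ^ n)" for A p q :: real
        by (simp add: power_mult_distrib mult_ac)
      then show ?thesis .
    qed
    also have "\<dots> = L * (K\<^sup>2 * H ^ n)"
      unfolding critical_scaling[OF n \<theta>(1) s(1)] \<epsilon>(3) power_divide L_def using s by simp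
    also have "\<dots> \<le> L * (\<eta> / L)" using L by (intro mult_left_mono HK) simp
    also have "\<dots> = \<eta>" using L by simp
    finally show "(C / \<epsilon> * (K * s powr \<gamma>)\<^sup>2) * (C / \<epsilon> * (H * s powr \<theta>)) ^ n \<le> \<eta>" .
    fix x y assume xy: "x \<in> S" "y \<in> S" "dist x y \<le> 2 * C * \<epsilon>"
    then have le: "dist x y \<le> s" by (simp add: \<epsilon>)
    then have 1: "dist (f x) (f y) \<le> H * dist x y powr \<theta>" "koranyi_dist (f x) (f y) \<le> K * dist x y powr \<gamma>"
      using mod xy s by auto
    have "H * dist x y powr \<theta> \<le> H * s powr \<theta>"
      using HK le \<theta> by (intro mult_left_mono powr_mono2) auto
    then show "dist (f x) (f y) \<le> H * s powr \<theta>" using 1 by linarith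
    have "K * dist x y powr \<gamma> \<le> K * s powr \<gamma>"
      using HK le \<gamma> by (intro mult_left_mono powr_mono2) auto
    then show "koranyi_dist (f x) (f y) \<le> K * s powr \<gamma>" using 1 by linarith
  qed
qed

section \<open>Reduction to the critical dimension\<close>

definition incl :: "('k \<Rightarrow> 'm) \<Rightarrow> real ^ 'k \<Rightarrow> real ^ 'm"
  where "incl \<sigma> x = (\<chi> i::'m::finite. if i \<in> range \<sigma> then x $ inv \<sigma> i else (0::real))" for \<sigma> :: "'k::finite \<Rightarrow> 'm"

lemma norm_incl:
  assumes "inj \<sigma>" shows "norm (incl \<sigma> x) = norm x"
proof -
  have "(\<Sum>i\<in>UNIV. (norm (incl \<sigma> x $ i))\<^sup>2) = (\<Sum>i\<in>range \<sigma>. (norm (incl \<sigma> x $ i))\<^sup>2)"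
    by (rule sum.mono_neutral_right) (auto simp: incl_def)
  also have "\<dots> = (\<Sum>k\<in>UNIV. (norm (incl \<sigma> x $ \<sigma> k))\<^sup>2)"
    by (simp add: sum.reindex[OF assms])
  also have "\<dots> = (\<Sum>k\<in>UNIV. (norm (x $ k))\<^sup>2)"
    by (simp add: incl_def inv_f_f[OF assms])
  finally show ?thesis by (simp add: norm_vec_def L2_set_def)
qed

lemma dist_incl:
  assumes "inj \<sigma>" shows "dist (incl \<sigma> x) (incl \<sigma> y) = dist x y"
proof -
  have "incl \<sigma> x - incl \<sigma> y = incl \<sigma> (x - y)" by (simp add: incl_def vec_eq_iff)
  then show ?thesis by (simp add: dist_norm norm_incl[OF assms])
qed

text \<open>
  Restriction to an isometrically embedded coordinate disc of dimension \<open>n + 1\<close>; both the moduli and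
  injectivity on the sphere are inherited.
\<close>

lemma no_critical_map:
  fixes f :: "real ^ 'm::finite \<Rightarrow> 'n::finite heis"
  assumes m: "CARD('m) \<ge> CARD('n) + 1"
    and \<theta>: "\<theta> = (real CARD('n) + 1) / real CARD('n) - 2 * \<gamma> / real CARD('n)" "\<theta> > 0" and \<gamma>: "\<gamma> \<ge> 0"
    and \<kappa>: "\<And>\<kappa>. \<kappa> > 0 \<Longrightarrow> \<exists>H K t. 0 \<le> H \<and> 0 \<le> K \<and> 0 < t \<and> K\<^sup>2 * H ^ CARD('n) \<le> \<kappa> \<and>
      (\<forall>x\<in>cball 0 1. \<forall>y\<in>cball 0 1. dist x y \<le> t \<longrightarrow> dist (f x) (f y) \<le> H * dist x y powr \<theta> \<and>
         koranyi_dist (f x) (f y) \<le> K * dist x y powr \<gamma>)"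
  shows "\<not> inj_on f (sphere 0 1)"
proof
  assume inj: "inj_on f (sphere 0 1)"
  obtain \<sigma> :: "'n idx \<Rightarrow> 'm" where \<sigma>: "inj \<sigma>"
    using inj_on_iff_card_le[of "UNIV :: 'n idx set" "UNIV :: 'm set"] m by (auto simp: card_idx)
  define g where "g x = f (incl \<sigma> x)" for x
  have sph: "incl \<sigma> x \<in> sphere 0 1" if "x \<in> sphere 0 1" for x using that by (simp add: norm_incl[OF \<sigma>])
  have "inj_on g (sphere 0 1)"
  proof (rule inj_onI)
    fix x y assume "x \<in> sphere 0 1" "y \<in> sphere 0 1" "g x = g y"
    then have "incl \<sigma> x = incl \<sigma> y" using inj_onD[OF inj] sph unfolding g_def by blast
    then show "x = y" using dist_incl[OF \<sigma>, of x y] by simp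
  qed
  moreover have "\<exists>\<epsilon>>0. \<exists>a b. 0 \<le> a \<and> a \<le> \<eta> \<and>
      (C / \<epsilon> * b\<^sup>2) * (C / \<epsilon> * a) ^ CARD('n) \<le> \<eta> \<and>
      (\<forall>x\<in>cball 0 1. \<forall>y\<in>cball 0 1. dist x y \<le> 2 * C * \<epsilon> \<longrightarrow> dist (g x) (g y) \<le> a \<and> koranyi_dist (g x) (g y) \<le> b)"
    if "C > 0" "\<eta> > 0" for C \<eta> :: real
  proof (rule critical_moduli[OF _ \<theta> _ \<gamma> that])
    fix \<kappa> :: real assume "\<kappa> > 0"
    from \<kappa>[OF this] obtain H K t where *: "0 \<le> H" "0 \<le> K" "0 < t" "K\<^sup>2 * H ^ CARD('n) \<le> \<kappa>"
      "\<forall>x\<in>cball 0 1. \<forall>y\<in>cball 0 1. dist x y \<le> t \<longrightarrow> dist (f x) (f y) \<le> H * dist x y powr \<theta> \<and>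
         koranyi_dist (f x) (f y) \<le> K * dist x y powr \<gamma>" by blast
    have "dist (g x) (g y) \<le> H * dist x y powr \<theta> \<and> koranyi_dist (g x) (g y) \<le> K * dist x y powr \<gamma>"
      if "x \<in> cball 0 1" "y \<in> cball 0 1" "dist x y \<le> t" for x y
      using *(5)[rule_format, of "incl \<sigma> x" "incl \<sigma> y"] that
      by (simp add: g_def norm_incl[OF \<sigma>] dist_incl[OF \<sigma>])
    then show "\<exists>H K t. 0 \<le> H \<and> 0 \<le> K \<and> 0 < t \<and> K\<^sup>2 * H ^ CARD('n) \<le> \<kappa> \<and>
      (\<forall>x\<in>cball 0 1. \<forall>y\<in>cball 0 1. dist x y \<le> t \<longrightarrow> dist (g x) (g y) \<le> H * dist x y powr \<theta> \<and>
         koranyi_dist (g x) (g y) \<le> K * dist x y powr \<gamma>)" using * by blast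
  qed simp
  ultimately show False by (rule no_sphere_embedding[OF card_idx])
qed

lemma embedding_map_inj_on:
  assumes "embedding_map (top_of_set S) euclidean f" shows "inj_on f S"
  using homeomorphic_imp_injective_map[OF assms[unfolded embedding_map_def]] by simp

theorem theorem1p2:
  fixes \<gamma> \<theta> :: real
  assumes "CARD('m::finite) \<ge> CARD('n::finite) + 1"
    and "1 / 2 \<le> \<gamma>"
    and "\<gamma> \<le> (real CARD('n) + 1) / (real CARD('n) + 2)"
    and "\<theta> = (real CARD('n) + 1) / real CARD('n) - 2 * \<gamma> / real CARD('n)"
  shows "\<not> (\<exists>f :: real ^ 'm \<Rightarrow> 'n heis.
            f \<in> holder_plus_class \<gamma> (cball 0 1) heis_metric \<inter>
                holder_class \<theta> (cball 0 1) euclidean_metric \<and>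
            embedding_map (top_of_set (sphere 0 1)) euclidean f)
       \<and> \<not> (\<exists>f :: real ^ 'm \<Rightarrow> 'n heis.
            f \<in> holder_class \<gamma> (cball 0 1) heis_metric \<inter>
                holder_plus_class \<theta> (cball 0 1) euclidean_metric \<and>
            embedding_map (top_of_set (sphere 0 1)) euclidean f)"
proof -
  let ?n = "CARD('n)"
  have \<gamma>0: "\<gamma> \<ge> 0" using assms(2) by simp
  have "2 * \<gamma> < real ?n + 1"
  proof -
    have "2 * \<gamma> \<le> 2 * ((real ?n + 1) / (real ?n + 2))" by (rule mult_left_mono[OF assms(3)]) simp
    also have "\<dots> < real ?n + 1" by (simp add: field_simps add_pos_pos)
    finally show ?thesis .
  qed
  then have \<theta>0: "\<theta> > 0" unfolding assms(4) diff_divide_distrib[symmetric] by simp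
  show ?thesis
  proof (intro conjI notI; elim exE conjE IntE)
    fix f :: "real ^ 'm \<Rightarrow> 'n heis"
    assume f1: "f \<in> holder_plus_class \<gamma> (cball 0 1) heis_metric" and f2: "f \<in> holder_class \<theta> (cball 0 1) euclidean_metric"
      and emb: "embedding_map (top_of_set (sphere 0 1)) euclidean f"
    obtain H where H: "H \<ge> 0" "\<forall>x\<in>cball 0 1. \<forall>y\<in>cball 0 1. dist (f x) (f y) \<le> H * dist x y powr \<theta>"
      using f2 unfolding holder_class_def by auto
    have "\<not> inj_on f (sphere 0 1)"
    proof (rule no_critical_map[OF assms(1,4) \<theta>0 \<gamma>0])
      fix \<kappa> :: real assume \<kappa>: "\<kappa> > 0"
      define c where "c = sqrt (\<kappa> / (H ^ ?n + 1))"
      have H1: "H ^ ?n + 1 > 0" using H by (simp add: add_nonneg_pos)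
      have c: "c > 0" "c\<^sup>2 = \<kappa> / (H ^ ?n + 1)" using \<kappa> H1 by (simp_all add: c_def)
      have "c\<^sup>2 * H ^ ?n \<le> \<kappa>" unfolding c(2) using H1 \<kappa> by (simp add: field_simps)
      moreover obtain t where "t > 0" "\<And>x y. x \<in> cball 0 1 \<Longrightarrow> y \<in> cball 0 1 \<Longrightarrow> dist x y \<le> t \<Longrightarrow>
          mdist heis_metric (f x) (f y) \<le> c * dist x y powr \<gamma>"
        using holder_plus_modulus[OF f1 c(1)] by blast
      ultimately show "\<exists>H K t. 0 \<le> H \<and> 0 \<le> K \<and> 0 < t \<and> K\<^sup>2 * H ^ ?n \<le> \<kappa> \<and>
      (\<forall>x\<in>cball 0 1. \<forall>y\<in>cball 0 1. dist x y \<le> t \<longrightarrow> dist (f x) (f y) \<le> H * dist x y powr \<theta> \<and>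
         koranyi_dist (f x) (f y) \<le> K * dist x y powr \<gamma>)"
        using H c(1) by (intro exI[of _ H] exI[of _ c] exI[of _ t]) auto
    qed
    then show False using embedding_map_inj_on[OF emb] by blast
  next
    fix f :: "real ^ 'm \<Rightarrow> 'n heis"
    assume f1: "f \<in> holder_class \<gamma> (cball 0 1) heis_metric" and f2: "f \<in> holder_plus_class \<theta> (cball 0 1) euclidean_metric"
      and emb: "embedding_map (top_of_set (sphere 0 1)) euclidean f"
    obtain H where H: "H \<ge> 0" "\<forall>x\<in>cball 0 1. \<forall>y\<in>cball 0 1. koranyi_dist (f x) (f y) \<le> H * dist x y powr \<gamma>"
      using f1 unfolding holder_class_def by auto
    have "\<not> inj_on f (sphere 0 1)"
    proof (rule no_critical_map[OF assms(1,4) \<theta>0 \<gamma>0])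
      fix \<kappa> :: real assume \<kappa>: "\<kappa> > 0"
      \<comment> \<open>As \<open>c \<le> 1\<close> and \<open>n \<ge> 1\<close>, its power of order
        \<open>n\<close> is at most \<open>c\<close>.\<close>
      define c where "c = min 1 (\<kappa> / (H\<^sup>2 + 1))"
      have H1: "H\<^sup>2 + 1 > 0" by (simp add: add_nonneg_pos)
      have c: "c > 0" "c \<le> 1" "c \<le> \<kappa> / (H\<^sup>2 + 1)" using \<kappa> H1 by (simp_all add: c_def)
      have "c ^ ?n \<le> c ^ 1" using c by (intro power_decreasing) auto
      then have "H\<^sup>2 * c ^ ?n \<le> H\<^sup>2 * (\<kappa> / (H\<^sup>2 + 1))" using c by (intro mult_left_mono) auto
      also have "\<dots> \<le> \<kappa>" using H1 \<kappa> by (simp add: field_simps)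
      finally have "H\<^sup>2 * c ^ ?n \<le> \<kappa>" .
      moreover obtain t where "t > 0" "\<And>x y. x \<in> cball 0 1 \<Longrightarrow> y \<in> cball 0 1 \<Longrightarrow> dist x y \<le> t \<Longrightarrow>
          mdist euclidean_metric (f x) (f y) \<le> c * dist x y powr \<theta>"
        using holder_plus_modulus[OF f2 c(1)] by blast
      ultimately show "\<exists>H K t. 0 \<le> H \<and> 0 \<le> K \<and> 0 < t \<and> K\<^sup>2 * H ^ ?n \<le> \<kappa> \<and>
      (\<forall>x\<in>cball 0 1. \<forall>y\<in>cball 0 1. dist x y \<le> t \<longrightarrow> dist (f x) (f y) \<le> H * dist x y powr \<theta> \<and>
         koranyi_dist (f x) (f y) \<le> K * dist x y powr \<gamma>)"
        using H c(1) by (intro exI[of _ c] exI[of _ H] exI[of _ t]) auto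
    qed
    then show False using embedding_map_inj_on[OF emb] by blast
  qed
qed

end
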